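(* Let $n$ be odd. Given a bi-infinite trajectory on the double regular $n$-gon surface, with corresponding cutting sequence $s$, the cutting sequence of the trajectory obtained by applying the Veech element $\begin{pmatrix}-1&0\\0&1\end{pmatrix}M_n$ to the double $n$-gon, where $M_n=\begin{pmatrix}1&2\cot(\pi/n)\\0&1\end{pmatrix}$, is the derivation $\mathrm{ksl}(s)$ of the original cutting sequence, i.e. the sequence obtained from $s$ by keeping only its sandwiched letters.
   Context: Surface. Let $n$ be odd. Let $P_U$ be a regular $n$-gon in the plane with unit-length edges whose bottom edge is horizontal with endpoints $(0,0)$ and $(1,0)$. Label the bottom edge $S_1$ and the other edges $S_2,\dots,S_n$ counter-clockwise. Let $P_L$ be the reflection of $P_U$ across its edge $S_n$ (equivalently, the half-turn rotation of $P_U$ about the midpoint of $S_n$), with each edge given the same label as the edge of $P_U$ parallel to it. The double regular $n$-gon surface is the translation surface obtained by identifying, for each $k$, the edge $S_k$ of $P_U$ with the parallel edge $S_k$ of $P_L$ by a translation. Trajectories and cutting sequences. A bi-infinite trajectory is a bi-infinite straight-line path (a geodesic for the flat metric) on the surface that does not pass through the vertices of the polygons. Its cutting sequence is the bi-infinite sequence of labels, in $\{S_1,\dots,S_n\}$, of the edges it crosses, in order. Derivation. A letter of a bi-infinite sequence $s$ is sandwiched if it is preceded and followed by the same letter. The derivation of $s$, written $\mathrm{ksl}(s)$, is the sequence obtained from $s$ by removing all letters except the sandwiched ones, keeping their order. Veech element. The Veech group of the surface is the group of derivatives of its affine diffeomorphisms (orientation-reversing ones allowed) taking cone points to cone points.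 The matrix $\begin{pmatrix}-1&0\\0&1\end{pmatrix}M_n=\begin{pmatrix}-1&-2\cot(\pi/n)\\0&1\end{pmatrix}$ belongs to this group. Applying the Veech element to the double $n$-gon means applying the affine automorphism of the surface with this derivative; it carries each trajectory to a new trajectory on the same surface, whose cutting sequence is read off with the same edge labels.
   Formalization: The trajectory's direction is additionally assumed to lie in the closed sector of angles from -π/n to 0 (either sense of travel); for other directions the claim with this fixed Veech element fails, e.g. for n=5 and a trajectory parallel to S_2 with cutting sequence …S_1S_3S_1S_3…. *)

theory Defs
  imports "HOL-Analysis.Analysis"
begin

section \<open>The double regular \<open>n\<close>-gon surface\<close>

text \<open>Counter-clockwise corners of \<open>P\<^sub>U\<close>: edge \<open>S\<^sub>k\<close> (\<open>1 \<le> k \<le> n\<close>) runs from corner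
  \<open>k - 1\<close> to corner \<open>k\<close> and is the unit vector of angle \<open>2 \<pi> (k - 1) / n\<close>. Corners \<open>0\<close> and \<open>n\<close>
  coincide.\<close>

definition corner_U :: "nat \<Rightarrow> nat \<Rightarrow> real^2" where
  "corner_U n k =
     (\<Sum>j<k. vector [cos (2 * pi * real j / real n), sin (2 * pi * real j / real n)])"

text \<open>Half-turn about the midpoint of \<open>S\<^sub>n\<close>; it takes \<open>P\<^sub>U\<close> to \<open>P\<^sub>L\<close> and each edge of \<open>P\<^sub>U\<close> to
  the parallel edge of \<open>P\<^sub>L\<close>.\<close>

definition half_turn :: "nat \<Rightarrow> real^2 \<Rightarrow> real^2" where
  "half_turn n z = corner_U n (n - 1) + corner_U n n - z"

datatype sheet = Upper | Lower

fun corner :: "nat \<Rightarrow> sheet \<Rightarrow> nat \<Rightarrow> real^2" where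
  "corner n Upper k = corner_U n k"
| "corner n Lower k = half_turn n (corner_U n k)"

definition polygon :: "nat \<Rightarrow> sheet \<Rightarrow> (real^2) set" where
  "polygon n s = convex hull (corner n s ` {..n})"

definition edge :: "nat \<Rightarrow> sheet \<Rightarrow> nat \<Rightarrow> (real^2) set" where
  "edge n s k = closed_segment (corner n s (k - 1)) (corner n s k)"

definition raw_points :: "nat \<Rightarrow> (sheet \<times> (real^2)) set" where
  "raw_points n = {(s, z). z \<in> polygon n s}"

text \<open>The half-turn reverses edges, so the translation taking \<open>S\<^sub>k\<close> of \<open>P\<^sub>U\<close> onto \<open>S\<^sub>k\<close> of
  \<open>P\<^sub>L\<close> takes corner \<open>k - 1\<close> of \<open>P\<^sub>U\<close> to corner \<open>k\<close> of \<open>P\<^sub>L\<close>. It is \<open>0\<close> for \<open>k = n\<close>.\<close>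

definition glue_shift :: "nat \<Rightarrow> nat \<Rightarrow> real^2" where
  "glue_shift n k = corner n Lower k - corner n Upper (k - 1)"

definition glue :: "nat \<Rightarrow> (sheet \<times> (real^2)) rel" where
  "glue n = {((Upper, z), (Lower, z + glue_shift n k)) | z k.
               k \<in> {1..n} \<and> z \<in> edge n Upper k}"

definition ident :: "nat \<Rightarrow> (sheet \<times> (real^2)) rel" where
  "ident n = (glue n \<union> (glue n)\<inverse>)\<^sup>* \<inter> raw_points n \<times> raw_points n"

text \<open>A point of the surface is an equivalence class of points of the two disjoint polygons.\<close>

type_synonym point = "(sheet \<times> (real^2)) set"

definition surface :: "nat \<Rightarrow> point set" where
  "surface n = raw_points n // ident n"

definition cone_points :: "nat \<Rightarrow> point set" where
  "cone_points n = {p \<in> surface n. \<exists>s. \<exists>k\<le>n. (s, corner n s k) \<in> p}"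

definition surface_edge :: "nat \<Rightarrow> nat \<Rightarrow> point set" where
  "surface_edge n k = {p \<in> surface n. \<exists>s. \<exists>z\<in>edge n s k. (s, z) \<in> p}"

text \<open>The point \<open>q\<close> is reached from \<open>p\<close> by a straight segment with displacement \<open>h\<close> lying inside
  one of the (convex) polygons. Away from the cone points this gives the flat charts: if \<open>p\<close> is
  not a cone point then every sufficiently short \<open>h\<close> leads to exactly one \<open>q\<close>. If \<open>p\<close> lies on an
  edge, its two representatives provide the two half-discs around \<open>p\<close>.\<close>

definition displaced :: "point \<Rightarrow> real^2 \<Rightarrow> point \<Rightarrow> bool" where
  "displaced p h q \<longleftrightarrow> (\<exists>s z. (s, z) \<in> p \<and> (s, z + h) \<in> q)"

section \<open>Trajectories and cutting sequences\<close>

text \<open>Trajectories are parametrised with constant, not necessarily unit, velocity \<open>v\<close>.\<close>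

definition trajectory :: "nat \<Rightarrow> real^2 \<Rightarrow> (real \<Rightarrow> point) \<Rightarrow> bool" where
  "trajectory n v \<tau> \<longleftrightarrow> v \<noteq> 0 \<and>
     (\<forall>t. \<tau> t \<in> surface n - cone_points n \<and>
          (\<exists>\<epsilon>>0. \<forall>u. \<bar>u\<bar> < \<epsilon> \<longrightarrow> displaced (\<tau> t) (u *\<^sub>R v) (\<tau> (t + u))))"

text \<open>A bi-infinite sequence has no distinguished starting index, so cutting sequences and
  derivations are relations, determined up to a shift of the index. A trajectory that avoids the
  corners is never parallel to an edge while on it, so each time on an edge is a crossing;
  \<open>c\<close> enumerates these times in order. The label \<open>k\<close> stands for \<open>S\<^sub>k\<close>.\<close>

definition cutting_sequence :: "nat \<Rightarrow> (real \<Rightarrow> point) \<Rightarrow> (int \<Rightarrow> nat) \<Rightarrow> bool" where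
  "cutting_sequence n \<tau> s \<longleftrightarrow>
     (\<exists>c :: int \<Rightarrow> real. strict_mono c \<and>
        range c = {t. \<exists>k\<in>{1..n}. \<tau> t \<in> surface_edge n k} \<and>
        (\<forall>i. s i \<in> {1..n} \<and> \<tau> (c i) \<in> surface_edge n (s i)))"

definition sandwiched :: "(int \<Rightarrow> 'a) \<Rightarrow> int \<Rightarrow> bool" where
  "sandwiched s i \<longleftrightarrow> s (i - 1) = s (i + 1)"

text \<open>\<open>d\<close> is the derivation \<open>ksl(s)\<close>; \<open>j\<close> enumerates the sandwiched positions in order.\<close>

definition ksl :: "(int \<Rightarrow> 'a) \<Rightarrow> (int \<Rightarrow> 'a) \<Rightarrow> bool" where
  "ksl s d \<longleftrightarrow>
     (\<exists>j :: int \<Rightarrow> int. strict_mono j \<and> range j = {i. sandwiched s i} \<and> d = s \<circ> j)"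

section \<open>Affine automorphisms and the Veech element\<close>

text \<open>A bijection preserving the cone points and affine with linear part \<open>A\<close> in the flat charts.
  Continuity and smoothness away from the cone points are contained in the chart condition, and
  continuity at the cone points follows by compactness of the surface. The linear part \<open>A\<close> may
  reverse orientation.\<close>

definition affine_automorphism :: "nat \<Rightarrow> real^2^2 \<Rightarrow> (point \<Rightarrow> point) \<Rightarrow> bool" where
  "affine_automorphism n A \<phi> \<longleftrightarrow>
     bij_betw \<phi> (surface n) (surface n) \<and>
     \<phi> ` cone_points n = cone_points n \<and>
     (\<forall>p \<in> surface n - cone_points n. \<exists>\<epsilon>>0. \<forall>h. \<forall>q \<in> surface n.
        norm h < \<epsilon> \<and> displaced p h q \<longrightarrow> displaced (\<phi> p) (A *v h) (\<phi> q))"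

definition flip :: "real^2^2" where
  "flip = vector [vector [-1, 0], vector [0, 1]]"

definition M :: "nat \<Rightarrow> real^2^2" where
  "M n = vector [vector [1, 2 * cot (pi / real n)], vector [0, 1]]"

text \<open>The sector of directions on which derivation corresponds to \<open>flip ** M n\<close>: the lines of
  angle between \<open>-\<pi>/n\<close> and \<open>0\<close>, travelled in either sense. Its boundary lines are the two
  eigenlines of the matrix. The dihedral symmetries of the surface carry every direction into this
  sector, permuting the labels. In another sector the derivation is the cutting sequence of the
  image under the correspondingly conjugated Veech element, not under \<open>flip ** M n\<close> itself.\<close>

definition standard_sector :: "nat \<Rightarrow> (real^2) set" where
  "standard_sector n =
     {r *\<^sub>R vector [cos \<theta>, sin \<theta>] | r \<theta>. - (pi / real n) \<le> \<theta> \<and> \<theta> \<le> 0}"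

end

theory Submission
  imports Defs
begin

text \<open>In the coordinates along the two eigenlines of the Veech element, \<open>x\<close> along the horizontal one and
  \<open>y\<close> along the other, the element is \<open>(x, y) \<mapsto> (- x, y)\<close> and the sector consists of the directions in
  which \<open>x\<close> and \<open>y\<close> change weakly in opposite senses. The zigzag of horizontal and slanted diagonals cuts
  each polygon into right triangles, and the two triangles along an edge form a rectangle, the box of the
  edge, with the edge as one diagonal. The boxes tile the surface, and the affine automorphism reflects
  every box to itself: this holds for the degenerate box of the bottom edge, since the image of that edge
  is a horizontal segment of length \<open>1\<close> between corners, and it propagates from box to box along the zigzag.
  So the image of a trajectory crosses an edge exactly when the trajectory crosses the other diagonal of the
  box of this edge. A box has the same left as right neighbour and the same upper as lower neighbour, and a
  trajectory in the sector visiting a box crosses its edge exactly once; it crosses the other diagonal, again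
  once, exactly when it leaves the box through the side opposite to that of its entry, that is, when the
  neighbouring letters agree.\<close>

text \<open>The obstacle is that \<open>\<phi>\<close> is given only by its linear part and has to
  be located on the surface. The anchor is the bottom edge: its image is a horizontal segment of
  length 1 stopped by corners at both ends. The horizontal chords cut the surface into cylinders. A
  leaf inside a cylinder never meets a corner, and among the chords, of lengths \<open>ell k\<close>
  for odd \<open>k\<close>, only the bottom edge has length 1. Here the parity of \<open>n\<close>
  enters: the other step of length 1 in the zigzag is the last one, and it is slanted because
  \<open>n - 1\<close> is even. As the linear part is prescribed, no freedom is left and the
  midpoint of the bottom edge is fixed. No topology is put on the surface: unique continuation of
  straight paths, based on local uniqueness and separation for \<open>displaced\<close>, replaces
  continuity arguments. Representing the lower polygon by its half-turn image turns every gluing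
  into a point reflection within one polygon, and one product identity for sines,
  \<open>ell_mult\<close>, is behind its metric relations.\<close>

lemma int_set_enumeration:
  fixes S :: "int set"
  assumes "\<And>i. \<exists>j>i. j \<in> S" "\<And>i. \<exists>j<i. j \<in> S"
  shows "\<exists>e :: int \<Rightarrow> int. strict_mono e \<and> range e = S"
proof -
  define U where "U = {m :: nat. int m \<in> S}"
  define L where "L = {m :: nat. - int m - 1 \<in> S}"
  have "\<exists>m'>m. m' \<in> U" for m
  proof -
    obtain j where "j > int m" "j \<in> S" using assms(1) by blast
    then show ?thesis by (intro exI[of _ "nat j"]) (auto simp: U_def)
  qed
  then have U: "infinite U" by (simp add: infinite_nat_iff_unbounded)
  have "\<exists>m'>m. m' \<in> L" for m
  proof -
    obtain j where "j < - int m - 1" "j \<in> S" using assms(2) by blast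
    then show ?thesis by (intro exI[of _ "nat (- j - 1)"]) (auto simp: L_def)
  qed
  then have L: "infinite L" by (simp add: infinite_nat_iff_unbounded)
  \<comment> \<open>The negative half is the mirror image of the other under
    \<open>m \<mapsto> - m - 1\<close>, so that 0 is used only once.\<close>
  define e where "e m = (if m \<ge> 0 then int (enumerate U (nat m)) else - int (enumerate L (nat (- m - 1))) - 1)" for m
  have "strict_mono e"
  proof (rule strict_monoI)
    fix x y :: int assume "x < y"
    then consider "0 \<le> x" | "x < 0" "0 \<le> y" | "y < 0" by linarith
    then show "e x < e y"
    proof cases
      case 1
      then have "enumerate U (nat x) < enumerate U (nat y)" using \<open>x < y\<close> U by (intro enumerate_mono) auto
      then show ?thesis using 1 \<open>x < y\<close> by (simp add: e_def)
    next
      case 3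
      then have "enumerate L (nat (- y - 1)) < enumerate L (nat (- x - 1))" using \<open>x < y\<close> L by (intro enumerate_mono) auto
      then show ?thesis using 3 \<open>x < y\<close> by (simp add: e_def)
    qed (simp add: e_def)
  qed
  moreover have "range e = S"
  proof (intro subset_antisym subsetI)
    fix y assume "y \<in> range e"
    then obtain m where "y = e m" by blast
    then show "y \<in> S" using enumerate_in_set[OF U] enumerate_in_set[OF L] by (auto simp: e_def U_def L_def)
  next
    fix y assume y: "y \<in> S"
    show "y \<in> range e"
    proof (cases "y \<ge> 0")
      case True
      then obtain m where "enumerate U m = nat y" using enumerate_Ex[OF U, of "nat y"] y by (auto simp: U_def)
      then have "e (int m) = y" using True by (simp add: e_def)
      then show ?thesis by blast
    next
      case False
      then obtain m where "enumerate L m = nat (- y - 1)" using enumerate_Ex[OF L, of "nat (- y - 1)"] y by (auto simp: L_def)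
      then have "e (- int m - 1) = y" using False by (simp add: e_def)
      then show ?thesis by blast
    qed
  qed
  ultimately show ?thesis by blast
qed

locale double_polygon =
  fixes n :: nat
  assumes odd_n: "odd n" and n_ge_3: "n \<ge> 3"
begin

subsection \<open>The regular polygon in eigencoordinates\<close>

abbreviation N :: int where "N \<equiv> int n"

section \<open>Lengths of the diagonals of the regular polygon\<close>

definition \<beta> :: real where "\<beta> = pi / real n"

text \<open>For \<open>0 \<le> k \<le> n\<close> this is the length of the diagonal that spans
  \<open>k\<close> edges of the regular \<open>n\<close>-gon with unit edges.\<close>

definition ell :: "int \<Rightarrow> real" where "ell k = sin (of_int k * \<beta>) / sin \<beta>"

lemma beta_bounds: "0 < \<beta>" "\<beta> < pi / 2"
  using n_ge_3 by (auto simp: \<beta>_def field_simps)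

lemma n_beta: "real n * \<beta> = pi" "of_int N * \<beta> = pi"
  using n_ge_3 by (auto simp: \<beta>_def)

lemma sin_beta_pos: "sin \<beta> > 0" and cos_beta_pos: "cos \<beta> > 0"
  using beta_bounds by (auto intro!: sin_gt_zero cos_gt_zero)

lemma ell_0 [simp]: "ell 0 = 0" and ell_1 [simp]: "ell 1 = 1" and ell_n [simp]: "ell N = 0"
  using sin_beta_pos n_beta by (auto simp: ell_def)

lemma ell_minus: "ell (- k) = - ell k"
  by (simp add: ell_def)

lemma ell_reflect: "ell (N - k) = ell k"
proof -
  have "sin (of_int (N - k) * \<beta>) = sin (of_int k * \<beta>)"
    using n_beta by (simp add: left_diff_distrib sin_diff)
  then show ?thesis by (simp add: ell_def)
qed

lemma ell_pos: "ell k > 0" if "0 < k" "k < N"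
proof -
  have "of_int k * \<beta> < of_int N * \<beta>"
    using that beta_bounds by (intro mult_strict_right_mono) auto
  then have "sin (of_int k * \<beta>) > 0"
    using that n_beta beta_bounds by (intro sin_gt_zero) auto
  then show ?thesis using sin_beta_pos by (simp add: ell_def)
qed

lemma ell_nonneg: "ell k \<ge> 0" if "0 \<le> k" "k \<le> N"
  using ell_pos[of k] that by (cases "k = 0 \<or> k = N") auto

text \<open>Ptolemy's theorem for four corners with \<open>a\<close>, \<open>c\<close>,
  \<open>b\<close> edges between consecutive ones: product of the diagonals minus one product of
  opposite sides is the other such product. As a sine identity it holds for all integers.\<close>

lemma ell_mult: "ell (a + c) * ell (b + c) - ell a * ell b = ell c * ell (a + b + c)"
proof -
  have *: "sin (x + z) * sin (y + z) - sin x * sin y = sin z * sin (x + y + z)" for x y z :: real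
    unfolding sin_add cos_add using sin_cos_squared_add[of z] by algebra
  have "sin (of_int (a + c) * \<beta>) * sin (of_int (b + c) * \<beta>)
      - sin (of_int a * \<beta>) * sin (of_int b * \<beta>)
      = sin (of_int c * \<beta>) * sin (of_int (a + b + c) * \<beta>)"
    using *[of "of_int a * \<beta>" "of_int c * \<beta>" "of_int b * \<beta>"] by (simp add: distrib_right)
  moreover have "ell (a + c) * ell (b + c) - ell a * ell b
     = (sin (of_int (a + c) * \<beta>) * sin (of_int (b + c) * \<beta>)
      - sin (of_int a * \<beta>) * sin (of_int b * \<beta>)) / (sin \<beta>)\<^sup>2"
    "ell c * ell (a + b + c) = sin (of_int c * \<beta>) * sin (of_int (a + b + c) * \<beta>) / (sin \<beta>)\<^sup>2"
    by (simp_all add: ell_def power2_eq_square diff_divide_distrib)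
  ultimately show ?thesis by simp
qed

text \<open>Ptolemy's relation gives \<open>ell k * ell k = 1 + ell (k - 1) * ell (k + 1)\<close>.
  This is what singles out the bottom edge among the horizontal chords.\<close>

lemma ell_gt_1: "ell k > 1" if "1 < k" "k < N - 1"
proof -
  have "ell ((-1) + k) * ell (-1 + N - k) > 0"
    using ell_pos[of "k-1"] ell_pos[of "N-1-k"] that by (simp add: algebra_simps)
  moreover have "ell (-1 + k) * ell (k+1) - ell (-1) * ell 1 = ell k * ell k"
    using ell_mult[of "-1" k 1] by (simp add: add.commute)
  moreover have "ell (k + 1) = ell (-1 + N - k)" using ell_reflect[of "k+1"] by (simp add: algebra_simps)
  ultimately have "ell k * ell k > 1" by (simp add: ell_minus)
  then show ?thesis using ell_nonneg[of k] that
    by (smt (verit, best) mult_left_le)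
qed

text \<open>The corners of \<open>P\<^sub>U\<close> in the zigzag order \<open>0, 1, n - 1, 2, n - 2, \<dots>\<close> (up to the repetition of
  the first and the last one), in the coordinates given by \<open>Lam\<close> below. The step from \<open>zt k\<close> to \<open>zt (k + 1)\<close>
  has length \<open>ell k\<close>; it is horizontal for odd \<open>k\<close> and vertical for even \<open>k\<close>.\<close>

definition zt :: "int \<Rightarrow> real \<times> real" where
  "zt k = (let i = k div 2 in
     (ell i * ell i, if even k then ell i * ell (i - 1) else ell i * ell (i + 1)))"

definition pr :: "int \<Rightarrow> real \<times> real \<Rightarrow> real" where
  "pr k p = (if odd k then fst p else snd p)"

text \<open>\<open>g k p\<close> is the excess of \<open>p\<close> over \<open>zt k\<close> in the direction of the \<open>k\<close>-th step of the zigzag. The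
  \<open>k\<close>-th edge (\<open>0 \<le> k < n\<close>) joins \<open>zt k\<close> to \<open>zt (k + 2)\<close>, and \<open>f k\<close> is positive on its inner side.\<close>

definition g :: "int \<Rightarrow> real \<times> real \<Rightarrow> real" where
  "g k p = pr k p - pr k (zt k)"

definition f :: "int \<Rightarrow> real \<times> real \<Rightarrow> real" where
  "f k p = ell (k + 1) * g k p - ell k * g (k + 1) p"

definition df :: "int \<Rightarrow> real \<times> real \<Rightarrow> real" where
  "df k w = ell (k + 1) * pr k w - ell k * pr (k + 1) w"

lemma zt_even: "zt (2 * i) = (ell i * ell i, ell i * ell (i - 1))"
  and zt_odd: "zt (2 * i + 1) = (ell i * ell i, ell i * ell (i + 1))"
  by (simp_all add: zt_def)

lemma pr_add: "pr k (p + q) = pr k p + pr k q"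
  and pr_diff: "pr k (p - q) = pr k p - pr k q"
  and pr_scale: "pr k (t *\<^sub>R p) = t * pr k p"
  and pr_plus_2: "pr (k + 2) p = pr k p"
  by (simp_all add: pr_def)

lemma pr_eqI: "p = q" if "pr k p = pr k q" "pr (k + 1) p = pr (k + 1) q"
  using that by (auto simp: pr_def prod_eq_iff split: if_splits)

lemma zt_0_1: "zt 0 = (0, 0)" "zt 1 = (0, 0)" "zt 2 = (1, 0)" "zt 3 = (1, ell 2)"
  using zt_even[of 0] zt_odd[of 0] zt_even[of 1] zt_odd[of 1] by simp_all

lemma zt_n: "zt (N + 1) = zt N"
proof -
  obtain m where m: "n = 2 * m + 1" using odd_n by (rule oddE)
  have "ell (int m + 1) = ell (int m)" using ell_reflect[of "int m"] m by (simp add: algebra_simps)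
  then show ?thesis using m zt_odd[of "int m"] zt_even[of "int m + 1"] by (simp add: algebra_simps)
qed

lemma pr_zt_step: "pr k (zt (k + 1)) = pr k (zt k) + ell k"
  and pr_zt_step': "pr (k + 1) (zt (k + 1)) = pr (k + 1) (zt k)"
proof -
  show "pr k (zt (k + 1)) = pr k (zt k) + ell k"
  proof (cases "even k")
    case True
    then obtain i where k: "k = 2 * i" by (elim evenE)
    show ?thesis using ell_mult[of i 1 "i-1"] unfolding k pr_def zt_even zt_odd
      by (simp add: algebra_simps)
  next
    case False
    then obtain i where k: "k = 2 * i + 1" by (elim oddE)
    have e: "k + 1 = 2 * (i + 1)" using k by simp
    show ?thesis using ell_mult[of i 1 i] unfolding e zt_even unfolding k pr_def zt_odd
      by (simp add: algebra_simps)
  qed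
  show "pr (k + 1) (zt (k + 1)) = pr (k + 1) (zt k)"
  proof (cases "even k")
    case True
    then obtain i where k: "k = 2 * i" by (elim evenE)
    show ?thesis unfolding k pr_def zt_even zt_odd
      by (simp add: algebra_simps)
  next
    case False
    then obtain i where k: "k = 2 * i + 1" by (elim oddE)
    have e: "k + 1 = 2 * (i + 1)" using k by simp
    show ?thesis unfolding e zt_even unfolding k pr_def zt_odd
      by (simp add: algebra_simps)
  qed
qed

text \<open>Of the two steps from \<open>zt k\<close> to \<open>zt (k + 2)\<close> only the first
  moves in the direction measured by \<open>g k\<close>. The recursion lets neighbouring boxes be
  described in the same two coordinates.\<close>

lemma g_rec: "g (k + 2) p = g k p - ell k"
  using pr_zt_step[of k] pr_zt_step'[of "k + 1"] by (simp add: g_def pr_plus_2 add.assoc)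

lemma g_zt:
  "g k (zt k) = 0" "g k (zt (k + 1)) = ell k" "g k (zt (k + 2)) = ell k"
  "g (k + 1) (zt k) = 0" "g (k + 1) (zt (k + 1)) = 0" "g (k + 1) (zt (k + 2)) = ell (k + 1)"
  using pr_zt_step[of k] pr_zt_step'[of k] pr_zt_step[of "k + 1"] pr_zt_step'[of "k + 1"]
  by (simp_all add: g_def pr_plus_2 add.assoc)

lemma g_move: "g k (p + t *\<^sub>R w) = g k p + t * pr k w"
  by (simp add: g_def pr_add pr_scale)

lemma f_move: "f k (p + t *\<^sub>R w) = f k p + t * df k w"
  by (simp add: f_def df_def g_move algebra_simps)

lemma df_scale: "df k (t *\<^sub>R w) = t * df k w"
  by (simp add: df_def pr_scale algebra_simps)

lemma g_eqI: "p = q" if "g k p = g k q" "g (k + 1) p = g (k + 1) q"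
  using that pr_eqI[of k p q] by (simp add: g_def)

lemma g_affine: "a + b = 1 \<Longrightarrow> g k (a *\<^sub>R p + b *\<^sub>R q) = a * g k p + b * g k q"
  by (simp add: g_def pr_add pr_scale algebra_simps flip: distrib_right)

lemma f_affine: "a + b = 1 \<Longrightarrow> f k (a *\<^sub>R p + b *\<^sub>R q) = a * f k p + b * f k q"
  by (simp add: f_def g_affine algebra_simps)

lemma g_affine3: "a + b + c = 1 \<Longrightarrow>
    g k (a *\<^sub>R p + b *\<^sub>R q + c *\<^sub>R r) = a * g k p + b * g k q + c * g k r"
proof -
  assume "a + b + c = 1"
  then have "c = 1 - a - b" by simp
  then show ?thesis by (simp only: g_def pr_add pr_scale) (simp add: algebra_simps)
qed

lemma f_affine3: "a + b + c = 1 \<Longrightarrow>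
    f k (a *\<^sub>R p + b *\<^sub>R q + c *\<^sub>R r) = a * f k p + b * f k q + c * f k r"
  by (simp only: f_def g_affine3) (simp add: algebra_simps)

text \<open>By the inscribed angle theorem every other corner sees an edge under the angle
  \<open>\<beta>\<close>. Computing the triangle's area twice, its distance from the edge is
  \<open>sin \<beta>\<close> times the product of its distances to the two ends. So \<open>f\<close>
  is the distance divided by \<open>sin \<beta>\<close>. Here the corner index has the parity of
  \<open>j\<close>; \<open>f_zt_opp\<close> treats the other parity.\<close>

lemma f_zt_same: "f j (zt (j + 2 * r)) = ell r * ell (r - 1)"
proof (cases "even j")
  case True
  then obtain u where j: "j = 2 * u" by (elim evenE)
  have e: "j + 2 * r = 2 * (u + r)" "j + 1 = 2 * u + 1" using j by simp_all
  have "ell (2 * u + 1) * ell (1 - 2 * u - r) + ell (2 * u) * ell (2 * u + r) = - ell (r - 1)"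
    using ell_mult[of "2*u" 1 "-(2 * u + r)"] ell_minus[of "2 * u + r"] ell_minus[of "r - 1"]
    by (simp add: algebra_simps)
  moreover have "ell (1 - 2 * u - r) = - ell (2 * u + r - 1)"
    using ell_minus[of "2 * u + r - 1"] by (simp add: algebra_simps)
  ultimately have 1: "ell (2 * u + 1) * ell (2 * u + r - 1) - ell (2 * u) * ell (2 * u + r) = ell (r - 1)"
    by simp
  have "g j (zt (j + 2 * r)) = ell r * ell (2 * u + r - 1)"
    using ell_mult[of u r "u - 1"] unfolding e zt_even g_def pr_def unfolding j zt_even
    by (simp add: algebra_simps)
  moreover have "g (j + 1) (zt (j + 2 * r)) = ell r * ell (2 * u + r)"
    using ell_mult[of u r u] unfolding e zt_even g_def pr_def unfolding j zt_odd
    by (simp add: algebra_simps)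
  ultimately have "f j (zt (j + 2 * r)) = ell r *
     (ell (2 * u + 1) * ell (2 * u + r - 1) - ell (2 * u) * ell (2 * u + r))"
    unfolding f_def by (simp add: j algebra_simps)
  then show ?thesis using 1 by simp
next
  case False
  then obtain u where j: "j = 2 * u + 1" by (elim oddE)
  have e: "j + 2 * r = 2 * (u + r) + 1" "j + 1 = 2 * (u + 1)" using j by simp_all
  have "ell (2 * u + 2) * ell (- (2 * u + r)) - ell (2 * u + 1) * ell (- (2 * u + r + 1)) = ell 1 * ell (- (r - 1))"
  proof -
    have "2 * u + 2 = 2 * u + 1 + 1" "- (2 * u + r) = - (2 * u + r + 1) + 1"
      "- (r - 1) = (2 * u + 1) + (- (2 * u + r + 1)) + 1" by simp_all
    then show ?thesis using ell_mult[of "2*u+1" 1 "-(2 * u + r + 1)"] by metis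
  qed
  then have 1: "ell (2 * u + 2) * ell (2 * u + r) - ell (2 * u + 1) * ell (2 * u + r + 1) = ell (r - 1)"
    unfolding ell_minus by simp
  have "g j (zt (j + 2 * r)) = ell r * ell (2 * u + r)"
    using ell_mult[of u r u] unfolding e zt_odd g_def pr_def unfolding j zt_odd
    by (simp add: algebra_simps)
  moreover have "g (j + 1) (zt (j + 2 * r)) = ell r * ell (2 * u + r + 1)"
    using ell_mult[of u r "u+1"] unfolding e zt_odd g_def pr_def zt_even
    by (simp add: algebra_simps)
  ultimately have "f j (zt (j + 2 * r)) = ell r *
     (ell (2 * u + 2) * ell (2 * u + r) - ell (2 * u + 1) * ell (2 * u + r + 1))"
    unfolding f_def by (simp add: j algebra_simps)
  then show ?thesis using 1 by simp
qed

lemma f_zt_opp: "f j (zt (2 * a + 1 - j)) = ell a * ell (a + 1)"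
proof (cases "even j")
  case True
  then obtain u where j: "j = 2 * u" by (elim evenE)
  have e: "2 * a + 1 - j = 2 * (a - u) + 1" "j + 1 = 2 * u + 1" using j by simp_all
  have "g j (zt (2 * a + 1 - j)) = ell a * ell (a - 2 * u + 1)"
    using ell_mult[of "a - u" u "a - u + 1"] ell_mult[of "- u" a "1 - u"] ell_minus[of u] ell_minus[of "u - 1"]
    unfolding e zt_odd g_def pr_def unfolding j zt_even
    by (simp add: algebra_simps)
  moreover have "g (j + 1) (zt (2 * a + 1 - j)) = ell a * ell (a - 2 * u)"
    using ell_mult[of "- u" a "- u"] ell_minus[of u]
    unfolding e zt_odd g_def pr_def unfolding j zt_odd
    by (simp add: algebra_simps)
  ultimately have "f j (zt (2 * a + 1 - j)) = ell a *
     (ell (2 * u + 1) * ell (a - 2 * u + 1) - ell (2 * u) * ell (a - 2 * u))"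
    unfolding f_def by (simp add: j algebra_simps)
  then show ?thesis using ell_mult[of "2*u" 1 "a - 2*u"] by (simp add: algebra_simps)
next
  case False
  then obtain u where j: "j = 2 * u + 1" by (elim oddE)
  have e: "2 * a + 1 - j = 2 * (a - u)" "j + 1 = 2 * (u + 1)" using j by simp_all
  have "g j (zt (2 * a + 1 - j)) = ell a * ell (a - 2 * u)"
    using ell_mult[of "- u" a "- u"] ell_minus[of u]
    unfolding e zt_even g_def pr_def unfolding j zt_odd
    by (simp add: algebra_simps)
  moreover have m1: "ell (- u - 1) = - ell (u + 1)" using ell_minus[of "u + 1"] by simp
  have "g (j + 1) (zt (2 * a + 1 - j)) = ell a * ell (a - 2 * u - 1)"
    using ell_mult[of "- u" a "- u - 1"] ell_minus[of u] m1
    unfolding e zt_even g_def pr_def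
    by (simp add: algebra_simps)
  ultimately have "f j (zt (2 * a + 1 - j)) = ell a *
     (ell (2 * u + 2) * ell (a - 2 * u) - ell (2 * u + 1) * ell (a - 2 * u - 1))"
    unfolding f_def by (simp add: j algebra_simps)
  then show ?thesis using ell_mult[of "2*u + 1" 1 "a - 2*u - 1"] by (simp add: algebra_simps)
qed

text \<open>The last two cases come from \<open>zt 0 = zt 1\<close> and \<open>zt n = zt (n + 1)\<close>.\<close>

definition incident :: "int \<Rightarrow> int \<Rightarrow> bool" where
  "incident j m \<longleftrightarrow> m = j \<or> m = j + 2 \<or> m + j = 1 \<or> m + j = 2 * N - 1"

text \<open>In this index range the two factors of the product formulas never have opposite signs,
  and a factor vanishes exactly when the corner is an end of the edge.\<close>

lemma f_zt:
  assumes "0 \<le> j" "j < N" "0 \<le> m" "m \<le> N + 1"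
  shows "f j (zt m) \<ge> 0" "f j (zt m) = 0 \<longleftrightarrow> incident j m"
proof -
  have "f j (zt m) \<ge> 0 \<and> (f j (zt m) = 0 \<longleftrightarrow> incident j m)"
  proof (cases "even (m - j)")
    case True
    then obtain r where r: "m - j = 2 * r" by (elim evenE)
    have m: "m = j + 2 * r" using r by simp
    have eq: "f j (zt m) = ell r * ell (r - 1)" unfolding m f_zt_same ..
    have inc: "incident j m \<longleftrightarrow> r = 0 \<or> r = 1"
      unfolding incident_def m using assms(1-4) by presburger
    show ?thesis
    proof (cases "r \<ge> 1")
      case True
      have "r < N" using m assms n_ge_3 by linarith
      then have "ell r > 0" "r > 1 \<Longrightarrow> ell (r - 1) > 0" using True ell_pos by auto
      then show ?thesis using True eq inc by (cases "r = 1") auto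
    next
      case False
      have "- r + 1 < N" using m assms n_ge_3 by linarith
      then have "ell (- r + 1) > 0" "r < 0 \<Longrightarrow> ell (- r) > 0" using False ell_pos by auto
      moreover have "ell (r - 1) = - ell (- r + 1)" "ell r = - ell (- r)"
        using ell_minus[of "r - 1"] ell_minus[of r] by simp_all
      ultimately show ?thesis using False eq inc by (cases "r = 0") auto
    qed
  next
    case False
    then have "odd (m + j)" by presburger
    then obtain a where "m + j = 2 * a + 1" by (elim oddE)
    then have m: "m = 2 * a + 1 - j" by simp
    have eq: "f j (zt m) = ell a * ell (a + 1)" unfolding m f_zt_opp ..
    have b: "0 \<le> a" "a \<le> N - 1" using m assms by auto
    have inc: "incident j m \<longleftrightarrow> a = 0 \<or> a = N - 1"
      unfolding incident_def m using assms(1-4) by presburger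
    show ?thesis
    proof (cases "a = 0 \<or> a = N - 1")
      case True
      then show ?thesis using eq inc by auto
    next
      case False
      then have "ell a > 0" "ell (a + 1) > 0" using b ell_pos by auto
      then show ?thesis using False eq inc by auto
    qed
  qed
  then show "f j (zt m) \<ge> 0" "f j (zt m) = 0 \<longleftrightarrow> incident j m" by auto
qed

section \<open>The polygon as an intersection of half-planes and as a chain of triangles\<close>

definition P :: "(real \<times> real) set" where
  "P = {p. \<forall>j\<in>{0..<N}. f j p \<ge> 0}"

text \<open>The half of the box of edge \<open>k\<close> inside the polygon: edge \<open>k\<close>
  is its long side, the steps \<open>k\<close> and \<open>k + 1\<close> of the zigzag are the other
  two.\<close>

definition tri :: "int \<Rightarrow> (real \<times> real) set" where
  "tri k = {p. g (k + 1) p \<ge> 0 \<and> g (k + 2) p \<le> 0 \<and> f k p \<ge> 0}"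

text \<open>Being on at most one edge is the form that makes the gluing partner of a point unique;
  \<open>reg_iff\<close> identifies these points with the points other than corners.\<close>

definition reg :: "(real \<times> real) \<Rightarrow> bool" where
  "reg p \<longleftrightarrow> p \<in> P \<and> (\<forall>i\<in>{0..<N}. \<forall>j\<in>{0..<N}. f i p = 0 \<and> f j p = 0 \<longrightarrow> i = j)"

lemma zt_P: "0 \<le> m \<Longrightarrow> m \<le> N + 1 \<Longrightarrow> zt m \<in> P"
  using f_zt by (auto simp: P_def)

text \<open>Edge \<open>0\<close> forces \<open>g 2 p \<ge> 0\<close> and the last edge forces
  \<open>g N p \<le> 0\<close>, so the sign changes somewhere between two consecutive indices; the
  last index with a nonnegative value locates the triangle.\<close>

lemma P_cover:
  assumes "p \<in> P"
  obtains k where "1 \<le> k" "k \<le> N - 2" "p \<in> tri k"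
proof -
  have f: "f j p \<ge> 0" if "0 \<le> j" "j < N" for j
    using assms that by (auto simp: P_def)
  have "g 2 p \<ge> 0" using f[of 0] n_ge_3 g_rec[of 0 p] by (simp add: f_def)
  moreover have "g N p \<le> 0"
  proof -
    have "ell (N - 1) > 0" using n_ge_3 by (intro ell_pos) auto
    then show ?thesis using f[of "N - 1"] n_ge_3 by (simp add: f_def mult_le_0_iff)
  qed
  ultimately have "\<exists>i\<ge>2. i < n \<and> g (int i) p \<ge> 0 \<and> g (int i + 1) p \<le> 0"
  proof -
    assume a: "g 2 p \<ge> 0" "g N p \<le> 0"
    define i where "i = Max {i. 2 \<le> i \<and> i < n \<and> g (int i) p \<ge> 0}"
    have fin: "finite {i. 2 \<le> i \<and> i < n \<and> g (int i) p \<ge> 0}" by simp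
    have ne: "2 \<in> {i. 2 \<le> i \<and> i < n \<and> g (int i) p \<ge> 0}" using a n_ge_3 by auto
    have i: "i \<in> {i. 2 \<le> i \<and> i < n \<and> g (int i) p \<ge> 0}"
      unfolding i_def using fin ne by (intro Max_in) auto
    have "g (int i + 1) p \<le> 0"
    proof (rule ccontr)
      assume *: "\<not> ?thesis"
      then have "i + 1 \<noteq> n" using a by (metis of_nat_Suc add.commute Suc_eq_plus1)
      then have "i + 1 \<in> {i. 2 \<le> i \<and> i < n \<and> g (int i) p \<ge> 0}" using i * by (auto simp: algebra_simps)
      then have "i + 1 \<le> i" using Max_ge[OF fin] i_def by blast
      then show False by simp
    qed
    then show ?thesis using i by auto
  qed
  then obtain i where i: "i \<ge> 2" "i < n" "g (int i) p \<ge> 0" "g (int i + 1) p \<le> 0" by blast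
  show ?thesis
    by (rule that[of "int i - 1"]) (use i f[of "int i - 1"] in \<open>auto simp: tri_def algebra_simps\<close>)
qed

lemma tri_bounds:
  assumes "p \<in> tri k" "1 \<le> k" "k \<le> N - 2"
  shows "0 \<le> g k p" "g k p \<le> ell k" "0 \<le> g (k + 1) p" "g (k + 1) p \<le> ell (k + 1)"
proof -
  have e: "ell k > 0" "ell (k + 1) > 0" using assms by (auto intro: ell_pos)
  have *: "g (k + 1) p \<ge> 0" "g k p \<le> ell k" "ell (k + 1) * g k p \<ge> ell k * g (k + 1) p"
    using assms g_rec[of k p] by (auto simp: tri_def f_def)
  show "0 \<le> g (k + 1) p" "g k p \<le> ell k" by fact+
  have "ell k * g (k + 1) p \<ge> 0" using * e by simp
  then have "ell (k + 1) * g k p \<ge> 0" using * by linarith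
  then show "0 \<le> g k p" using e by (simp add: zero_le_mult_iff)
  have "ell (k + 1) * g k p \<le> ell (k + 1) * ell k"
    using *(2) e by (intro mult_left_mono) auto
  then have "ell k * g (k + 1) p \<le> ell k * ell (k + 1)"
    using *(3) by (simp add: mult.commute)
  then show "g (k + 1) p \<le> ell (k + 1)" using e by simp
qed

lemma tri_barycentric:
  assumes "p \<in> tri k" "1 \<le> k" "k \<le> N - 2"
  obtains a b c where "a \<ge> 0" "b \<ge> 0" "c \<ge> 0" "a + b + c = 1"
    "p = a *\<^sub>R zt k + b *\<^sub>R zt (k + 1) + c *\<^sub>R zt (k + 2)"
proof -
  have e: "ell k > 0" "ell (k + 1) > 0" using assms by (auto intro: ell_pos)
  note B = tri_bounds[OF assms]
  \<comment> \<open>On the three corners the pair \<open>g k\<close>, \<open>g (k + 1)\<close> takes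
    the values \<open>(0, 0)\<close>, \<open>(ell k, 0)\<close>,
    \<open>(ell k, ell (k + 1))\<close>; the weights solve the resulting system.\<close>
  define c where "c = g (k + 1) p / ell (k + 1)"
  define a where "a = 1 - g k p / ell k"
  define b where "b = g k p / ell k - g (k + 1) p / ell (k + 1)"
  have s: "a + b + c = 1" by (simp add: a_def b_def c_def)
  have "b = f k p / (ell k * ell (k + 1))" using e by (simp add: b_def f_def field_simps)
  then have "b \<ge> 0" using assms e by (simp add: tri_def)
  moreover have "a \<ge> 0" "c \<ge> 0" using B e by (auto simp: a_def c_def field_simps)
  moreover have "p = a *\<^sub>R zt k + b *\<^sub>R zt (k + 1) + c *\<^sub>R zt (k + 2)"
  proof (rule g_eqI[of k])
    have "g k (a *\<^sub>R zt k + b *\<^sub>R zt (k + 1) + c *\<^sub>R zt (k + 2)) = (b + c) * ell k"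
      by (simp only: g_affine3[OF s] g_zt) (simp add: algebra_simps)
    also have "\<dots> = g k p" using e by (simp add: b_def c_def)
    finally show "g k p = g k (a *\<^sub>R zt k + b *\<^sub>R zt (k + 1) + c *\<^sub>R zt (k + 2))" ..
    have "g (k + 1) (a *\<^sub>R zt k + b *\<^sub>R zt (k + 1) + c *\<^sub>R zt (k + 2)) = c * ell (k + 1)"
      by (simp only: g_affine3[OF s] g_zt)
    also have "\<dots> = g (k + 1) p" using e by (simp add: c_def)
    finally show "g (k + 1) p = g (k + 1) (a *\<^sub>R zt k + b *\<^sub>R zt (k + 1) + c *\<^sub>R zt (k + 2))" ..
  qed
  ultimately show ?thesis using that s by blast
qed

lemma convex_P: "convex P"
proof (rule convexI)
  fix x y u v assume *: "x \<in> P" "y \<in> P" "0 \<le> u" "0 \<le> v" "u + v = (1::real)"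
  then show "u *\<^sub>R x + v *\<^sub>R y \<in> P" by (auto simp: P_def f_affine)
qed

lemma P_hull: "P = convex hull (zt ` {1..N})"
proof
  have *: "zt m \<in> zt ` {1..N}" if "0 \<le> m" "m \<le> N + 1" for m
  proof -
    have "zt 0 = zt 1" "zt (N + 1) = zt N" "1 \<in> {1..N}" "N \<in> {1..N}"
      using zt_0_1 zt_n n_ge_3 by auto
    moreover have "m = 0 \<or> m = N + 1 \<or> (1 \<le> m \<and> m \<le> N)" using that by linarith
    ultimately show ?thesis by (metis atLeastAtMost_iff imageI)
  qed
  show "P \<subseteq> convex hull (zt ` {1..N})"
  proof
    fix p assume "p \<in> P"
    then obtain k where k: "1 \<le> k" "k \<le> N - 2" "p \<in> tri k" by (rule P_cover)
    obtain a b c where abc: "a \<ge> 0" "b \<ge> 0" "c \<ge> 0" "a + b + c = 1"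
      "p = a *\<^sub>R zt k + b *\<^sub>R zt (k + 1) + c *\<^sub>R zt (k + 2)"
      using tri_barycentric[OF k(3,1,2)] by blast
    have "p \<in> convex hull {zt k, zt (k + 1), zt (k + 2)}"
      unfolding convex_hull_3 using abc by blast
    also have "\<dots> \<subseteq> convex hull (zt ` {1..N})"
      by (rule hull_mono) (use k * in auto)
    finally show "p \<in> convex hull (zt ` {1..N})" .
  qed
  show "convex hull (zt ` {1..N}) \<subseteq> P"
    by (rule hull_minimal) (use zt_P convex_P in force)+
qed

lemma tri_subset_P: assumes "1 \<le> k" "k \<le> N - 2" shows "tri k \<subseteq> P"
proof
  fix p assume "p \<in> tri k"
  then obtain a b c where abc: "a \<ge> 0" "b \<ge> 0" "c \<ge> 0" "a + b + c = 1"
    "p = a *\<^sub>R zt k + b *\<^sub>R zt (k + 1) + c *\<^sub>R zt (k + 2)"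
    using tri_barycentric assms by blast
  have "f j p \<ge> 0" if "j \<in> {0..<N}" for j
    unfolding abc(5) f_affine3[OF abc(4)]
    by (intro add_nonneg_nonneg mult_nonneg_nonneg abc f_zt) (use that assms in auto)
  then show "p \<in> P" by (simp add: P_def)
qed

lemma incident_edge:
  assumes "incident j m" "0 \<le> j" "j < N" "0 \<le> m" "m \<le> N + 1"
  shows "zt m = zt j \<or> zt m = zt (j + 2)"
proof -
  consider "m = j" | "m = j + 2" | "m = 1" "j = 0" | "m = 0" "j = 1" | "m = N" "j = N - 1" | "m = N + 1" "j = N - 2"
    using assms unfolding incident_def by smt
  then show ?thesis
  proof cases
    case 5
    then have "j + 2 = N + 1" by simp
    then show ?thesis using 5 zt_n by metis
  next
    case 6
    then have "j + 2 = N" by simp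
    then show ?thesis using 6 zt_n by metis
  qed (use zt_0_1 in auto)
qed

lemma incident_both:
  assumes "incident i a" "incident i b" "a < b" "1 \<le> a" "b \<le> N" "0 \<le> i" "i < N"
  shows "b = a + 2 \<and> i = a \<or> a = 1 \<and> b = 2 \<and> i = 0 \<or> a = N - 1 \<and> b = N \<and> i = N - 1"
proof -
  define K where "K = N"
  have "K \<ge> 3" using n_ge_3 by (simp add: K_def)
  have a: "a = i \<or> a = i + 2 \<or> a = 1 - i \<or> a = 2 * K - 1 - i"
   "b = i \<or> b = i + 2 \<or> b = 1 - i \<or> b = 2 * K - 1 - i"
    using assms unfolding incident_def K_def by auto
  show ?thesis using \<open>K \<ge> 3\<close> a assms(3-7) unfolding K_def[symmetric] by smt
qed

lemma incident_unique:
  assumes "incident i a" "incident i b" "incident j a" "incident j b"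
    "a < b" "1 \<le> a" "b \<le> N" "0 \<le> i" "i < N" "0 \<le> j" "j < N"
  shows "i = j"
  using incident_both[of i a b] incident_both[of j a b] assms n_ge_3 by force

text \<open>\<open>f j p\<close> is the weighted mean of nonnegative values at the corners, so where
  it vanishes every corner of positive weight lies on edge \<open>j\<close>.\<close>

lemma tri_coefficients:
  assumes "p \<in> tri k" "1 \<le> k" "k \<le> N - 2"
  obtains a b c where "a \<ge> 0" "b \<ge> 0" "c \<ge> 0" "a + b + c = 1"
    "p = a *\<^sub>R zt k + b *\<^sub>R zt (k + 1) + c *\<^sub>R zt (k + 2)"
    "\<And>j. 0 \<le> j \<Longrightarrow> j < N \<Longrightarrow> f j p = 0 \<Longrightarrow>
       (a = 0 \<or> incident j k) \<and> (b = 0 \<or> incident j (k + 1)) \<and> (c = 0 \<or> incident j (k + 2))"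
proof -
  obtain a b c where abc: "a \<ge> 0" "b \<ge> 0" "c \<ge> 0" "a + b + c = 1"
    "p = a *\<^sub>R zt k + b *\<^sub>R zt (k + 1) + c *\<^sub>R zt (k + 2)"
    using tri_barycentric[OF assms] by blast
  have "(a = 0 \<or> incident j k) \<and> (b = 0 \<or> incident j (k + 1)) \<and> (c = 0 \<or> incident j (k + 2))"
    if j: "0 \<le> j" "j < N" "f j p = 0" for j
  proof -
    have pos: "f j (zt k) \<ge> 0" "f j (zt (k + 1)) \<ge> 0" "f j (zt (k + 2)) \<ge> 0"
      using f_zt(1) assms(2,3) j by auto
    have "a * f j (zt k) + b * f j (zt (k + 1)) + c * f j (zt (k + 2)) = 0"
      using j(3) unfolding abc(5) f_affine3[OF abc(4)] .
    moreover have "a * f j (zt k) \<ge> 0" "b * f j (zt (k + 1)) \<ge> 0" "c * f j (zt (k + 2)) \<ge> 0"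
      using abc(1-3) pos by simp_all
    ultimately have "a * f j (zt k) = 0" "b * f j (zt (k + 1)) = 0" "c * f j (zt (k + 2)) = 0"
      by linarith+
    then show ?thesis using f_zt(2)[of j] j assms(2,3) by auto
  qed
  then show thesis using that[OF abc] by blast
qed

text \<open>Away from the corners at least two weights are positive. Since two corners determine an
  edge, this bounds the number of edges through \<open>p\<close> by one.\<close>

lemma tri_two_vertices:
  assumes "p \<in> tri k" "1 \<le> k" "k \<le> N - 2" "p \<noteq> zt k" "p \<noteq> zt (k + 1)" "p \<noteq> zt (k + 2)"
  obtains l m where "k \<le> l" "l < m" "m \<le> k + 2"
    "\<And>j. 0 \<le> j \<Longrightarrow> j < N \<Longrightarrow> f j p = 0 \<Longrightarrow> incident j l \<and> incident j m"
proof -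
  obtain a b c where abc: "a + b + c = 1" "p = a *\<^sub>R zt k + b *\<^sub>R zt (k + 1) + c *\<^sub>R zt (k + 2)"
    "\<And>j. 0 \<le> j \<Longrightarrow> j < N \<Longrightarrow> f j p = 0 \<Longrightarrow>
       (a = 0 \<or> incident j k) \<and> (b = 0 \<or> incident j (k + 1)) \<and> (c = 0 \<or> incident j (k + 2))"
  proof (rule tri_coefficients[OF assms(1-3)], goal_cases)
    case (1 a b c)
    show ?case by (rule 1(1)[OF 1(5,6,7)])
  qed
  have "\<not> (b = 0 \<and> c = 0)" "\<not> (a = 0 \<and> c = 0)" "\<not> (a = 0 \<and> b = 0)"
    using abc(1,2) assms(4-6) by auto
  then consider "a \<noteq> 0" "b \<noteq> 0" | "a \<noteq> 0" "c \<noteq> 0" | "b \<noteq> 0" "c \<noteq> 0" by blast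
  then show thesis
  proof cases
    case 1
    show thesis by (rule that[of k "k + 1"]) (use 1 abc(3) in auto)
  next
    case 2
    show thesis by (rule that[of k "k + 2"]) (use 2 abc(3) in auto)
  next
    case 3
    show thesis by (rule that[of "k + 1" "k + 2"]) (use 3 abc(3) in auto)
  qed
qed

subsection \<open>Points of the surface\<close>

definition sig :: "int \<Rightarrow> real \<times> real \<Rightarrow> real \<times> real" where
  "sig k p = zt k + zt (k + 2) - p"

lemma sig_sig [simp]: "sig k (sig k p) = p"
  by (simp add: sig_def)

lemma sig_zt: "sig k (zt k) = zt (k + 2)" "sig k (zt (k + 2)) = zt k"
  by (simp_all add: sig_def)

lemma sig_add: "sig k (p + w) = sig k p - w"
  by (simp add: sig_def)

lemma g_sig: "g k (sig k p) = ell k - g k p" "g (k + 1) (sig k p) = ell (k + 1) - g (k + 1) p"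
  using g_zt[of k] by (simp_all add: g_def sig_def pr_add pr_diff)

lemma f_sig: "f k (sig k p) = - f k p"
  unfolding f_def g_sig by (simp add: algebra_simps)

lemma f_zt_ends: "f k (zt k) = 0" "f k (zt (k + 2)) = 0"
  by (simp_all add: f_def g_zt)

lemma edge_segment:
  assumes "0 \<le> j" "j < N"
  shows "{p \<in> P. f j p = 0} = closed_segment (zt j) (zt (j + 2))" (is "_ = ?S")
proof
  show "?S \<subseteq> {p \<in> P. f j p = 0}"
  proof
    fix p assume p: "p \<in> ?S"
    then have "p \<in> P"
      using closed_segment_subset[OF _ _ convex_P, of "zt j" "zt (j + 2)"] zt_P assms by auto
    moreover from p obtain u where "p = (1 - u) *\<^sub>R zt j + u *\<^sub>R zt (j + 2)"
      by (auto simp: closed_segment_def)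
    then have "f j p = 0" by (simp add: f_affine f_zt_ends)
    ultimately show "p \<in> {p \<in> P. f j p = 0}" by simp
  qed
  show "{p \<in> P. f j p = 0} \<subseteq> ?S"
  proof
    fix p assume "p \<in> {p \<in> P. f j p = 0}"
    then have p: "p \<in> P" "f j p = 0" by auto
    then obtain k where k: "1 \<le> k" "k \<le> N - 2" "p \<in> tri k" using P_cover by blast
    obtain a b c where abc: "a \<ge> 0" "b \<ge> 0" "c \<ge> 0" "a + b + c = 1"
      "p = a *\<^sub>R zt k + b *\<^sub>R zt (k + 1) + c *\<^sub>R zt (k + 2)"
      and "\<And>i. 0 \<le> i \<Longrightarrow> i < N \<Longrightarrow> f i p = 0 \<Longrightarrow>
       (a = 0 \<or> incident i k) \<and> (b = 0 \<or> incident i (k + 1)) \<and> (c = 0 \<or> incident i (k + 2))"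
    proof (rule tri_coefficients[OF k(3,1,2)], goal_cases)
      case (1 a b c)
      show ?case by (rule 1(1)[OF 1(2-7)])
    qed
    then have z: "a = 0 \<or> incident j k" "b = 0 \<or> incident j (k + 1)" "c = 0 \<or> incident j (k + 2)"
      using assms p(2) by blast+
    have S: "zt m \<in> ?S" if "incident j m" "0 \<le> m" "m \<le> N + 1" for m
      using incident_edge[of j m] assms that by auto
    \<comment> \<open>A corner of weight 0 may lie off the edge. Replacing it by \<open>zt j\<close>
      does not change \<open>p\<close> and puts all three points on the segment.\<close>
    define x where "x = (if a = 0 then zt j else zt k)"
    define y where "y = (if b = 0 then zt j else zt (k + 1))"
    define w where "w = (if c = 0 then zt j else zt (k + 2))"
    have m: "x \<in> ?S" "y \<in> ?S" "w \<in> ?S" using z k S by (auto simp: x_def y_def w_def)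
    have eq: "p = a *\<^sub>R x + b *\<^sub>R y + c *\<^sub>R w" unfolding abc(5) by (simp add: x_def y_def w_def)
    have "p \<in> convex hull {x, y, w}" unfolding convex_hull_3 eq using abc(1-4) by blast
    also have "\<dots> \<subseteq> ?S" using m by (intro hull_minimal) auto
    finally show "p \<in> ?S" .
  qed
qed

lemma sig_P: assumes "0 \<le> k" "k < N" "p \<in> P" "f k p = 0" shows "sig k p \<in> P"
proof -
  have "p \<in> closed_segment (zt k) (zt (k + 2))" using edge_segment[of k] assms by auto
  then obtain u where u: "0 \<le> u" "u \<le> 1" "p = (1 - u) *\<^sub>R zt k + u *\<^sub>R zt (k + 2)"
    by (auto simp: closed_segment_def)
  have "sig k p = (1 - (1 - u)) *\<^sub>R zt k + (1 - u) *\<^sub>R zt (k + 2)"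
    unfolding sig_def u(3) by (simp add: algebra_simps)
  then have "sig k p \<in> closed_segment (zt k) (zt (k + 2))"
    unfolding closed_segment_def using u(1,2) by (intro CollectI exI[of _ "1 - u"]) auto
  then show ?thesis using edge_segment[of k] assms by auto
qed

lemma reg_tri:
  assumes "p \<in> tri k" "1 \<le> k" "k \<le> N - 2" "p \<noteq> zt k" "p \<noteq> zt (k + 1)" "p \<noteq> zt (k + 2)"
  shows "reg p"
proof -
  obtain l m where lm: "k \<le> l" "l < m" "m \<le> k + 2"
    "\<And>j. 0 \<le> j \<Longrightarrow> j < N \<Longrightarrow> f j p = 0 \<Longrightarrow> incident j l \<and> incident j m"
  proof (rule tri_two_vertices[OF assms], goal_cases)
    case (1 l m)
    show ?case by (rule 1(1)[OF 1(2-5)])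
  qed
  have "i = j" if "0 \<le> i" "i < N" "f i p = 0" "0 \<le> j" "j < N" "f j p = 0" for i j
    using incident_unique[of i l m j] lm that assms(2,3) by simp
  then show ?thesis using tri_subset_P assms by (auto simp: reg_def)
qed

lemma not_reg_zt: assumes "0 \<le> m" "m \<le> N + 1" shows "\<not> reg (zt m)"
proof -
  have *: "\<not> reg (zt m)" if m: "1 \<le> m" "m \<le> N" for m
  proof -
    \<comment> \<open>The two edges at a corner are \<open>m - 2\<close> and \<open>m\<close>,
      except at the ends of the zigzag, where \<open>zt 0 = zt 1\<close> and
      \<open>zt N = zt (N + 1)\<close> shift one of the indices.\<close>
    consider "m = 1" | "2 \<le> m" "m < N" | "m = N" using m by linarith
    then obtain i j where ij: "i \<noteq> j" "0 \<le> i" "i < N" "0 \<le> j" "j < N" "incident i m" "incident j m"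
    proof cases
      case 1
      show ?thesis by (rule that[of 0 1]) (use 1 n_ge_3 in \<open>auto simp: incident_def\<close>)
    next
      case 2
      show ?thesis by (rule that[of "m - 2" m]) (use 2 in \<open>auto simp: incident_def\<close>)
    next
      case 3
      show ?thesis by (rule that[of "N - 2" "N - 1"]) (use 3 n_ge_3 in \<open>auto simp: incident_def\<close>)
    qed
    then have "f i (zt m) = 0" "f j (zt m) = 0" using f_zt(2) m by auto
    then show ?thesis using ij unfolding reg_def by (metis atLeastLessThan_iff)
  qed
  show ?thesis
    using assms *[of m] *[of 1] *[of N] zt_0_1 zt_n n_ge_3
    by (cases "m = 0"; cases "m = N + 1") auto
qed

lemma reg_iff: "p \<in> P \<Longrightarrow> reg p \<longleftrightarrow> p \<notin> zt ` {1..N}"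
proof
  assume p: "p \<in> P"
  show "p \<notin> zt ` {1..N}" if "reg p" using that not_reg_zt by auto
  obtain k where "1 \<le> k" "k \<le> N - 2" "p \<in> tri k" using p by (rule P_cover)
  then show "reg p" if "p \<notin> zt ` {1..N}"
    using that by (intro reg_tri[of p k]) auto
qed

lemma reg_P: "reg p \<Longrightarrow> p \<in> P" by (simp add: reg_def)

lemma reg_sig: assumes "0 \<le> k" "k < N" "reg p" "f k p = 0" shows "reg (sig k p)"
proof (rule ccontr)
  assume "\<not> ?thesis"
  then obtain m where m: "m \<in> {1..N}" "sig k p = zt m"
    using reg_iff[OF sig_P[OF assms(1,2) reg_P[OF assms(3)] assms(4)]] by auto
  have "f k (zt m) = 0" using m f_sig[of k p] assms by simp
  then have "zt m = zt k \<or> zt m = zt (k + 2)"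
    using f_zt(2)[of k m] incident_edge[of k m] m assms by auto
  then have "p = zt k \<or> p = zt (k + 2)" using m sig_zt sig_sig by metis
  then show False using not_reg_zt[of k] not_reg_zt[of "k + 2"] assms by auto
qed

lemma reg_pos: "reg p \<Longrightarrow> f k p = 0 \<Longrightarrow> 0 \<le> k \<Longrightarrow> k < N \<Longrightarrow> 0 \<le> j \<Longrightarrow> j < N \<Longrightarrow> j \<noteq> k \<Longrightarrow> f j p > 0"
proof -
  assume a: "reg p" "f k p = 0" "0 \<le> k" "k < N" "0 \<le> j" "j < N" "j \<noteq> k"
  then have "f j p \<ge> 0" "f j p \<noteq> 0" by (auto simp: reg_def P_def)
  then show "f j p > 0" by simp
qed

section \<open>From eigencoordinates to the plane polygons and their labels\<close>

text \<open>The basis consists of the unit vectors of angles \<open>0\<close> and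
  \<open>\<pi> - \<beta>\<close>, which span the two eigenlines of the Veech element.\<close>

definition Lam :: "real \<times> real \<Rightarrow> real^2" where
  "Lam p = vector [fst p - snd p * cos \<beta>, snd p * sin \<beta>]"

lemma Lam_nth: "Lam p $ 1 = fst p - snd p * cos \<beta>" "Lam p $ 2 = snd p * sin \<beta>"
  by (simp_all add: Lam_def)

lemma linear_Lam: "linear Lam"
  by (rule linearI) (auto simp: vec_eq_iff forall_2 Lam_nth algebra_simps)

lemmas Lam_add = linear_add[OF linear_Lam]
  and Lam_diff = linear_diff[OF linear_Lam]
  and Lam_scale = linear_scale[OF linear_Lam]

lemma Lam_eq_iff: "Lam p = Lam q \<longleftrightarrow> p = q"
  using sin_beta_pos by (auto simp: vec_eq_iff forall_2 Lam_nth prod_eq_iff)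

lemma corner_U_eq: "corner_U n k = Lam (zt (2 * int k))"
proof (induction k)
  case 0
  then show ?case by (simp add: corner_U_def zt_0_1 vec_eq_iff forall_2 Lam_nth)
next
  case (Suc k)
  have "zt (2 * int (Suc k)) = zt (2 * int k) + (ell (2 * int k + 1), ell (2 * int k))"
    using zt_even[of "int k + 1"] zt_even[of "int k"] ell_mult[of "int k" 1 "int k"] ell_mult[of "int k" 1 "int k - 1"]
    by (simp add: algebra_simps)
  moreover have "Lam (ell (2 * int k + 1), ell (2 * int k)) =
    vector [cos (2 * pi * real k / real n), sin (2 * pi * real k / real n)]"
  proof -
    have *: "2 * pi * real k / real n = of_int (2 * int k) * \<beta>" by (simp add: \<beta>_def)
    have "ell (2 * int k + 1) = (sin (of_int (2 * int k) * \<beta>) * cos \<beta> + cos (of_int (2 * int k) * \<beta>) * sin \<beta>) / sin \<beta>"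
      unfolding ell_def by (simp add: distrib_right sin_add)
    then show ?thesis unfolding *
      using sin_beta_pos by (simp add: vec_eq_iff forall_2 Lam_nth ell_def field_simps)
  qed
  moreover have "corner_U n (Suc k) = corner_U n k +
    vector [cos (2 * pi * real k / real n), sin (2 * pi * real k / real n)]"
    by (simp add: corner_U_def)
  ultimately show ?case using Suc.IH by (simp add: Lam_add)
qed

text \<open>Corner \<open>i\<close> of the upper polygon has zigzag index \<open>2 * i\<close>. Past
  the middle this index leaves the range, and the symmetry \<open>ell (N - i) = ell i\<close> folds
  it back to an odd one.\<close>

lemma zt_fold: "zt (2 * (N - i)) = zt (2 * i + 1)"
  using ell_reflect[of i] ell_reflect[of "i + 1"]
  unfolding zt_even zt_odd by (simp add: diff_diff_eq)

lemma corner_set: "corner n Upper ` {..n} = Lam ` zt ` {1..N}"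
proof -
  have "(\<lambda>k. zt (2 * int k)) ` {..n} = zt ` {1..N}"
  proof (intro subset_antisym subsetI)
    fix x assume "x \<in> (\<lambda>k. zt (2 * int k)) ` {..n}"
    then obtain k where k: "k \<le> n" "x = zt (2 * int k)" by auto
    consider "k = 0" | "1 \<le> k" "2 * int k \<le> N" | "2 * int k > N" by linarith
    then show "x \<in> zt ` {1..N}"
    proof cases
      case 1
      then show ?thesis using k zt_0_1 n_ge_3 by (intro image_eqI[of _ _ 1]) auto
    next
      case 2
      then show ?thesis using k by (intro image_eqI[of _ _ "2 * int k"]) auto
    next
      case 3
      then have "x = zt (2 * (N - int k) + 1)" using zt_fold[of "N - int k"] k by simp
      then show ?thesis using 3 k by (intro image_eqI[of _ _ "2 * (N - int k) + 1"]) auto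
    qed
  next
    fix x assume "x \<in> zt ` {1..N}"
    then obtain m where m: "1 \<le> m" "m \<le> N" "x = zt m" by auto
    show "x \<in> (\<lambda>k. zt (2 * int k)) ` {..n}"
    proof (cases "even m")
      case True
      then obtain i where "m = 2 * i" by (elim evenE)
      then show ?thesis using m by (intro image_eqI[of _ _ "nat i"]) auto
    next
      case False
      then obtain i where i: "m = 2 * i + 1" by (elim oddE)
      then have "x = zt (2 * (N - i))" using m zt_fold by simp
      then show ?thesis using m i by (intro image_eqI[of _ _ "nat (N - i)"]) auto
    qed
  qed
  moreover have "corner n Upper ` {..n} = Lam ` (\<lambda>k. zt (2 * int k)) ` {..n}"
    by (simp add: corner_U_eq image_image)
  ultimately show ?thesis by simp
qed

lemma half_turn_Lam: "half_turn n (Lam p) = Lam (zt 3 - p)"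
proof -
  have "zt (2 * int (n - 1)) = zt 3" "zt (2 * int n) = zt 1"
    using zt_fold[of 1] zt_fold[of 0] n_ge_3 by (simp_all add: of_nat_diff)
  moreover have "Lam (zt 1) = 0" by (simp add: zt_0_1 vec_eq_iff forall_2 Lam_nth)
  ultimately show ?thesis by (simp only: half_turn_def corner_U_eq Lam_diff add_0_right)
qed

text \<open>A point of \<open>P\<^sub>L\<close> is represented by the coordinates of its half-turn image in \<open>P\<^sub>U\<close>. So displacements
  change sign on the lower sheet, and the gluing along the \<open>k\<close>-th edge becomes the half-turn \<open>sig k\<close>
  about the midpoint of this edge.\<close>

definition emb :: "sheet \<Rightarrow> real \<times> real \<Rightarrow> sheet \<times> (real^2)" where
  "emb s p = (s, if s = Upper then Lam p else half_turn n (Lam p))"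

definition opp :: "sheet \<Rightarrow> sheet" where "opp s = (if s = Upper then Lower else Upper)"

definition sg :: "sheet \<Rightarrow> real" where "sg s = (if s = Upper then 1 else - 1)"

lemma opp_opp [simp]: "opp (opp s) = s" and opp_neq [simp]: "opp s \<noteq> s" "s \<noteq> opp s"
  and sg_opp: "sg (opp s) = - sg s" and sg_sg [simp]: "sg s * sg s = 1"
  by (cases s; simp add: opp_def sg_def)+

lemma sheet_cases: "s' = s \<or> s' = opp s"
  by (cases s; cases s'; simp add: opp_def)

lemma emb_eq_iff: "emb s p = emb s' p' \<longleftrightarrow> s = s' \<and> p = p'"
  by (auto simp: emb_def half_turn_Lam Lam_eq_iff split: if_splits)

lemma emb_move: "emb s (p + sg s *\<^sub>R w) = (s, snd (emb s p) + Lam w)"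
  by (cases s) (simp_all add: emb_def sg_def half_turn_Lam algebra_simps flip: Lam_diff Lam_add)

lemma fst_emb: "fst (emb s p) = s"
  by (simp add: emb_def)

lemma polygon_Upper: "polygon n Upper = Lam ` P"
  unfolding polygon_def P_hull corner_set by (rule convex_hull_linear_image[OF linear_Lam, symmetric])

lemma corner_Lower: "corner n Lower = half_turn n \<circ> corner n Upper"
  by auto

lemma polygon_Lower: "polygon n Lower = half_turn n ` Lam ` P"
proof -
  have *: "half_turn n = (\<lambda>z. (corner_U n (n - 1) + corner_U n n) + (- 1) *\<^sub>R z)"
    by (auto simp: half_turn_def)
  have "polygon n Lower = convex hull (half_turn n ` corner n Upper ` {..n})"
    unfolding polygon_def corner_Lower by (simp add: image_comp)
  also have "\<dots> = half_turn n ` (convex hull (corner n Upper ` {..n}))"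
    unfolding * by (rule convex_hull_affinity)
  finally show ?thesis using polygon_Upper by (simp add: polygon_def)
qed

lemma raw_points_eq: "raw_points n = {emb s p | s p. p \<in> P}"
proof (intro subset_antisym subsetI)
  fix x assume "x \<in> raw_points n"
  then obtain s z where x: "x = (s, z)" "z \<in> polygon n s" by (auto simp: raw_points_def)
  then show "x \<in> {emb s p | s p. p \<in> P}"
    by (cases s) (auto simp: emb_def polygon_Upper polygon_Lower)
next
  fix x assume "x \<in> {emb s p | s p. p \<in> P}"
  then obtain s p where "x = emb s p" "p \<in> P" by auto
  then show "x \<in> raw_points n"
    by (cases s) (auto simp: emb_def polygon_Upper polygon_Lower raw_points_def)
qed

text \<open>The \<open>k\<close>-th edge in the zigzag order is \<open>S\<close> with index \<open>lab k\<close>.\<close>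

definition lab :: "int \<Rightarrow> nat" where
  "lab k = (if even k then nat (k div 2) + 1 else n - nat (k div 2))"

lemma bij_lab: "bij_betw lab {0..<N} {1..n}"
proof -
  have inj: "inj_on lab {0..<N}"
  proof (rule inj_onI)
    fix x y assume xy: "x \<in> {0..<N}" "y \<in> {0..<N}" "lab x = lab y"
    obtain m where m: "n = 2 * m + 1" using odd_n by (rule oddE)
    from xy m show "x = y" unfolding lab_def by (auto split: if_splits elim!: evenE oddE)
  qed
  moreover have "lab ` {0..<N} \<subseteq> {1..n}"
    using odd_n by (auto simp: lab_def elim!: evenE oddE)
  moreover have "card (lab ` {0..<N}) = card {1..n}" using card_image[OF inj] by simp
  ultimately show ?thesis unfolding bij_betw_def by (metis card_subset_eq finite_atLeastAtMost)
qed

lemma lab_range: "0 \<le> k \<Longrightarrow> k < N \<Longrightarrow> lab k \<in> {1..n}"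
  using bij_lab by (auto simp: bij_betw_def)

lemma lab_cases: assumes "l \<in> {1..n}" obtains k where "0 \<le> k" "k < N" "l = lab k"
  using assms bij_lab unfolding bij_betw_def by (metis atLeastLessThan_iff imageE)

text \<open>The even zigzag edges run counter-clockwise and the odd ones clockwise, hence the two
  alternatives.\<close>

lemma corner_lab:
  assumes "0 \<le> k" "k < N"
  shows "corner_U n (lab k - 1) = Lam (zt k) \<and> corner_U n (lab k) = Lam (zt (k + 2))
    \<or> corner_U n (lab k - 1) = Lam (zt (k + 2)) \<and> corner_U n (lab k) = Lam (zt k)"
proof (cases "even k")
  case True
  then obtain i where k: "k = 2 * i" by (elim evenE)
  then have "2 * int (lab k) = k + 2" "2 * int (lab k - 1) = k"
    using assms by (auto simp: lab_def)
  then show ?thesis by (simp only: corner_U_eq) simp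
next
  case False
  then obtain i where k: "k = 2 * i + 1" by (elim oddE)
  have "2 * int (lab k) = 2 * (N - i)" "2 * int (lab k - 1) = 2 * (N - (i + 1))"
    using k assms by (auto simp: lab_def)
  moreover have "2 * i + 1 = k" "2 * (i + 1) + 1 = k + 2" using k by simp_all
  ultimately show ?thesis by (simp only: corner_U_eq zt_fold) simp
qed

lemma edge_lab:
  assumes "0 \<le> k" "k < N"
  shows "edge n s (lab k) = (\<lambda>p. snd (emb s p)) ` {p \<in> P. f k p = 0}"
proof -
  have U: "edge n Upper (lab k) = Lam ` {p \<in> P. f k p = 0}"
    using corner_lab[OF assms]
    by (auto simp: edge_def edge_segment[OF assms] closed_segment_linear_image[OF linear_Lam]
       closed_segment_commute)
  have L: "edge n Lower (lab k) = half_turn n ` edge n Upper (lab k)"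
  proof -
    have "half_turn n ((1 - u) *\<^sub>R a + u *\<^sub>R b) = (1 - u) *\<^sub>R half_turn n a + u *\<^sub>R half_turn n b"
      for u a b by (simp add: half_turn_def algebra_simps)
    then show ?thesis by (simp add: edge_def closed_segment_image_interval image_image)
  qed
  show ?thesis using U L by (cases s) (auto simp: emb_def)
qed

section \<open>The identifications and the points of the surface in coordinates\<close>

lemma glue_eq:
  "glue n = {(emb Upper p, emb Lower (sig k p)) | k p. 0 \<le> k \<and> k < N \<and> p \<in> P \<and> f k p = 0}"
proof -
  have sh: "snd (emb Upper p) + glue_shift n (lab k) = snd (emb Lower (sig k p))"
    if "0 \<le> k" "k < N" for k p
    using corner_lab[OF that]
    by (auto simp: glue_shift_def emb_def sig_def half_turn_Lam Lam_eq_iff algebra_simps simp flip: Lam_diff Lam_add)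
  show ?thesis
  proof (intro subset_antisym subsetI)
    fix x assume "x \<in> glue n"
    then obtain z l where x: "x = ((Upper, z), (Lower, z + glue_shift n l))" "l \<in> {1..n}" "z \<in> edge n Upper l"
      by (auto simp: glue_def)
    then obtain k where k: "0 \<le> k" "k < N" "l = lab k" using lab_cases by blast
    then obtain p where p: "p \<in> P" "f k p = 0" "z = snd (emb Upper p)" using x edge_lab[of k] by auto
    have "x = (emb Upper p, emb Lower (sig k p))"
      using x p k sh[OF k(1,2), of p] by (simp add: prod_eq_iff fst_emb)
    then show "x \<in> {(emb Upper p, emb Lower (sig k p)) | k p. 0 \<le> k \<and> k < N \<and> p \<in> P \<and> f k p = 0}"
      using k p by blast
  next
    fix x assume "x \<in> {(emb Upper p, emb Lower (sig k p)) | k p. 0 \<le> k \<and> k < N \<and> p \<in> P \<and> f k p = 0}"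
    then obtain k p where x: "x = (emb Upper p, emb Lower (sig k p))" "0 \<le> k" "k < N" "p \<in> P" "f k p = 0" by blast
    have "snd (emb Upper p) \<in> edge n Upper (lab k)" using edge_lab[of k Upper] x by auto
    moreover have "x = ((Upper, snd (emb Upper p)), (Lower, snd (emb Upper p) + glue_shift n (lab k)))"
      using x sh[of k p] by (simp add: prod_eq_iff fst_emb)
    ultimately show "x \<in> glue n" unfolding glue_def using lab_range[of k] x(2,3) by blast
  qed
qed

text \<open>Since \<open>sig k\<close> is an involution, the same formula describes the gluing and
  its converse.\<close>

definition step :: "((sheet \<times> (real^2)) \<times> (sheet \<times> (real^2))) set" where
  "step = {(emb s p, emb (opp s) (sig k p)) | s k p. 0 \<le> k \<and> k < N \<and> p \<in> P \<and> f k p = 0}"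

lemma glue_step: "glue n \<union> (glue n)\<inverse> = step"
proof -
  have "(glue n)\<inverse> = {(emb Lower p, emb Upper (sig k p)) | k p. 0 \<le> k \<and> k < N \<and> p \<in> P \<and> f k p = 0}"
  proof -
    have "\<exists>k' p'. emb Lower (sig k p) = emb Lower p' \<and> emb Upper p = emb Upper (sig k' p') \<and> 0 \<le> k' \<and> k' < N \<and> p' \<in> P \<and> f k' p' = 0"
     if "0 \<le> k" "k < N" "p \<in> P" "f k p = 0" for k p
      by (intro exI[of _ k] exI[of _ "sig k p"]) (use that sig_P f_sig in auto)
    moreover have "\<exists>k' p'. emb Upper (sig k p) = emb Upper p' \<and> emb Lower p = emb Lower (sig k' p') \<and> 0 \<le> k' \<and> k' < N \<and> p' \<in> P \<and> f k' p' = 0"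
     if "0 \<le> k" "k < N" "p \<in> P" "f k p = 0" for k p
      by (intro exI[of _ k] exI[of _ "sig k p"]) (use that sig_P f_sig in auto)
    ultimately show ?thesis unfolding glue_eq by fastforce
  qed
  moreover have "step = {(emb Upper p, emb Lower (sig k p)) | k p. 0 \<le> k \<and> k < N \<and> p \<in> P \<and> f k p = 0}
    \<union> {(emb Lower p, emb Upper (sig k p)) | k p. 0 \<le> k \<and> k < N \<and> p \<in> P \<and> f k p = 0}"
  proof -
    have ex: "(\<exists>s. R s) \<longleftrightarrow> R Upper \<or> R Lower" for R by (metis sheet.exhaust)
    show ?thesis unfolding step_def by (rule set_eqI) (simp add: ex opp_def)
  qed
  ultimately show ?thesis using glue_eq by simp
qed

lemma ident_eq: "ident n = step\<^sup>* \<inter> raw_points n \<times> raw_points n"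
  by (simp add: ident_def glue_step)

lemma equiv_ident: "equiv (raw_points n) (ident n)"
proof -
  have "sym (glue n \<union> (glue n)\<inverse>)" by (auto simp: sym_def)
  then have "sym ((glue n \<union> (glue n)\<inverse>)\<^sup>*)" by (rule sym_rtrancl)
  then show ?thesis unfolding ident_def
    by (intro equivI refl_onI symI transI) (auto dest: symD intro: rtrancl_trans)
qed

definition C :: "sheet \<Rightarrow> real \<times> real \<Rightarrow> point" where
  "C s p = ident n `` {emb s p}"

lemma emb_raw: "p \<in> P \<Longrightarrow> emb s p \<in> raw_points n"
  unfolding raw_points_eq by blast

lemma mem_C_self: "p \<in> P \<Longrightarrow> emb s p \<in> C s p"
  unfolding C_def by (intro equiv_class_self[OF equiv_ident] emb_raw)

lemma C_eqI: "emb s' p' \<in> C s p \<Longrightarrow> C s' p' = C s p"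
  unfolding C_def using equiv_class_eq[OF equiv_ident] by blast

lemma surface_eq: "surface n = {C s p | s p. p \<in> P}"
  unfolding surface_def quotient_def raw_points_eq C_def by blast

lemma C_surface [intro]: "p \<in> P \<Longrightarrow> C s p \<in> surface n"
  unfolding surface_eq by blast

lemma surface_mem: assumes "q \<in> surface n" "(s, z) \<in> q"
  obtains p where "p \<in> P" "(s, z) = emb s p" "q = C s p"
proof -
  obtain s' p' where q: "q = C s' p'" "p' \<in> P" using assms by (auto simp: surface_eq)
  then have "(s, z) \<in> raw_points n" using assms by (auto simp: C_def ident_def)
  then obtain s1 p where "(s, z) = emb s1 p" "p \<in> P" by (auto simp: raw_points_eq)
  then have "(s, z) = emb s p" "p \<in> P" by (auto simp: emb_def)
  then show ?thesis using q assms that C_eqI[of s p s' p'] by auto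
qed

lemma C_glue: assumes "0 \<le> k" "k < N" "p \<in> P" "f k p = 0" shows "C (opp s) (sig k p) = C s p"
proof (rule C_eqI)
  have "(emb s p, emb (opp s) (sig k p)) \<in> step" unfolding step_def using assms by blast
  then show "emb (opp s) (sig k p) \<in> C s p"
    unfolding C_def ident_eq using assms(3) sig_P[OF assms] emb_raw by blast
qed

text \<open>A regular point lies on at most one edge \<open>k\<close>, and so does its partner; a
  second gluing step can only undo the first. Hence a regular class has at most two
  representatives.\<close>

lemma C_reg: assumes "reg p" "x \<in> C s p"
  shows "x = emb s p \<or> (\<exists>k. 0 \<le> k \<and> k < N \<and> f k p = 0 \<and> x = emb (opp s) (sig k p))"
proof -
  have "(emb s p, x) \<in> step\<^sup>*" using assms by (auto simp: C_def ident_eq)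
  then show ?thesis
  proof (induction rule: rtrancl_induct)
    case base
    then show ?case by simp
  next
    case (step y z)
    obtain s' p' j where yz: "y = emb s' p'" "z = emb (opp s') (sig j p')" "0 \<le> j" "j < N" "f j p' = 0"
      using step.hyps(2) by (auto simp: step_def)
    from step.IH show ?case
    proof (elim disjE exE conjE)
      assume "y = emb s p"
      then show ?thesis using yz by (auto simp: emb_eq_iff)
    next
      fix k assume k: "0 \<le> k" "k < N" "f k p = 0" "y = emb (opp s) (sig k p)"
      then have e: "s' = opp s" "p' = sig k p" using yz by (auto simp: emb_eq_iff)
      have "reg (sig k p)" "f k (sig k p) = 0" using reg_sig k assms f_sig by auto
      then have "j = k" using yz k e by (auto simp: reg_def)
      then show ?thesis using yz e by simp
    qed
  qed
qed

lemma C_corner: assumes "p \<in> P" "\<not> reg p" "emb s' p' \<in> C s p" shows "\<not> reg p'"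
proof
  assume r: "reg p'"
  have "emb s p \<in> C s' p'" using C_eqI[OF assms(3)] mem_C_self assms(1) by metis
  from C_reg[OF r this] show False
  proof (elim disjE exE conjE)
    assume "emb s p = emb s' p'"
    then show False using r assms(2) by (simp add: emb_eq_iff)
  next
    fix k assume "0 \<le> k" "k < N" "f k p' = 0" "emb s p = emb (opp s') (sig k p')"
    then show False using r assms(2) reg_sig by (simp add: emb_eq_iff)
  qed
qed

lemma C_reg_eq:
  assumes "reg p" "p' \<in> P"
  shows "C s p = C s' p' \<longleftrightarrow> s' = s \<and> p' = p \<or>
    s' = opp s \<and> (\<exists>k. 0 \<le> k \<and> k < N \<and> f k p = 0 \<and> p' = sig k p)" (is "_ \<longleftrightarrow> ?R")
proof
  assume "C s p = C s' p'"
  then have "emb s' p' \<in> C s p" using mem_C_self assms by simp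
  from C_reg[OF assms(1) this] show ?R unfolding emb_eq_iff by blast
next
  assume ?R
  then show "C s p = C s' p'" using C_glue reg_P[OF assms(1)] by metis
qed

lemma cone_iff: assumes "p \<in> P" shows "C s p \<in> cone_points n \<longleftrightarrow> \<not> reg p"
proof -
  have c: "(\<exists>k\<le>n. (s, corner n s k) = emb s p) \<longleftrightarrow> p \<in> zt ` {1..N}" for s p
  proof -
    have "(\<exists>k\<le>n. corner n Upper k = Lam p) \<longleftrightarrow> Lam p \<in> corner n Upper ` {..n}" by (auto simp del: corner.simps intro: sym)
    then have U: "(\<exists>k\<le>n. corner n Upper k = Lam p) \<longleftrightarrow> p \<in> zt ` {1..N}"
      unfolding corner_set by (auto simp: Lam_eq_iff)
    have "half_turn n z = half_turn n z' \<longleftrightarrow> z = z'" for z z' by (auto simp: half_turn_def)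
    then show ?thesis using U by (cases s) (simp_all add: emb_def)
  qed
  show ?thesis
  proof
    assume "C s p \<in> cone_points n"
    then obtain s' k where k: "k \<le> n" "(s', corner n s' k) \<in> C s p"
      by (auto simp: cone_points_def)
    obtain p' where p': "p' \<in> P" "(s', corner n s' k) = emb s' p'" "C s p = C s' p'"
      using surface_mem[OF C_surface[OF assms] k(2)] by blast
    have "p' \<in> zt ` {1..N}" using c[of s' p'] k p' by auto
    then have "\<not> reg p'" using reg_iff p' by blast
    moreover have "emb s p \<in> C s' p'" using p'(3) mem_C_self[OF assms, of s] by simp
    ultimately show "\<not> reg p" using C_corner[OF p'(1)] by blast
  next
    assume "\<not> reg p"
    then have "p \<in> zt ` {1..N}" using reg_iff assms by blast
    then obtain k where k: "k \<le> n" "(s, corner n s k) = emb s p" using c by blast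
    have "(s, corner n s k) \<in> C s p" unfolding k(2) by (rule mem_C_self[OF assms])
    then show "C s p \<in> cone_points n"
      unfolding cone_points_def using assms k(1) C_surface by blast
  qed
qed

lemma displaced_iff:
  assumes "q \<in> surface n" "q' \<in> surface n"
  shows "displaced q (Lam w) q' \<longleftrightarrow>
    (\<exists>s p. p \<in> P \<and> p + sg s *\<^sub>R w \<in> P \<and> q = C s p \<and> q' = C s (p + sg s *\<^sub>R w))"
proof
  assume "displaced q (Lam w) q'"
  then obtain s z where z: "(s, z) \<in> q" "(s, z + Lam w) \<in> q'" by (auto simp: displaced_def)
  obtain p where p: "p \<in> P" "(s, z) = emb s p" "q = C s p" using surface_mem[OF assms(1) z(1)] by blast
  obtain p' where p': "p' \<in> P" "(s, z + Lam w) = emb s p'" "q' = C s p'" using surface_mem[OF assms(2) z(2)] by blast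
  have "emb s p' = emb s (p + sg s *\<^sub>R w)" unfolding emb_move p'(2)[symmetric] p(2)[symmetric] by simp
  then have "p' = p + sg s *\<^sub>R w" by (simp add: emb_eq_iff)
  then show "\<exists>s p. p \<in> P \<and> p + sg s *\<^sub>R w \<in> P \<and> q = C s p \<and> q' = C s (p + sg s *\<^sub>R w)"
    using p p' by blast
next
  assume "\<exists>s p. p \<in> P \<and> p + sg s *\<^sub>R w \<in> P \<and> q = C s p \<and> q' = C s (p + sg s *\<^sub>R w)"
  then obtain s p where p: "p \<in> P" "p + sg s *\<^sub>R w \<in> P" "q = C s p" "q' = C s (p + sg s *\<^sub>R w)" by blast
  have "(s, snd (emb s p)) \<in> q" using mem_C_self[OF p(1), of s] p by (metis fst_emb prod.collapse)
  moreover have "(s, snd (emb s p) + Lam w) \<in> q'" using mem_C_self[OF p(2), of s] p by (simp add: emb_move)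
  ultimately show "displaced q (Lam w) q'" unfolding displaced_def by blast
qed

lemma surface_edge_iff:
  assumes "reg p" "0 \<le> k" "k < N"
  shows "C s p \<in> surface_edge n (lab k) \<longleftrightarrow> f k p = 0"
proof
  assume "C s p \<in> surface_edge n (lab k)"
  then obtain s' z where z: "z \<in> edge n s' (lab k)" "(s', z) \<in> C s p" by (auto simp: surface_edge_def)
  then obtain p' where p': "p' \<in> P" "f k p' = 0" "z = snd (emb s' p')" using edge_lab[OF assms(2,3)] by auto
  then have "emb s' p' \<in> C s p" using z by (metis fst_emb prod.collapse)
  then consider "p' = p" | j where "0 \<le> j" "j < N" "f j p = 0" "p' = sig j p"
    using C_reg[OF assms(1), of "emb s' p'" s] unfolding emb_eq_iff by blast
  then show "f k p = 0"
  proof cases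
    case 2
    then have "reg p'" "f j p' = 0" using reg_sig assms f_sig by auto
    then have "j = k" using 2 p' assms by (auto simp: reg_def)
    then show ?thesis using 2 by simp
  qed (use p' in auto)
next
  assume "f k p = 0"
  then have "snd (emb s p) \<in> edge n s (lab k)" using edge_lab[OF assms(2,3)] assms(1) by (auto simp: reg_def)
  moreover have "(s, snd (emb s p)) \<in> C s p" using mem_C_self[of p s] assms(1) by (metis fst_emb prod.collapse reg_P)
  ultimately show "C s p \<in> surface_edge n (lab k)"
    unfolding surface_edge_def using assms(1) reg_P by blast
qed

section \<open>The Veech matrix and the sector in eigencoordinates\<close>

lemma veech_Lam: "(flip ** M n) *v Lam (x, y) = Lam (- x, y)"
proof -
  have A: "(flip ** M n) *v z = vector [- (z $ 1) - 2 * cot \<beta> * z $ 2, z $ 2]" for z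
    unfolding flip_def M_def \<beta>_def[symmetric]
    by (simp add: vec_eq_iff forall_2 matrix_matrix_mult_def matrix_vector_mult_def sum_2)
  have c: "cot \<beta> * sin \<beta> = cos \<beta>" using sin_beta_pos by (simp add: cot_def)
  have "2 * cot \<beta> * (y * sin \<beta>) = 2 * y * (cot \<beta> * sin \<beta>)" by (simp only: mult_ac)
  then have "2 * cot \<beta> * (y * sin \<beta>) = 2 * (y * cos \<beta>)" unfolding c by simp
  then have "- (Lam (x, y) $ 1) - 2 * cot \<beta> * Lam (x, y) $ 2 = Lam (- x, y) $ 1"
    by (simp only: Lam_nth fst_conv snd_conv)
  then show ?thesis unfolding A by (simp only: vec_eq_iff forall_2 vector_2) (simp add: Lam_nth)
qed

lemma sector_Lam:
  assumes "v \<in> standard_sector n" "v \<noteq> 0"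
  obtains w o' where "v = Lam w" "w \<noteq> 0" "o' = 1 \<or> o' = - 1" "o' * fst w \<ge> 0" "o' * snd w \<le> 0"
proof -
  obtain r \<theta> where r: "v = r *\<^sub>R vector [cos \<theta>, sin \<theta>]" "- \<beta> \<le> \<theta>" "\<theta> \<le> 0"
    using assms by (auto simp: standard_sector_def \<beta>_def)
  \<comment> \<open>The sine rule gives the components of the unit vector of angle
    \<open>\<theta>\<close> along the directions \<open>0\<close> and
    \<open>\<pi> - \<beta>\<close>.\<close>
  define w where "w = (r * sin (\<theta> + \<beta>) / sin \<beta>, r * sin \<theta> / sin \<beta>)"
  have 1: "sin (\<theta> + \<beta>) / sin \<beta> \<ge> 0" using r beta_bounds sin_beta_pos by (intro divide_nonneg_pos sin_ge_zero) auto
  have "sin (- \<theta>) \<ge> 0" using r beta_bounds by (intro sin_ge_zero) auto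
  then have 2: "sin \<theta> / sin \<beta> \<le> 0" using sin_beta_pos by (simp add: divide_nonpos_pos)
  have v: "v = Lam w" using sin_beta_pos
    by (simp add: r vec_eq_iff forall_2 Lam_nth w_def sin_add field_simps)
  then have "w \<noteq> 0" using assms(2) linear_0[OF linear_Lam] by auto
  show ?thesis
  proof (cases "r \<ge> 0")
    case True
    then have "fst w \<ge> 0" "snd w \<le> 0" using mult_nonneg_nonneg[OF True 1] mult_nonneg_nonpos[OF True 2] by (auto simp: w_def)
    then show ?thesis using that[of w 1] v \<open>w \<noteq> 0\<close> by simp
  next
    case False
    then have "fst w \<le> 0" "snd w \<ge> 0" using mult_nonpos_nonneg[of r, OF _ 1] mult_nonpos_nonpos[of r, OF _ 2] by (auto simp: w_def)
    then show ?thesis using that[of w "-1"] v \<open>w \<noteq> 0\<close> by simp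
  qed
qed

subsection \<open>Straight paths on the surface\<close>

definition regp :: "point \<Rightarrow> bool" where "regp q \<longleftrightarrow> q \<in> surface n - cone_points n"

lemma regp_C: "p \<in> P \<Longrightarrow> regp (C s p) \<longleftrightarrow> reg p"
  using cone_iff[of p s] C_surface[of p s] unfolding regp_def by blast

lemma regp_surface: "regp q \<Longrightarrow> q \<in> surface n" by (simp add: regp_def)

lemma regpE: assumes "regp q" obtains s p where "reg p" "q = C s p"
proof -
  obtain s p where "p \<in> P" "q = C s p" using regp_surface[OF assms] unfolding surface_eq by blast
  then show thesis using that assms regp_C by blast
qed

section \<open>Small displacements of a regular point\<close>

lemma displaced_C: "p \<in> P \<Longrightarrow> p + sg s *\<^sub>R w \<in> P \<Longrightarrow> displaced (C s p) (Lam w) (C s (p + sg s *\<^sub>R w))"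
proof -
  assume a: "p \<in> P" and b: "p + sg s *\<^sub>R w \<in> P"
  show ?thesis unfolding displaced_iff[OF C_surface[OF a] C_surface[OF b]] using a b by blast
qed

text \<open>If the two displacements start from the two representatives of \<open>q\<close> on edge
  \<open>k\<close>, the displaced points are exchanged by \<open>sig k\<close>. Both lie in the
  polygon, while \<open>sig k\<close> negates \<open>f k\<close>; so both are on the edge and are
  glued.\<close>

lemma displaced_unique:
  assumes "regp q" "q1 \<in> surface n" "q2 \<in> surface n" "displaced q (Lam w) q1" "displaced q (Lam w) q2"
  shows "q1 = q2"
proof -
  obtain s p where p: "p \<in> P" "p + sg s *\<^sub>R w \<in> P" "q = C s p" "q1 = C s (p + sg s *\<^sub>R w)"
    using displaced_iff[of q q1 w] assms regp_surface by blast
  obtain s' p' where p': "p' \<in> P" "p' + sg s' *\<^sub>R w \<in> P" "q = C s' p'" "q2 = C s' (p' + sg s' *\<^sub>R w)"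
    using displaced_iff[of q q2 w] assms regp_surface by blast
  have r: "reg p" using p assms regp_C by blast
  from p p' have "C s p = C s' p'" by simp
  then consider "s' = s" "p' = p" | k where "s' = opp s" "0 \<le> k" "k < N" "f k p = 0" "p' = sig k p"
    using C_reg_eq[OF r p'(1)] by blast
  then show ?thesis
  proof cases
    case 2
    have e: "p' + sg s' *\<^sub>R w = sig k (p + sg s *\<^sub>R w)" by (simp add: 2 sig_add sg_opp)
    have "f k (p + sg s *\<^sub>R w) \<ge> 0" using p(2) 2 by (auto simp: P_def)
    moreover have "f k (sig k (p + sg s *\<^sub>R w)) \<ge> 0" using p'(2) 2 unfolding e by (auto simp: P_def)
    ultimately have "f k (p + sg s *\<^sub>R w) = 0" by (simp add: f_sig)
    then show ?thesis using C_glue[OF 2(2,3) p(2)] p(4) p'(4) 2 e by simp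
  qed (use p p' in simp)
qed

lemma tendsto_id_nhds: "((\<lambda>u. u) \<longlongrightarrow> (0::real)) (nhds 0)"
  by (rule filterlim_ident)

lemma eventually_f:
  "\<forall>\<^sub>F u in nhds 0. \<forall>j\<in>{0..<N}. (f j p > 0 \<longrightarrow> f j (p + u *\<^sub>R w) > 0) \<and> (f j p < 0 \<longrightarrow> f j (p + u *\<^sub>R w) < 0)"
proof (rule eventually_ball_finite)
  show "\<forall>j\<in>{0..<N}. \<forall>\<^sub>F u in nhds 0. (f j p > 0 \<longrightarrow> f j (p + u *\<^sub>R w) > 0) \<and> (f j p < 0 \<longrightarrow> f j (p + u *\<^sub>R w) < 0)"
  proof
    fix j
    have "((\<lambda>u. f j p + u * df j w) \<longlongrightarrow> f j p + 0 * df j w) (nhds 0)"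
      by (intro tendsto_intros tendsto_id_nhds)
    then have lim: "((\<lambda>u. f j (p + u *\<^sub>R w)) \<longlongrightarrow> f j p) (nhds 0)" by (simp add: f_move)
    have "\<forall>\<^sub>F u in nhds 0. f j p > 0 \<longrightarrow> f j (p + u *\<^sub>R w) > 0"
      by (cases "f j p > 0") (use order_tendstoD(1)[OF lim, of 0] in auto)
    moreover have "\<forall>\<^sub>F u in nhds 0. f j p < 0 \<longrightarrow> f j (p + u *\<^sub>R w) < 0"
      by (cases "f j p < 0") (use order_tendstoD(2)[OF lim, of 0] in auto)
    ultimately show "\<forall>\<^sub>F u in nhds 0. (f j p > 0 \<longrightarrow> f j (p + u *\<^sub>R w) > 0) \<and> (f j p < 0 \<longrightarrow> f j (p + u *\<^sub>R w) < 0)"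
      by eventually_elim auto
  qed
qed auto

text \<open>This makes disagreement of two paths an open condition. Small displacements preserve the
  strict signs of all \<open>f j\<close>, so end points glued along an edge come from starting
  points glued along the same edge. The point \<open>q'\<close> may be a cone point, as is needed at
  the ends of the bottom edge.\<close>

lemma separate:
  assumes "regp q" "q' \<in> surface n" "q \<noteq> q'"
  shows "\<forall>\<^sub>F u in nhds 0. \<forall>r. regp r \<longrightarrow> \<not> (displaced q (Lam (u *\<^sub>R w)) r \<and> displaced q' (Lam (u *\<^sub>R w)) r)"
proof -
  obtain s p where p: "reg p" "q = C s p" using assms(1) by (rule regpE)
  define G where "G p' w' u \<longleftrightarrow> (\<forall>j\<in>{0..<N}. (f j p' > 0 \<longrightarrow> f j (p' + u *\<^sub>R w') > 0) \<and> (f j p' < 0 \<longrightarrow> f j (p' + u *\<^sub>R w') < 0))" for p' w' u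
  have "\<forall>\<^sub>F u in nhds 0. G p (sg s *\<^sub>R w) u" unfolding G_def by (rule eventually_f)
  moreover have "\<forall>\<^sub>F u in nhds 0. \<forall>k\<in>{0..<N}. G (sig k p) (sg (opp s) *\<^sub>R w) u"
    unfolding G_def by (intro eventually_ball_finite ballI eventually_f) simp
  ultimately show ?thesis
  proof eventually_elim
    case (elim u)
    show ?case
    proof (intro allI impI notI)
      fix r assume r: "regp r" and d: "displaced q (Lam (u *\<^sub>R w)) r \<and> displaced q' (Lam (u *\<^sub>R w)) r"
      obtain s1 p1 where p1: "p1 \<in> P" "p1 + sg s1 *\<^sub>R u *\<^sub>R w \<in> P" "q = C s1 p1" "r = C s1 (p1 + sg s1 *\<^sub>R u *\<^sub>R w)"
        using displaced_iff[of q r "u *\<^sub>R w"] d assms r regp_surface by blast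
      obtain s2 p2 where p2: "p2 \<in> P" "p2 + sg s2 *\<^sub>R u *\<^sub>R w \<in> P" "q' = C s2 p2" "r = C s2 (p2 + sg s2 *\<^sub>R u *\<^sub>R w)"
        using displaced_iff[of q' r "u *\<^sub>R w"] d assms r regp_surface by blast
      have G: "G p1 (sg s1 *\<^sub>R w) u"
        using C_reg_eq[OF p(1) p1(1), of s s1] p(2) p1(3) elim by auto
      have "reg (p1 + sg s1 *\<^sub>R u *\<^sub>R w)" using p1(2,4) r regp_C by blast
      from C_reg_eq[OF this p2(2), of s1 s2] p1(4) p2(4)
      consider "s2 = s1" "p2 + sg s2 *\<^sub>R u *\<^sub>R w = p1 + sg s1 *\<^sub>R u *\<^sub>R w"
        | k where "s2 = opp s1" "0 \<le> k" "k < N" "f k (p1 + sg s1 *\<^sub>R u *\<^sub>R w) = 0"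
          "p2 + sg s2 *\<^sub>R u *\<^sub>R w = sig k (p1 + sg s1 *\<^sub>R u *\<^sub>R w)" by metis
      then show False
      proof cases
        case 1
        then show False using p1(3) p2(3) assms(3) by simp
      next
        case (2 k)
        have "p2 = sig k p1" using 2(5) by (simp add: 2(1) sg_opp sig_add)
        moreover have "f k (p1 + u *\<^sub>R sg s1 *\<^sub>R w) = 0" using 2(4) by (simp add: mult.commute)
        then have "f k p1 = 0" using G 2(2,3) unfolding G_def by (metis atLeastLessThan_iff less_irrefl linorder_neqE_linordered_idom)
        ultimately show False using C_glue[OF 2(2,3) p1(1)] 2(1) p1(3) p2(3) assms(3) by simp
      qed
    qed
  qed
qed

text \<open>On an edge \<open>k\<close> a displacement points into the polygon for one of the two
  representatives, according to the sign of \<open>f k\<close>.\<close>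

lemma displaced_ex:
  assumes "regp q"
  shows "\<forall>\<^sub>F u in nhds 0. \<exists>r. regp r \<and> displaced q (Lam (u *\<^sub>R w)) r"
proof -
  obtain s p where p: "reg p" "q = C s p" using assms by (rule regpE)
  have ok: "\<exists>r. regp r \<and> displaced q (Lam (u *\<^sub>R w)) r"
    if "reg p'" "q = C s' p'" "\<forall>j\<in>{0..<N}. f j (p' + u *\<^sub>R sg s' *\<^sub>R w) \<ge> 0"
      "\<forall>i\<in>{0..<N}. \<forall>j\<in>{0..<N}. f i (p' + u *\<^sub>R sg s' *\<^sub>R w) = 0 \<and> f j (p' + u *\<^sub>R sg s' *\<^sub>R w) = 0 \<longrightarrow> i = j"
    for s' p' u
  proof -
    have "reg (p' + u *\<^sub>R sg s' *\<^sub>R w)" using that by (simp add: reg_def P_def)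
    moreover have e: "p' + u *\<^sub>R sg s' *\<^sub>R w = p' + sg s' *\<^sub>R u *\<^sub>R w" by (simp add: mult.commute)
    ultimately have r: "reg (p' + sg s' *\<^sub>R u *\<^sub>R w)" by (simp only: e)
    have "displaced q (Lam (u *\<^sub>R w)) (C s' (p' + sg s' *\<^sub>R u *\<^sub>R w))"
      using displaced_iff[of q "C s' (p' + sg s' *\<^sub>R u *\<^sub>R w)" "u *\<^sub>R w"] that(1,2) r reg_P C_surface by blast
    then show ?thesis using r regp_C reg_P by blast
  qed
  show ?thesis
  proof (cases "\<exists>k. 0 \<le> k \<and> k < N \<and> f k p = 0")
    case False
    have pos: "f j p > 0" if "j \<in> {0..<N}" for j
    proof -
      have "f j p \<ge> 0" using reg_P[OF p(1)] that by (simp add: P_def)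
      moreover have "f j p \<noteq> 0" using False that by auto
      ultimately show ?thesis by simp
    qed
    show ?thesis using eventually_f[of p "sg s *\<^sub>R w"]
    proof eventually_elim
      case (elim u)
      then have "\<forall>j\<in>{0..<N}. f j (p + u *\<^sub>R sg s *\<^sub>R w) > 0" using pos by blast
      then show ?case using ok[OF p, of u] by (metis less_imp_le less_irrefl)
    qed
  next
    case True
    then obtain k where k: "0 \<le> k" "k < N" "f k p = 0" by blast
    have p': "reg (sig k p)" "q = C (opp s) (sig k p)"
      using reg_sig p k C_glue[OF k(1,2) reg_P[OF p(1)] k(3)] by auto
    have pos: "f j p > 0" "f j (sig k p) > 0" if "j \<in> {0..<N}" "j \<noteq> k" for j
      using reg_pos[OF p(1) k(3,1,2)] reg_pos[OF p'(1) _ k(1,2)] that k(3) f_sig[of k p] by auto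
    show ?thesis using eventually_f[of p "sg s *\<^sub>R w"] eventually_f[of "sig k p" "sg (opp s) *\<^sub>R w"]
    proof eventually_elim
      case (elim u)
      let ?a = "p + u *\<^sub>R sg s *\<^sub>R w" and ?b = "sig k p + u *\<^sub>R sg (opp s) *\<^sub>R w"
      have ab: "?b = sig k ?a" by (simp add: sig_add sg_opp)
      have pa: "f j ?a > 0" "f j ?b > 0" if "j \<in> {0..<N}" "j \<noteq> k" for j
        using elim pos[OF that] that by auto
      show ?case
      proof (cases "f k ?a \<ge> 0")
        case True
        have "\<forall>j\<in>{0..<N}. f j ?a \<ge> 0" using pa True by (metis less_imp_le)
        moreover have "\<forall>i\<in>{0..<N}. \<forall>j\<in>{0..<N}. f i ?a = 0 \<and> f j ?a = 0 \<longrightarrow> i = j" using pa by (metis less_irrefl)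
        ultimately show ?thesis by (rule ok[OF p])
      next
        case False
        then have F: "f k ?b \<ge> 0" unfolding ab f_sig by simp
        have "\<forall>j\<in>{0..<N}. f j ?b \<ge> 0" using pa F by (metis less_imp_le)
        moreover have "\<forall>i\<in>{0..<N}. \<forall>j\<in>{0..<N}. f i ?b = 0 \<and> f j ?b = 0 \<longrightarrow> i = j" using pa by (metis less_irrefl)
        ultimately show ?thesis by (rule ok[OF p'])
      qed
    qed
  qed
qed

section \<open>Straight paths and their unique continuation\<close>

definition straight :: "real set \<Rightarrow> real \<times> real \<Rightarrow> (real \<Rightarrow> point) \<Rightarrow> bool" where
  "straight I w \<gamma> \<longleftrightarrow> (\<forall>t\<in>I. \<gamma> t \<in> surface n \<and>
     (\<forall>\<^sub>F u in nhds 0. t + u \<in> I \<longrightarrow> displaced (\<gamma> t) (Lam (u *\<^sub>R w)) (\<gamma> (t + u))))"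

lemma straight_surface: "straight I w \<gamma> \<Longrightarrow> t \<in> I \<Longrightarrow> \<gamma> t \<in> surface n"
  by (simp add: straight_def)

lemma straightD: "straight I w \<gamma> \<Longrightarrow> t \<in> I \<Longrightarrow>
    \<forall>\<^sub>F u in nhds 0. t + u \<in> I \<longrightarrow> displaced (\<gamma> t) (Lam (u *\<^sub>R w)) (\<gamma> (t + u))"
  by (simp add: straight_def)

lemma straight_subset: "straight I w \<gamma> \<Longrightarrow> J \<subseteq> I \<Longrightarrow> straight J w \<gamma>"
  unfolding straight_def by (fast elim: eventually_mono)

lemma straight_cong:
  assumes "straight I w \<gamma>" "\<And>t. t \<in> I \<Longrightarrow> \<gamma>' t = \<gamma> t"
  shows "straight I w \<gamma>'"
  unfolding straight_def
proof (intro ballI conjI)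
  fix t assume t: "t \<in> I"
  show "\<gamma>' t \<in> surface n" using assms t straight_surface by metis
  show "\<forall>\<^sub>F u in nhds 0. t + u \<in> I \<longrightarrow> displaced (\<gamma>' t) (Lam (u *\<^sub>R w)) (\<gamma>' (t + u))"
    using straightD[OF assms(1) t] by eventually_elim (use t assms(2) in simp)
qed

lemma straight_affine:
  assumes "straight I w \<gamma>"
  shows "straight {t. a + c * t \<in> I} (c *\<^sub>R w) (\<lambda>t. \<gamma> (a + c * t))"
  unfolding straight_def
proof (intro ballI conjI)
  fix t assume "t \<in> {t. a + c * t \<in> I}"
  then have t: "a + c * t \<in> I" by simp
  then show "\<gamma> (a + c * t) \<in> surface n" using assms by (simp add: straight_def)
  have "((\<lambda>u. c * u) \<longlongrightarrow> c * 0) (nhds 0)" by (intro tendsto_intros tendsto_id_nhds)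
  then have "filterlim (\<lambda>u. c * u) (nhds 0) (nhds 0)" by simp
  from eventually_compose_filterlim[OF straightD[OF assms t] this]
  show "\<forall>\<^sub>F u in nhds 0. t + u \<in> {t. a + c * t \<in> I} \<longrightarrow>
      displaced (\<gamma> (a + c * t)) (Lam (u *\<^sub>R c *\<^sub>R w)) (\<gamma> (a + c * (t + u)))"
    by eventually_elim (simp add: algebra_simps)
qed

lemma straight_join:
  assumes "straight {a..b} w \<gamma>" "straight {b..c} w \<gamma>" "a \<le> b" "b \<le> c"
  shows "straight {a..c} w \<gamma>"
  unfolding straight_def
proof (intro ballI conjI)
  fix t assume t: "t \<in> {a..c}"
  show "\<gamma> t \<in> surface n" using t assms straight_surface by (cases "t \<le> b") auto
  have lim: "((\<lambda>u. t + u) \<longlongrightarrow> t + 0) (nhds 0)" by (intro tendsto_intros tendsto_id_nhds)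
  consider "t < b" | "t > b" | "t = b" by linarith
  then show "\<forall>\<^sub>F u in nhds 0. t + u \<in> {a..c} \<longrightarrow> displaced (\<gamma> t) (Lam (u *\<^sub>R w)) (\<gamma> (t + u))"
  proof cases
    case 1
    then have "t \<in> {a..b}" using t by simp
    moreover have "\<forall>\<^sub>F u in nhds 0. t + u < b" using order_tendstoD(2)[OF lim, of b] 1 by simp
    ultimately show ?thesis using straightD[OF assms(1), of t] by (auto elim: eventually_elim2)
  next
    case 2
    then have "t \<in> {b..c}" using t by simp
    moreover have "\<forall>\<^sub>F u in nhds 0. b < t + u" using order_tendstoD(1)[OF lim, of b] 2 by simp
    ultimately show ?thesis using straightD[OF assms(2), of t] by (auto elim: eventually_elim2)
  next
    case 3
    then have "t \<in> {a..b}" "t \<in> {b..c}" using t by auto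
    from straightD[OF assms(1) this(1)] straightD[OF assms(2) this(2)]
    show ?thesis by eventually_elim (use 3 in force)
  qed
qed

lemma straight_sheet:
  assumes "\<And>t. t \<in> I \<Longrightarrow> p + (t - a) *\<^sub>R sg s *\<^sub>R w \<in> P"
  shows "straight I w (\<lambda>t. C s (p + (t - a) *\<^sub>R sg s *\<^sub>R w))"
  unfolding straight_def
proof (intro ballI conjI always_eventually allI impI)
  fix t assume t: "t \<in> I"
  show s: "C s (p + (t - a) *\<^sub>R sg s *\<^sub>R w) \<in> surface n" using assms t by blast
  fix u assume u: "t + u \<in> I"
  have "(p + (t - a) *\<^sub>R sg s *\<^sub>R w) + sg s *\<^sub>R u *\<^sub>R w = p + (t + u - a) *\<^sub>R sg s *\<^sub>R w"
    by (simp add: algebra_simps)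
  then show "displaced (C s (p + (t - a) *\<^sub>R sg s *\<^sub>R w)) (Lam (u *\<^sub>R w)) (C s (p + (t + u - a) *\<^sub>R sg s *\<^sub>R w))"
    using displaced_iff[OF s C_surface[OF assms[OF u]], of "u *\<^sub>R w"] assms[OF t] assms[OF u] by metis
qed

text \<open>Only one of the paths is assumed to avoid the corners, so a trajectory that starts along a segment
  follows it as long as the segment stays in the polygon.\<close>

lemma straight_unique:
  assumes "connected I" "straight I w \<alpha>" "\<And>t. t \<in> I \<Longrightarrow> regp (\<alpha> t)" "straight I w \<beta>'"
    "t0 \<in> I" "\<alpha> t0 = \<beta>' t0" "t \<in> I"
  shows "\<alpha> t = \<beta>' t"
proof (rule connected_induction_simple[OF assms(1,5,7), of "\<lambda>t. \<alpha> t = \<beta>' t"])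
  show "\<alpha> t0 = \<beta>' t0" by fact
  fix a assume a: "a \<in> I"
  have "\<forall>\<^sub>F u in nhds 0. a + u \<in> I \<longrightarrow> (\<alpha> (a + u) = \<beta>' (a + u) \<longleftrightarrow> \<alpha> a = \<beta>' a)"
  proof (cases "\<alpha> a = \<beta>' a")
    case True
    from straightD[OF assms(2) a] straightD[OF assms(4) a] show ?thesis
    proof eventually_elim
      case (elim u)
      then show ?case using True assms(2-4) a straight_surface
        displaced_unique[of "\<alpha> a" "\<alpha> (a + u)" "\<beta>' (a + u)" "u *\<^sub>R w"] by metis
    qed
  next
    case False
    from straightD[OF assms(2) a] straightD[OF assms(4) a]
      separate[OF assms(3)[OF a] straight_surface[OF assms(4) a] False, of w] show ?thesis
    proof eventually_elim
      case (elim u)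
      then show ?case using False assms(3) by metis
    qed
  qed
  then obtain e where e: "e > 0" "\<And>u. dist u 0 < e \<Longrightarrow> a + u \<in> I \<Longrightarrow> \<alpha> (a + u) = \<beta>' (a + u) \<longleftrightarrow> \<alpha> a = \<beta>' a"
    unfolding eventually_nhds_metric by blast
  have near: "\<alpha> x = \<beta>' x \<longleftrightarrow> \<alpha> a = \<beta>' a" if "x \<in> I \<inter> ball a e" for x
    using e(2)[of "x - a"] that by (simp add: dist_real_def abs_minus_commute)
  show "\<exists>T. openin (top_of_set I) T \<and> a \<in> T \<and> (\<forall>x\<in>T. \<forall>y\<in>T. \<alpha> x = \<beta>' x \<longrightarrow> \<alpha> y = \<beta>' y)"
  proof (intro exI conjI)
    show "openin (top_of_set I) (I \<inter> ball a e)" by (rule openin_open_Int) simp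
    show "a \<in> I \<inter> ball a e" using a e(1) by simp
    show "\<forall>x\<in>I \<inter> ball a e. \<forall>y\<in>I \<inter> ball a e. \<alpha> x = \<beta>' x \<longrightarrow> \<alpha> y = \<beta>' y"
      using near by metis
  qed
qed

section \<open>Mirrored velocities, horizontal chords and horizontal cylinders\<close>

definition mir :: "real \<times> real \<Rightarrow> real \<times> real" where "mir w = (- fst w, snd w)"

lemma mir_scale: "mir (t *\<^sub>R w) = t *\<^sub>R mir w" by (simp add: mir_def)

lemma veech_Lam_mir: "(flip ** M n) *v Lam w = Lam (mir w)"
  using veech_Lam[of "fst w" "snd w"] by (simp add: mir_def)

lemma reg_chord:
  assumes "1 \<le> k" "k \<le> N - 2" "g (k + 1) p = 0" "0 < g k p" "g k p < ell k"
  shows "reg p"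
proof (rule reg_tri[of p k])
  have "ell (k + 1) > 0" using assms by (intro ell_pos) auto
  then show "p \<in> tri k" using assms g_rec[of k p] by (simp add: tri_def f_def)
qed (use assms g_zt[of k] in auto)

text \<open>In the cylinder between two horizontal chords, the polygon is cut out by two of the edges.\<close>

lemma reg_cylinder:
  assumes "2 \<le> j" "j \<le> N - 1" "0 < g j p" "g j p < ell j" "f j p \<ge> 0" "f (j - 1) p \<ge> 0"
  shows "reg p"
proof (cases "g (j + 1) p \<le> 0")
  case True
  have e: "j - 1 + 1 = j" "j - 1 + 2 = j + 1" by simp_all
  show ?thesis
  proof (rule reg_tri[of p "j - 1"])
    show "p \<in> tri (j - 1)" using True assms by (simp add: tri_def e)
  qed (use assms g_zt[of "j - 1"] in \<open>auto simp: e\<close>)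
next
  case False
  have "j \<noteq> N - 1"
  proof
    assume j: "j = N - 1"
    then have "ell j > 0" using n_ge_3 by (intro ell_pos) auto
    moreover have "f j p = - ell j * g (j + 1) p" using j by (simp add: f_def)
    moreover have "ell j * g (j + 1) p > 0" using False \<open>ell j > 0\<close> by (intro mult_pos_pos) auto
    ultimately show False using assms(5) by linarith
  qed
  then show ?thesis
    using assms False g_rec[of j p] g_zt[of j] by (intro reg_tri[of p j]) (auto simp: tri_def)
qed

text \<open>For even index \<open>g\<close> measures height, and the horizontal chords are the odd
  steps of the zigzag, the bottom edge being step 1. The topmost cylinder, \<open>j = N - 1\<close>,
  ends at the corner \<open>zt N\<close> and not at a chord.\<close>

lemma P_horizontal_cases:
  assumes "reg p"
  obtains (chord) k where "odd k" "1 \<le> k" "k \<le> N - 2" "g (k + 1) p = 0" "0 < g k p" "g k p < ell k"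
  | (cylinder) j where "even j" "2 \<le> j" "j \<le> N - 1" "0 < g j p" "g j p < ell j"
proof -
  obtain k where k: "1 \<le> k" "k \<le> N - 2" "p \<in> tri k" using P_cover[OF reg_P[OF assms]] by blast
  note B = tri_bounds[OF k(3,1,2)]
  \<comment> \<open>The slanted side of the triangle, which is the even one of its two zigzag steps,
    spans the height of a cylinder.\<close>
  define j where "j = (if even k then k else k + 1)"
  have oddN: "odd N" using odd_n by simp
  have j: "even j" "2 \<le> j" "j \<le> N - 1" "0 \<le> g j p" "g j p \<le> ell j"
    using k B by (auto simp: j_def elim!: evenE)
  have ch: thesis if "odd i" "1 \<le> i" "i \<le> N - 2" "g (i + 1) p = 0" for i
  proof -
    have e: "ell (i + 1) > 0" using that by (intro ell_pos) auto
    have "f i p \<ge> 0" "f (i + 1) p \<ge> 0" using that reg_P[OF assms] by (auto simp: P_def)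
    moreover have "f i p = ell (i + 1) * g i p" using that by (simp add: f_def)
    moreover have "f (i + 1) p = ell (i + 1) * (ell i - g i p)"
      using that(4) by (simp add: f_def add.assoc g_rec[of i p] algebra_simps)
    ultimately have "0 \<le> g i p" "g i p \<le> ell i" using e by (auto simp: zero_le_mult_iff)
    moreover have "g i p \<noteq> 0"
      using g_eqI[of i p "zt i"] g_zt[of i] that assms not_reg_zt[of i] by auto
    moreover have "g i p \<noteq> ell i"
      using g_eqI[of i p "zt (i + 1)"] g_zt[of i] that assms not_reg_zt[of "i + 1"] by auto
    ultimately show thesis using chord[of i] that by auto
  qed
  consider "0 < g j p" "g j p < ell j" | "g j p = 0" | "g j p = ell j" using j(4,5) by linarith
  then show thesis
  proof cases
    case 1
    then show thesis using cylinder j by blast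
  next
    case 2
    then show thesis using ch[of "j - 1"] j by simp
  next
    case 3
    show thesis
    proof (cases "j = N - 1")
      case True
      then have kj: "k = N - 2" "k + 1 = j" using k oddN by (auto simp: j_def split: if_splits)
      have e: "ell (k + 1) > 0" using k by (intro ell_pos) auto
      have "f k p \<ge> 0" using k by (simp add: tri_def)
      moreover have "f k p = ell (k + 1) * (g k p - ell k)"
        unfolding f_def kj(2) 3 by (simp add: algebra_simps)
      ultimately have "ell (k + 1) * (g k p - ell k) \<ge> 0" by simp
      then have "g k p = ell k" using e B by (simp add: zero_le_mult_iff)
      then have "p = zt (k + 2)" using g_eqI[of k p "zt (k + 2)"] g_zt[of k] 3 kj by simp
      then show thesis using not_reg_zt[of "k + 2"] k assms by simp
    next
      case False
      then have "j \<le> N - 2" using j by simp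
      moreover have "j \<noteq> N - 2" using j oddN by auto
      ultimately show thesis using ch[of "j + 1"] j 3 g_rec[of j p] by (simp add: add.assoc)
    qed
  qed
qed

definition exit_edge :: "int \<Rightarrow> sheet \<Rightarrow> int" where
  "exit_edge j s = (if s = Upper then j else j - 1)"

text \<open>A leaf in the interior of a horizontal cylinder crosses its two edges alternately, so it can be
  followed for any length.\<close>

lemma cylinder_leaf:
  assumes j: "even j" "2 \<le> j" "j \<le> N - 1" and x: "0 < x" "x < ell j"
  obtains D where "D > 0"
    "\<And>m s p. reg p \<Longrightarrow> g j p \<in> {x, ell j - x} \<Longrightarrow>
      \<exists>\<eta>. straight {0..real m * D} (1, 0) \<eta> \<and> \<eta> 0 = C s p \<and> (\<forall>t\<in>{0..real m * D}. regp (\<eta> t))"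
proof -
  define Z where "Z q \<longleftrightarrow> (\<exists>s p. q = C s p \<and> reg p \<and> g j p \<in> {x, ell j - x})" for q
  have ej: "ell j > 0" "ell (j - 1) > 0" "ell (j + 1) \<ge> 0"
    using j by (auto intro: ell_pos ell_nonneg)
  have ZI: "Z (C s p)" if "reg p" "g j p \<in> {x, ell j - x}" for s p
    unfolding Z_def using that by blast
  \<comment> \<open>The width of the polygon at height \<open>y\<close>, interpolated between the
    bounding chords. The gluing exchanges the heights \<open>x\<close> and \<open>ell j - x\<close>;
    moving by the smaller of the two widths crosses at most one edge before a new start.\<close>
  define lam where "lam y = ell (j - 1) * (ell j - y) / ell j + ell (j + 1) * y / ell j" for y
  define D where "D = min (lam x) (lam (ell j - x)) / ell j * ell j"
  have lam_pos: "lam y > 0" if "0 < y" "y < ell j" for y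
    unfolding lam_def using ej that by (intro add_pos_nonneg divide_pos_pos divide_nonneg_pos mult_pos_pos mult_nonneg_nonneg) auto
  have D: "D > 0" "D \<le> lam x" "D \<le> lam (ell j - x)" using lam_pos x ej by (auto simp: D_def)
  have Dy: "D \<le> lam y" "0 < y" "y < ell j" "ell j - y \<in> {x, ell j - x}" if "y \<in> {x, ell j - x}" for y
    using that D x by auto
  have sum: "f j p + f (j - 1) p = ell j * lam (g j p)" for p
  proof -
    have "j - 1 + 2 = j + 1" by simp
    then have e: "g (j + 1) p = g (j - 1) p - ell (j - 1)" using g_rec[of "j - 1" p] by metis
    show ?thesis unfolding f_def e using ej by (simp add: lam_def field_simps)
  qed
  have jj: "0 \<le> exit_edge j s" "exit_edge j s < N" for s
    using j by (auto simp: exit_edge_def)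
  have gsig: "g j (sig (exit_edge j s) p) = ell j - g j p" for s p
    using g_sig[of j p] g_sig(2)[of "j - 1" p] by (simp add: exit_edge_def)
  have prj: "pr j (1, 0) = 0" "pr (j + 1) (1, 0) = 1" "pr (j - 1) (1, 0) = 1" using j by (auto simp: pr_def)
  have gm: "g j (p + t *\<^sub>R sg s *\<^sub>R (1, 0)) = g j p" for p t s
    by (simp only: g_move pr_scale prj mult_zero_right add_0_right)
  have fm: "f (exit_edge j s) (p + t *\<^sub>R sg s *\<^sub>R (1, 0)) = f (exit_edge j s) p - t * ell j"
    "f (exit_edge j (opp s)) (p + t *\<^sub>R sg s *\<^sub>R (1, 0)) = f (exit_edge j (opp s)) p + t * ell j" for p t s
    using prj by (simp_all only: f_move df_scale) (auto simp: df_def exit_edge_def sg_def opp_def)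
  have sum': "f (exit_edge j s) p + f (exit_edge j (opp s)) p = ell j * lam (g j p)" for s p
    using sum[of p] by (auto simp: exit_edge_def opp_def)
  have inP: "reg p" if "0 < g j p" "g j p < ell j" "f (exit_edge j s) p \<ge> 0" "f (exit_edge j (opp s)) p \<ge> 0" for s p
    by (rule reg_cylinder[OF j(2,3) that(1,2)]) (use that(3,4) in \<open>auto simp: exit_edge_def opp_def split: if_splits\<close>)
  have step: "\<exists>\<eta>. straight {0..D} (1, 0) \<eta> \<and> \<eta> 0 = q \<and> (\<forall>t\<in>{0..D}. regp (\<eta> t)) \<and> Z (\<eta> D)" if zq: "Z q" for q
  proof -
    obtain s p where p: "q = C s p" "reg p" "g j p \<in> {x, ell j - x}" using zq unfolding Z_def by blast
    define y where "y = g j p"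
    have y: "D \<le> lam y" "0 < y" "y < ell j" "ell j - y \<in> {x, ell j - x}" "y \<in> {x, ell j - x}"
      using Dy[of y] p(3) by (auto simp: y_def)
    have F0: "f (exit_edge j s) p \<ge> 0" "f (exit_edge j (opp s)) p \<ge> 0"
      using reg_P[OF p(2)] jj by (auto simp: P_def)
    define d where "d = f (exit_edge j s) p / ell j"
    have d: "d \<ge> 0" "d * ell j = f (exit_edge j s) p" using F0 ej by (auto simp: d_def)
    let ?P1 = "\<lambda>t. p + (t - 0) *\<^sub>R sg s *\<^sub>R (1, 0)"
    have r1: "reg (?P1 t)" if "0 \<le> t" "t \<le> d" for t
    proof (rule inP[of _ s])
      have "t * ell j \<le> d * ell j" "t * ell j \<ge> 0" using that ej by (auto intro: mult_right_mono)
      then show "f (exit_edge j s) (?P1 t) \<ge> 0" "f (exit_edge j (opp s)) (?P1 t) \<ge> 0"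
        using fm[of s p t] d F0 by auto
    qed (use gm[of p t s] y y_def in auto)
    show ?thesis
    proof (cases "D \<le> d")
      case True
      show ?thesis
      proof (intro exI[of _ "\<lambda>t. C s (?P1 t)"] conjI ballI)
        show "straight {0..D} (1, 0) (\<lambda>t. C s (?P1 t))"
          by (rule straight_sheet) (use True r1 reg_P in auto)
        show "regp (C s (?P1 t))" if "t \<in> {0..D}" for t using that True r1[of t] regp_C reg_P by auto
        show "Z (C s (?P1 D))"
          by (rule ZI) (use r1[of D] True D(1) gm[of p D s] p(3) in simp_all)
      qed (use p in \<open>simp flip: zero_prod_def\<close>)
    next
      case False
      define p' where "p' = sig (exit_edge j s) (?P1 d)"
      have f0: "f (exit_edge j s) (?P1 d) = 0" using fm[of s p d] d by simp
      have gl: "C (opp s) p' = C s (?P1 d)" unfolding p'_def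
        using C_glue[OF jj reg_P[OF r1[OF d(1) order.refl]] f0] .
      let ?P2 = "\<lambda>t. p' + (t - d) *\<^sub>R sg (opp s) *\<^sub>R (1, 0)"
      have gp': "g j p' = ell j - y" unfolding p'_def gsig using gm[of p d s] y_def by simp
      have fp': "f (exit_edge j s) p' = 0" unfolding p'_def f_sig f0 by simp
      then have fp'2: "f (exit_edge j (opp s)) p' = ell j * lam (ell j - y)"
        using sum'[of s p'] gp' by simp
      have r2: "reg (?P2 t)" if "d \<le> t" "t \<le> D" for t
      proof (rule inP[of _ "opp s"])
        have "D \<le> lam (ell j - y)" using Dy[OF y(4)] by simp
        then have "(t - d) * ell j \<le> lam (ell j - y) * ell j" "(t - d) * ell j \<ge> 0"
          using that ej d(1) by (auto intro: mult_right_mono)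
        then show "f (exit_edge j (opp s)) (?P2 t) \<ge> 0" "f (exit_edge j (opp (opp s))) (?P2 t) \<ge> 0"
          using fm[of "opp s" p' "t - d"] fp' fp'2 by (auto simp: mult.commute)
      qed (use gm[of p' "t - d" "opp s"] gp' y in auto)
      define \<eta> where "\<eta> = (\<lambda>t. if t \<le> d then C s (?P1 t) else C (opp s) (?P2 t))"
      have "straight {0..d} (1, 0) (\<lambda>t. C s (?P1 t))"
        by (rule straight_sheet) (use r1 reg_P in auto)
      then have 1: "straight {0..d} (1, 0) \<eta>" by (rule straight_cong) (simp add: \<eta>_def)
      have "straight {d..D} (1, 0) (\<lambda>t. C (opp s) (?P2 t))"
        by (rule straight_sheet) (use r2 reg_P in auto)
      then have 2: "straight {d..D} (1, 0) \<eta>"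
      proof (rule straight_cong)
        show "\<eta> t = C (opp s) (?P2 t)" if "t \<in> {d..D}" for t
          using that gl by (cases "t = d") (simp_all add: \<eta>_def flip: zero_prod_def)
      qed
      show ?thesis
      proof (intro exI[of _ \<eta>] conjI ballI)
        show "straight {0..D} (1, 0) \<eta>" by (rule straight_join[OF 1 2]) (use d False in auto)
        show "\<eta> 0 = q" using d p by (simp add: \<eta>_def flip: zero_prod_def)
        show "regp (\<eta> t)" if "t \<in> {0..D}" for t
          using that r1[of t] r2[of t] regp_C reg_P by (auto simp: \<eta>_def)
        have "Z (C (opp s) (?P2 D))"
          by (rule ZI) (use False r2[of D] gm[of p' "D - d" "opp s"] gp' y(4) in simp_all)
        then show "Z (\<eta> D)" unfolding \<eta>_def using False by simp
      qed
    qed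
  qed
  have iter: "Z q \<longrightarrow> (\<exists>\<eta>. straight {0..real m * D} (1, 0) \<eta> \<and> \<eta> 0 = q \<and> (\<forall>t\<in>{0..real m * D}. regp (\<eta> t)) \<and>
      Z (\<eta> (real m * D)))" for m q
  proof (induction m)
    case 0
    show ?case
    proof
      assume z: "Z q"
      from step[OF z] obtain \<eta> where \<eta>: "straight {0..D} (1, 0) \<eta>" "\<eta> 0 = q" "\<forall>t\<in>{0..D}. regp (\<eta> t)" by blast
      then show "\<exists>\<eta>. straight {0..real 0 * D} (1, 0) \<eta> \<and> \<eta> 0 = q \<and> (\<forall>t\<in>{0..real 0 * D}. regp (\<eta> t)) \<and> Z (\<eta> (real 0 * D))"
        using straight_subset[OF \<eta>(1), of "{0..0}"] D z by (intro exI[of _ \<eta>]) auto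
    qed
  next
    case (Suc m)
    show ?case
    proof
      assume z: "Z q"
      let ?a = "real m * D"
      obtain \<eta> where \<eta>: "straight {0..?a} (1, 0) \<eta>" "\<eta> 0 = q" "\<forall>t\<in>{0..?a}. regp (\<eta> t)" "Z (\<eta> ?a)"
        using Suc z by blast
      obtain \<eta>' where \<eta>': "straight {0..D} (1, 0) \<eta>'" "\<eta>' 0 = \<eta> ?a" "\<forall>t\<in>{0..D}. regp (\<eta>' t)" "Z (\<eta>' D)"
        using step[OF \<eta>(4)] by blast
      define \<theta> where "\<theta> t = (if t \<le> ?a then \<eta> t else \<eta>' (- ?a + 1 * t))" for t
      have a: "?a \<ge> 0" "real (Suc m) * D = ?a + D" using D by (auto simp: algebra_simps)
      have 1: "straight {0..?a} (1, 0) \<theta>" using \<eta>(1) by (rule straight_cong) (simp add: \<theta>_def)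
      have "straight {t. - ?a + 1 * t \<in> {0..D}} (1 *\<^sub>R (1, 0)) (\<lambda>t. \<eta>' (- ?a + 1 * t))"
        by (rule straight_affine[OF \<eta>'(1)])
      then have "straight {?a..?a + D} (1, 0) (\<lambda>t. \<eta>' (- ?a + 1 * t))"
        unfolding scaleR_one by (rule straight_subset) auto
      then have 2: "straight {?a..?a + D} (1, 0) \<theta>"
      proof (rule straight_cong)
        show "\<theta> t = \<eta>' (- ?a + 1 * t)" if "t \<in> {?a..?a + D}" for t
          using that \<eta>'(2) by (cases "t = ?a") (simp_all add: \<theta>_def)
      qed
      show "\<exists>\<eta>. straight {0..real (Suc m) * D} (1, 0) \<eta> \<and> \<eta> 0 = q \<and> (\<forall>t\<in>{0..real (Suc m) * D}. regp (\<eta> t)) \<and> Z (\<eta> (real (Suc m) * D))"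
      proof (intro exI[of _ \<theta>] conjI ballI)
        show "straight {0..real (Suc m) * D} (1, 0) \<theta>" unfolding a(2)
          by (rule straight_join[OF 1 2]) (use a D in auto)
        show "\<theta> 0 = q" using a \<eta>(2) by (simp add: \<theta>_def)
        show "regp (\<theta> t)" if "t \<in> {0..real (Suc m) * D}" for t
          using that \<eta>(3) \<eta>'(3) a by (auto simp: \<theta>_def)
        show "Z (\<theta> (real (Suc m) * D))" unfolding a(2) using \<eta>'(4) D by (simp add: \<theta>_def)
      qed
    qed
  qed
  show thesis
  proof (rule that[OF D(1)])
    fix m s p assume "reg p" "g j p \<in> {x, ell j - x}"
    then have "Z (C s p)" by (rule ZI)
    then show "\<exists>\<eta>. straight {0..real m * D} (1, 0) \<eta> \<and> \<eta> 0 = C s p \<and> (\<forall>t\<in>{0..real m * D}. regp (\<eta> t))"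
      using iter by blast
  qed
qed

subsection \<open>Boxes\<close>

text \<open>The map that negates \<open>x\<close>, translated so that the centre of the box of edge
  \<open>k\<close> stays fixed.\<close>

definition rho :: "int \<Rightarrow> real \<times> real \<Rightarrow> real \<times> real" where
  "rho k p = (fst (zt k) + fst (zt (k + 2)) - fst p, snd p)"

definition F :: "int \<Rightarrow> real \<times> real \<Rightarrow> real" where
  "F k p = ell (k + 1) * g k p + ell k * g (k + 1) p - ell k * ell (k + 1)"

text \<open>The box of an edge is the parallelogram with horizontal and slanted sides that has the edge as a
  diagonal; its two halves lie in the two polygons. The Veech element reflects every box to itself and
  so exchanges the edge with the other diagonal, which is the zero set of \<open>F k\<close>.\<close>

definition inb :: "int \<Rightarrow> real \<times> real \<Rightarrow> bool" where
  "inb k p \<longleftrightarrow> 0 \<le> g k p \<and> g k p \<le> ell k \<and> 0 \<le> g (k + 1) p \<and> g (k + 1) p \<le> ell (k + 1) \<and>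
     \<not> (g k p \<in> {0, ell k} \<and> g (k + 1) p \<in> {0, ell (k + 1)})"

text \<open>One chart for the whole box: upper coordinates are continued across the edge, and beyond
  it \<open>sig k\<close> converts them into those of the lower sheet.\<close>

definition Bx :: "int \<Rightarrow> real \<times> real \<Rightarrow> point" where
  "Bx k p = (if f k p \<ge> 0 then C Upper p else C Lower (sig k p))"

lemma rho_rho [simp]: "rho k (rho k p) = p"
  by (simp add: rho_def)

lemma rho_move: "rho k (p + t *\<^sub>R w) = rho k p + t *\<^sub>R mir w"
  by (simp add: rho_def mir_def)

lemma g_rho_odd: "odd k \<Longrightarrow> g k (rho k p) = ell k - g k p" "odd k \<Longrightarrow> g (k + 1) (rho k p) = g (k + 1) p"
  using g_zt[of k] by (simp_all add: g_def pr_def rho_def)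

lemma g_rho_even: "even k \<Longrightarrow> g k (rho k p) = g k p" "even k \<Longrightarrow> g (k + 1) (rho k p) = ell (k + 1) - g (k + 1) p"
  using g_zt[of k] by (simp_all add: g_def pr_def rho_def)

lemma inb_rho: "inb k p \<Longrightarrow> inb k (rho k p)"
  by (cases "odd k") (auto simp: inb_def g_rho_odd g_rho_even)

lemma inb_sig: "inb k p \<Longrightarrow> inb k (sig k p)"
  by (auto simp: inb_def g_sig)

lemma F_sig: "F k (sig k p) = - F k p"
  unfolding F_def g_sig by (simp add: algebra_simps)

lemma f_rho: "f k (rho k p) = 0 \<longleftrightarrow> F k p = 0"
proof -
  have "f k (rho k p) = - F k p" if "odd k"
    unfolding f_def F_def g_rho_odd[OF that] by (simp add: algebra_simps)
  moreover have "f k (rho k p) = F k p" if "even k"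
    unfolding f_def F_def g_rho_even[OF that] by (simp add: algebra_simps)
  ultimately show ?thesis by (cases "odd k") auto
qed

lemma inb_tri:
  assumes "1 \<le> k" "k \<le> N - 2" "inb k p" "f k p \<ge> 0"
  shows "p \<in> tri k" "reg p"
proof -
  show t: "p \<in> tri k" using assms g_rec[of k p] by (simp add: tri_def inb_def)
  show "reg p" by (rule reg_tri[OF t assms(1,2)]) (use assms(3) g_zt[of k] in \<open>auto simp: inb_def\<close>)
qed

lemma tri_inb:
  assumes "1 \<le> k" "k \<le> N - 2" "p \<in> tri k" "reg p"
  shows "inb k p"
proof -
  have e: "ell k > 0" "ell (k + 1) > 0" using assms by (auto intro: ell_pos)
  have v: "p \<noteq> zt k" "p \<noteq> zt (k + 1)" "p \<noteq> zt (k + 2)" using assms not_reg_zt by force+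
  have "\<not> (g k p \<in> {0, ell k} \<and> g (k + 1) p \<in> {0, ell (k + 1)})"
  proof
    assume "g k p \<in> {0, ell k} \<and> g (k + 1) p \<in> {0, ell (k + 1)}"
    then consider "g k p = 0" "g (k + 1) p = 0" | "g k p = ell k" "g (k + 1) p = 0"
      | "g k p = ell k" "g (k + 1) p = ell (k + 1)" | "g k p = 0" "g (k + 1) p = ell (k + 1)" by blast
    then show False
    proof cases
      case 4
      then have "f k p = - (ell k * ell (k + 1))" by (simp add: f_def)
      moreover have "f k p \<ge> 0" using assms(3) by (simp add: tri_def)
      ultimately show False using mult_pos_pos[OF e] by linarith
    qed (use g_eqI[of k p "zt k"] g_eqI[of k p "zt (k + 1)"] g_eqI[of k p "zt (k + 2)"] g_zt[of k] v in auto)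
  qed
  then show ?thesis using tri_bounds[OF assms(3,1,2)] by (simp add: inb_def)
qed

lemma Bx_cases:
  assumes "1 \<le> k" "k \<le> N - 2" "inb k p"
  shows "f k p \<ge> 0 \<Longrightarrow> Bx k p = C Upper p" "f k p \<le> 0 \<Longrightarrow> Bx k p = C Lower (sig k p)"
proof -
  show "Bx k p = C Lower (sig k p)" if "f k p \<le> 0"
  proof (cases "f k p = 0")
    case True
    have "C (opp Upper) (sig k p) = C Upper p"
      using assms True inb_tri(2)[OF assms] by (intro C_glue) (auto intro: reg_P)
    then show ?thesis using True by (simp add: Bx_def opp_def)
  qed (use that in \<open>simp add: Bx_def\<close>)
qed (simp add: Bx_def)

lemma regp_Bx: assumes "1 \<le> k" "k \<le> N - 2" "inb k p" shows "regp (Bx k p)"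
proof (cases "f k p \<ge> 0")
  case True
  then show ?thesis using inb_tri[OF assms True] regp_C reg_P by (simp add: Bx_def)
next
  case False
  then have "reg (sig k p)" using inb_tri[OF assms(1,2) inb_sig[OF assms(3)]] by (simp add: f_sig)
  then show ?thesis using False regp_C reg_P by (simp add: Bx_def)
qed

lemma C_Bx: assumes "1 \<le> k" "k \<le> N - 2" "p \<in> tri k" "reg p"
  shows "C s p = Bx k (if s = Upper then p else sig k p)"
proof -
  have "f k p \<ge> 0" using assms(3) by (simp add: tri_def)
  then show ?thesis
    using Bx_cases(1)[OF assms(1,2), of p] Bx_cases(2)[OF assms(1,2), of "sig k p"]
      tri_inb[OF assms] inb_sig by (cases s) (auto simp: f_sig)
qed

text \<open>A small displacement from a point off the edge stays in the same half of the box, and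
  one from a point on the edge stays in one closed half; so each is realised within a single
  polygon.\<close>

lemma straight_Bx:
  assumes k: "1 \<le> k" "k \<le> N - 2" and inb: "\<And>t. t \<in> I \<Longrightarrow> inb k (p + t *\<^sub>R w)"
  shows "straight I w (\<lambda>t. Bx k (p + t *\<^sub>R w))"
  unfolding straight_def
proof (intro ballI conjI)
  fix t assume t: "t \<in> I"
  let ?q = "p + t *\<^sub>R w"
  show "Bx k ?q \<in> surface n" using regp_Bx[OF k inb[OF t]] by (rule regp_surface)
  have up: "displaced (Bx k ?q) (Lam (u *\<^sub>R w)) (Bx k (p + (t + u) *\<^sub>R w))"
    if "t + u \<in> I" "f k ?q \<ge> 0" "f k (?q + u *\<^sub>R w) \<ge> 0" for u
  proof -
    have e: "p + (t + u) *\<^sub>R w = ?q + sg Upper *\<^sub>R u *\<^sub>R w" by (simp add: sg_def algebra_simps)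
    have "f k (p + (t + u) *\<^sub>R w) \<ge> 0" using that(3) by (simp add: algebra_simps)
    then show ?thesis
      using Bx_cases(1)[OF k inb[OF t] that(2)] Bx_cases(1)[OF k inb[OF that(1)]]
        displaced_C[of ?q Upper "u *\<^sub>R w"] inb_tri(2)[OF k inb[OF t] that(2)] inb_tri(2)[OF k inb[OF that(1)]] reg_P
      unfolding e by metis
  qed
  have down: "displaced (Bx k ?q) (Lam (u *\<^sub>R w)) (Bx k (p + (t + u) *\<^sub>R w))"
    if "t + u \<in> I" "f k ?q \<le> 0" "f k (?q + u *\<^sub>R w) \<le> 0" for u
  proof -
    have e: "sig k (p + (t + u) *\<^sub>R w) = sig k ?q + sg Lower *\<^sub>R u *\<^sub>R w" by (simp add: sg_def sig_def algebra_simps)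
    have f2: "f k (p + (t + u) *\<^sub>R w) \<le> 0" using that(3) by (simp add: algebra_simps)
    have "reg (sig k ?q)" "reg (sig k (p + (t + u) *\<^sub>R w))"
      using inb_tri(2)[OF k inb_sig[OF inb[OF t]]] inb_tri(2)[OF k inb_sig[OF inb[OF that(1)]]] that(2) f2 by (simp_all add: f_sig)
    then show ?thesis
      using Bx_cases(2)[OF k inb[OF t] that(2)] Bx_cases(2)[OF k inb[OF that(1)] f2]
        displaced_C[of "sig k ?q" Lower "u *\<^sub>R w"] reg_P
      unfolding e by metis
  qed
  have kk: "k \<in> {0..<N}" using k by simp
  show "\<forall>\<^sub>F u in nhds 0. t + u \<in> I \<longrightarrow> displaced (Bx k ?q) (Lam (u *\<^sub>R w)) (Bx k (p + (t + u) *\<^sub>R w))"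
    using eventually_f[of ?q w]
  proof eventually_elim
    case (elim u)
    then have "(f k ?q > 0 \<longrightarrow> f k (?q + u *\<^sub>R w) > 0) \<and> (f k ?q < 0 \<longrightarrow> f k (?q + u *\<^sub>R w) < 0)"
      using kk by blast
    then show ?case using up[of u] down[of u] by (metis less_eq_real_def linorder_le_cases not_less)
  qed
qed

text \<open>The four excluded corners are extreme points of the box, so removing them preserves
  convexity.\<close>

lemma inb_convex:
  assumes "inb k a" "inb k b" "0 \<le> t" "t \<le> 1"
  shows "inb k (a + t *\<^sub>R (b - a))"
proof -
  consider "t = 0" | "t = 1" | "0 < t" "t < 1" using assms by linarith
  then show ?thesis
  proof cases
    case 3
    have gi: "g i (a + t *\<^sub>R (b - a)) = (1 - t) * g i a + t * g i b" for i
      by (simp only: g_move pr_diff) (simp add: g_def algebra_simps)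
    have *: "0 \<le> (1 - t) * x + t * y \<and> (1 - t) * x + t * y \<le> L \<and>
        ((1 - t) * x + t * y \<in> {0, L} \<longrightarrow> x \<in> {0, L} \<and> y = x)"
      if "0 \<le> x" "x \<le> L" "0 \<le> y" "y \<le> L" for x y L :: real
    proof -
      have a: "0 \<le> (1 - t) * x" "0 \<le> t * y" "0 \<le> (1 - t) * (L - x)" "0 \<le> t * (L - y)"
        using 3 that by auto
      have b: "(1 - t) * x = 0 \<longleftrightarrow> x = 0" "t * y = 0 \<longleftrightarrow> y = 0" "(1 - t) * (L - x) = 0 \<longleftrightarrow> x = L" "t * (L - y) = 0 \<longleftrightarrow> y = L"
        using 3 by auto
      have c: "(1 - t) * x + t * y + ((1 - t) * (L - x) + t * (L - y)) = L" by (simp add: algebra_simps)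
      have "x = 0 \<and> y = 0" if "(1 - t) * x + t * y = 0" using a b that by linarith
      moreover have "x = L \<and> y = L" if "(1 - t) * x + t * y = L" using a b c that by linarith
      ultimately show ?thesis using a c by auto
    qed
    show ?thesis
      using *[of "g k a" "ell k" "g k b"] *[of "g (k + 1) a" "ell (k + 1)" "g (k + 1) b"] assms(1,2)
      unfolding inb_def gi by auto
  qed (use assms in auto)
qed

text \<open>The two short sides of the triangle are inner chords, with two exceptions: the bottom
  edge bounds \<open>tri 1\<close> and the last zigzag edge bounds
  \<open>tri (N - 2)\<close>.\<close>

lemma tri_zero:
  assumes "1 \<le> k" "k \<le> N - 2" "p \<in> tri k" "reg p" "0 \<le> j" "j < N" "f j p = 0"
  shows "j = k \<or> j = 0 \<or> j = N - 1"
proof -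
  have "p \<noteq> zt k" "p \<noteq> zt (k + 1)" "p \<noteq> zt (k + 2)" using assms not_reg_zt by force+
  then obtain l m where "k \<le> l" "l < m" "m \<le> k + 2" "incident j l \<and> incident j m"
  proof (rule tri_two_vertices[OF assms(3,1,2)], goal_cases)
    case (1 l m)
    show ?case by (rule 1(1)[OF 1(2-4) 1(5)[OF assms(5-7)]])
  qed
  then show ?thesis using incident_both[of j l m] assms by auto
qed

lemma bottom_tri:
  assumes "reg p" "f 0 p = 0"
  shows "p \<in> tri 1" "g 0 p = 0" "g 2 p = 0"
proof -
  show g0: "g 0 p = 0" using assms(2) by (simp add: f_def)
  then show g2: "g 2 p = 0" using g_rec[of 0 p] by simp
  have e: "ell 2 > 0" using n_ge_3 by (intro ell_pos) auto
  have "f 2 p \<ge> 0" "f 1 p \<ge> 0" using reg_P[OF assms(1)] n_ge_3 by (auto simp: P_def)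
  then have "g 3 p \<le> 0" using g2 e by (simp add: f_def mult_le_0_iff)
  then show "p \<in> tri 1" using g2 \<open>f 1 p \<ge> 0\<close> by (simp add: tri_def)
qed

lemma apex_tri:
  assumes "reg p" "f (N - 1) p = 0"
  shows "p \<in> tri (N - 2)" "g (N - 2) p = ell (N - 2)"
proof -
  have e: "ell (N - 1) > 0" "ell (N - 2) > 0" using n_ge_3 by (auto intro: ell_pos)
  then have gN: "g N p = 0" using assms(2) by (simp add: f_def)
  then show g: "g (N - 2) p = ell (N - 2)" using g_rec[of "N - 2" p] by simp
  have "f (N - 3) p \<ge> 0" "f (N - 2) p \<ge> 0" using reg_P[OF assms(1)] n_ge_3 by (auto simp: P_def)
  moreover have g3: "g (N - 1) p = g (N - 3) p - ell (N - 3)"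
  proof -
    have "N - 3 + 2 = N - 1" by simp
    then show ?thesis using g_rec[of "N - 3" p] by metis
  qed
  moreover have "f (N - 3) p = ell (N - 2) * g (N - 3) p - ell (N - 3) * g (N - 2) p"
    unfolding f_def by simp
  then have "f (N - 3) p = ell (N - 2) * g (N - 1) p" unfolding g g3 by (simp add: algebra_simps)
  ultimately have "ell (N - 2) * g (N - 1) p \<ge> 0" by simp
  then have "g (N - 1) p \<ge> 0" using e by (simp add: zero_le_mult_iff)
  then show "p \<in> tri (N - 2)" using gN \<open>f (N - 2) p \<ge> 0\<close> by (simp add: tri_def)
qed

subsection \<open>Chords of a polygon\<close>

lemma reg_edge_param:
  assumes "0 \<le> k" "k < N" "reg p" "f k p = 0"
  obtains \<theta> where "0 < \<theta>" "\<theta> < 1" "g k p = \<theta> * ell k" "g (k + 1) p = \<theta> * ell (k + 1)"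
proof -
  obtain u where u: "0 \<le> u" "u \<le> 1" "p = (1 - u) *\<^sub>R zt k + u *\<^sub>R zt (k + 2)"
    using edge_segment[OF assms(1,2)] reg_P[OF assms(3)] assms(4) by (auto simp: closed_segment_def)
  have "u \<noteq> 0" "u \<noteq> 1" using u(3) assms not_reg_zt[of k] not_reg_zt[of "k + 2"] by auto
  then show thesis using that[of u] u by (simp add: g_affine g_zt)
qed

text \<open>This and the next three lemmas express the diagonals of the neighbouring boxes in the
  coordinates of box \<open>k\<close>.\<close>

lemma f_f_up: "f (k + 1) p = ell (k + 2) * g (k + 1) p + ell (k + 1) * (ell k - g k p)"
proof -
  have "k + 1 + 1 = k + 2" by simp
  then have "f (k + 1) p = ell (k + 2) * g (k + 1) p - ell (k + 1) * g (k + 2) p" unfolding f_def by metis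
  then show ?thesis unfolding g_rec by (simp add: algebra_simps)
qed

lemma f_f_down: "f (k - 1) p = ell k * g (k + 1) p + ell (k - 1) * (ell k - g k p)"
proof -
  have "k - 1 + 2 = k + 1" by simp
  then have "g (k + 1) p = g (k - 1) p - ell (k - 1)" using g_rec[of "k - 1" p] by metis
  then have *: "g (k - 1) p = g (k + 1) p + ell (k - 1)" by simp
  show ?thesis unfolding f_def * by (simp add: algebra_simps)
qed

lemma F_up: "F (k + 1) p = ell (k + 2) * (g (k + 1) p - ell (k + 1)) + ell (k + 1) * (g k p - ell k)"
proof -
  have "k + 1 + 1 = k + 2" by simp
  then have "F (k + 1) p = ell (k + 2) * g (k + 1) p + ell (k + 1) * g (k + 2) p - ell (k + 1) * ell (k + 2)"
    unfolding F_def by metis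
  then show ?thesis unfolding g_rec by (simp add: algebra_simps)
qed

lemma F_down: "F (k - 1) p = ell k * g (k + 1) p + ell (k - 1) * g k p"
proof -
  have "k - 1 + 2 = k + 1" by simp
  then have "g (k + 1) p = g (k - 1) p - ell (k - 1)" using g_rec[of "k - 1" p] by metis
  then have *: "g (k - 1) p = g (k + 1) p + ell (k - 1)" by simp
  show ?thesis unfolding F_def * by (simp add: algebra_simps)
qed

lemma tri_up_iff: "p \<in> tri (k + 1) \<longleftrightarrow> g k p \<ge> ell k \<and> g (k + 1) p \<le> ell (k + 1) \<and> f (k + 1) p \<ge> 0"
  using g_rec[of k p] g_rec[of "k + 1" p] by (auto simp: tri_def add.assoc)

lemma tri_down_iff: "p \<in> tri (k - 1) \<longleftrightarrow> g k p \<ge> 0 \<and> g (k + 1) p \<le> 0 \<and> f (k - 1) p \<ge> 0"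
proof -
  have e: "k - 1 + 1 = k" "k - 1 + 2 = k + 1" by simp_all
  show ?thesis unfolding tri_def mem_Collect_eq e by blast
qed

lemma tri_iff: "p \<in> tri k \<longleftrightarrow> g (k + 1) p \<ge> 0 \<and> g k p \<le> ell k \<and> f k p \<ge> 0"
  using g_rec[of k p] by (auto simp: tri_def)

text \<open>A chord of a polygon with direction in the sector leaves the half box of its first edge \<open>k\<close>
  at parameter \<open>m\<close> and enters there the half box of the neighbouring edge \<open>k + 1\<close> or \<open>k - 1\<close>.\<close>

definition chord :: "int \<Rightarrow> int \<Rightarrow> real \<times> real \<Rightarrow> real \<times> real \<Rightarrow> real \<Rightarrow> real \<Rightarrow> bool" where
  "chord k k' p d m T \<longleftrightarrow>
     0 < T \<and> 0 \<le> m \<and> m \<le> T \<and> (k' = k + 1 \<or> k' = k - 1) \<and> 0 \<le> k' \<and> k' < N \<and>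
     p + T *\<^sub>R d \<in> P \<and> f k' (p + T *\<^sub>R d) = 0 \<and> f k (p + T *\<^sub>R d) > 0 \<and>
     (if 1 \<le> k \<and> k \<le> N - 2 then (\<forall>t. 0 \<le> t \<and> t \<le> m \<longrightarrow> p + t *\<^sub>R d \<in> tri k) \<and>
        (if k' = k + 1 then F k (p + m *\<^sub>R d) > 0 else F k (p + m *\<^sub>R d) < 0) else m = 0) \<and>
     (if 1 \<le> k' \<and> k' \<le> N - 2 then (\<forall>t. m \<le> t \<and> t \<le> T \<longrightarrow> p + t *\<^sub>R d \<in> tri k') \<and>
        (if k' = k + 1 then F k' (p + m *\<^sub>R d) < 0 else F k' (p + m *\<^sub>R d) > 0) else m = T)"

text \<open>The path moves towards the sides \<open>g k = ell k\<close> and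
  \<open>g (k + 1) = 0\<close> of the half box, which are shared with the half boxes of
  \<open>k + 1\<close> and \<open>k - 1\<close>. The side reached first decides the neighbour, and a
  tie is the corner \<open>zt (k + 1)\<close>. The last two assumptions keep the path from running
  along a degenerate edge.\<close>

lemma chord_exists:
  assumes k: "0 \<le> k" "k < N" and p: "reg p" "f k p = 0"
    and d: "pr k d \<ge> 0" "pr (k + 1) d \<le> 0" "d \<noteq> 0" "k = 0 \<longrightarrow> pr k d > 0" "k = N - 1 \<longrightarrow> pr (k + 1) d < 0"
  shows "(\<exists>T>0. p + T *\<^sub>R d = zt (k + 1)) \<or> (\<exists>k' m T. chord k k' p d m T)"
proof -
  obtain \<theta> where \<theta>: "0 < \<theta>" "\<theta> < 1" "g k p = \<theta> * ell k" "g (k + 1) p = \<theta> * ell (k + 1)"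
    using reg_edge_param[OF k p] .
  define a b where "a = pr k d" and "b = - pr (k + 1) d"
  define \<alpha> \<gamma> where "\<alpha> = g k p" and "\<gamma> = g (k + 1) p"
  have ab: "a \<ge> 0" "b \<ge> 0" using d by (auto simp: a_def b_def)
  have gt: "g k (p + t *\<^sub>R d) = \<alpha> + t * a" "g (k + 1) (p + t *\<^sub>R d) = \<gamma> - t * b" for t
    by (simp_all add: g_move a_def b_def \<alpha>_def \<gamma>_def)
  have fk: "f k (p + t *\<^sub>R d) = t * (ell (k + 1) * a + ell k * b)" for t
    using p(2) by (simp add: f_move df_def a_def b_def)
  have ell0: "ell k \<ge> 0" "ell (k + 1) \<ge> 0" using k by (auto intro: ell_nonneg)
  have bounds: "0 \<le> \<alpha>" "\<alpha> \<le> ell k" "0 \<le> \<gamma>" "\<gamma> \<le> ell (k + 1)"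
    using \<theta> ell0 by (auto simp: \<alpha>_def \<gamma>_def mult_left_le_one_le)
  have strict: "k \<noteq> 0 \<Longrightarrow> 0 < \<alpha> \<and> \<alpha> < ell k" "k \<noteq> N - 1 \<Longrightarrow> 0 < \<gamma> \<and> \<gamma> < ell (k + 1)"
    using \<theta> ell_pos[of k] ell_pos[of "k + 1"] k by (auto simp: \<alpha>_def \<gamma>_def)
  have a0: "k = 0 \<Longrightarrow> a > 0 \<and> \<alpha> = 0 \<and> ell k = 0" and b0: "k = N - 1 \<Longrightarrow> b > 0 \<and> \<gamma> = 0 \<and> ell (k + 1) = 0"
    using d bounds by (auto simp: a_def b_def)
  have ab0: "\<not> (a = 0 \<and> b = 0)"
  proof
    assume "a = 0 \<and> b = 0"
    then have "d = 0" using pr_eqI[of k d 0] by (simp add: a_def b_def pr_def)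
    then show False using d by simp
  qed
  \<comment> \<open>The times \<open>(ell k - \<alpha>) / a\<close> and \<open>\<gamma> / b\<close>
    at which the two sides are reached are compared after cross-multiplication, since
    \<open>a\<close> or \<open>b\<close> vanishes on the boundary of the sector.\<close>
  consider (corner) "(ell k - \<alpha>) * b = \<gamma> * a" | (up) "(ell k - \<alpha>) * b < \<gamma> * a" | (down) "(ell k - \<alpha>) * b > \<gamma> * a"
    by linarith
  then show ?thesis
  proof cases
    case corner
    have k0: "k \<noteq> 0"
    proof
      assume "k = 0"
      then have "0 < \<gamma> * a" using a0 strict(2) n_ge_3 by simp
      then show False using corner a0[OF \<open>k = 0\<close>] by simp
    qed
    have a: "a > 0"
    proof (rule ccontr)
      assume "\<not> a > 0"
      then have "a = 0" using ab by simp
      then have "b = 0" using corner strict(1)[OF k0] by simp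
      then show False using ab0 \<open>a = 0\<close> by simp
    qed
    define T where "T = (ell k - \<alpha>) / a"
    have T: "T > 0" "T * a = ell k - \<alpha>" using a strict(1)[OF k0] by (auto simp: T_def)
    have "T * b = \<gamma>"
    proof -
      have "T * b * a = (ell k - \<alpha>) * b" using T(2) by (simp add: mult.commute mult.left_commute)
      then have "T * b * a = \<gamma> * a" using corner by simp
      then show ?thesis using a by simp
    qed
    then have "p + T *\<^sub>R d = zt (k + 1)" by (intro g_eqI[of k]) (simp_all add: gt T g_zt)
    then show ?thesis using T by blast
  next
    case up
    have kN: "k \<noteq> N - 1"
    proof
      assume "k = N - 1"
      then have "\<gamma> * a = 0" using b0 by simp
      moreover have "(ell k - \<alpha>) * b \<ge> 0" using bounds ab by simp
      ultimately show False using up by linarith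
    qed
    have a: "a > 0"
    proof (rule ccontr)
      assume "\<not> a > 0"
      then have "\<gamma> * a = 0" using ab by simp
      moreover have "(ell k - \<alpha>) * b \<ge> 0" using bounds ab by simp
      ultimately show False using up by linarith
    qed
    have e1: "ell (k + 1) > 0" and e2: "ell (k + 2) \<ge> 0" using k kN by (auto intro: ell_pos ell_nonneg)
    define m where "m = (ell k - \<alpha>) / a"
    have m: "m \<ge> 0" "m * a = ell k - \<alpha>" using a bounds by (auto simp: m_def)
    define G where "G = \<gamma> - m * b"
    have "m * b * a < \<gamma> * a" using up m(2) by (metis mult.commute mult.left_commute)
    then have G: "G > 0" using a by (simp add: G_def)
    \<comment> \<open>\<open>f (k + 1)\<close> has the value \<open>ell (k + 2) * G\<close> at time
      \<open>m\<close> and decreases at rate \<open>D\<close>, which gives the arrival time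
      \<open>T\<close>. The third case below has the same form with
      \<open>f (k - 1)\<close>.\<close>
    define D where "D = ell (k + 2) * b + ell (k + 1) * a"
    have D: "D > 0" unfolding D_def using e1 e2 a ab by (intro add_nonneg_pos) auto
    define T where "T = m + ell (k + 2) * G / D"
    have TD: "(T - m) * D = ell (k + 2) * G" using D by (simp add: T_def)
    have Tm: "T \<ge> m" using D G e2 by (simp add: T_def)
    have fu: "f (k + 1) (p + t *\<^sub>R d) = (T - t) * D" for t
    proof -
      have "f (k + 1) (p + t *\<^sub>R d) = ell (k + 2) * (\<gamma> - t * b) + ell (k + 1) * (ell k - (\<alpha> + t * a))"
        unfolding f_f_up gt ..
      also have "\<dots> = ell (k + 2) * G + ell (k + 1) * (ell k - \<alpha> - m * a) + (m - t) * D"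
        by (simp add: G_def D_def algebra_simps)
      also have "\<dots> = (T - t) * D" using TD m(2) by (simp add: algebra_simps)
      finally show ?thesis .
    qed
    have T: "T > 0"
    proof (cases "k = 0")
      case True
      then have "ell (k + 2) > 0" using n_ge_3 by (intro ell_pos) auto
      then have "ell (k + 2) * G / D > 0" using G D by simp
      then show ?thesis using m(1) by (simp add: T_def)
    next
      case False
      then have "m > 0" using strict(1) a by (simp add: m_def)
      then show ?thesis using Tm by simp
    qed
    have gt0: "g (k + 1) (p + t *\<^sub>R d) > 0" if "t \<le> m" for t
      using mult_right_mono[OF that ab(2)] G by (simp add: gt G_def)
    have gle: "g k (p + t *\<^sub>R d) \<le> ell k" if "t \<le> m" for t
      using mult_right_mono[OF that ab(1)] m by (simp add: gt)
    have gge: "g k (p + t *\<^sub>R d) \<ge> ell k" if "m \<le> t" for t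
      using mult_right_mono[OF that ab(1)] m by (simp add: gt)
    have fk0: "f k (p + t *\<^sub>R d) \<ge> 0" if "0 \<le> t" for t
      unfolding fk using that ell0 ab by (intro mult_nonneg_nonneg add_nonneg_nonneg) auto
    have fkT: "f k (p + T *\<^sub>R d) > 0"
      unfolding fk using T ell0 e1 a ab by (intro mult_pos_pos add_pos_nonneg) auto
    have tri1: "p + t *\<^sub>R d \<in> tri k" if "0 \<le> t" "t \<le> m" for t
      using gt0[OF that(2)] gle[OF that(2)] fk0[OF that(1)] by (simp add: tri_iff)
    have tri2: "p + t *\<^sub>R d \<in> tri (k + 1)" if "m \<le> t" "t \<le> T" for t
    proof -
      have "0 \<le> t * b" using that m(1) ab by simp
      then have "g (k + 1) (p + t *\<^sub>R d) \<le> ell (k + 1)" using bounds by (simp add: gt)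
      moreover have "f (k + 1) (p + t *\<^sub>R d) \<ge> 0" unfolding fu using that D by simp
      ultimately show ?thesis using gge[OF that(1)] by (simp add: tri_up_iff)
    qed
    have gm: "g k (p + m *\<^sub>R d) = ell k" "g (k + 1) (p + m *\<^sub>R d) = G"
      using m by (simp_all add: gt G_def)
    \<comment> \<open>\<open>F k\<close> is nonnegative on the sides \<open>g k = ell k\<close> and
      \<open>g (k + 1) = ell (k + 1)\<close> and nonpositive on the other two, so its sign at time
      \<open>m\<close> records on which side of the other diagonal the box is left or
      entered.\<close>
    have F1: "F k (p + m *\<^sub>R d) > 0" if "k \<noteq> 0"
    proof -
      have "F k (p + m *\<^sub>R d) = ell k * G" unfolding F_def gm by (simp add: algebra_simps)
      moreover have "ell k > 0" using strict(1)[OF that] by simp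
      ultimately show ?thesis using G by simp
    qed
    have F2: "F (k + 1) (p + m *\<^sub>R d) < 0" if "k + 1 \<le> N - 2"
    proof -
      have "ell (k + 2) > 0" using that k by (intro ell_pos) auto
      moreover have "G < ell (k + 1)" using strict(2)[OF kN] m(1) ab by (simp add: G_def add_strict_increasing2 mult_nonneg_nonneg algebra_simps)
      ultimately show ?thesis unfolding F_up gm by (simp add: mult_pos_neg)
    qed
    have mT: "m = T" if "k + 1 > N - 2"
    proof -
      have "k + 2 = N" using that k kN by simp
      then have "ell (k + 2) = 0" by simp
      then show ?thesis by (simp add: T_def)
    qed
    have "p + T *\<^sub>R d \<in> P"
    proof (cases "k + 1 \<le> N - 2")
      case True
      then show ?thesis using tri2[OF Tm order.refl] tri_subset_P[of "k + 1"] k by auto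
    next
      case False
      then have "1 \<le> k" "k \<le> N - 2" using k kN n_ge_3 by auto
      then show ?thesis using tri1[of T] mT False T tri_subset_P[of k] by auto
    qed
    moreover have "f (k + 1) (p + T *\<^sub>R d) = 0" by (simp add: fu)
    moreover have "m = 0" if "\<not> (1 \<le> k \<and> k \<le> N - 2)"
    proof -
      have "k = 0" using that k kN by linarith
      then show ?thesis using a0 by (simp add: m_def)
    qed
    ultimately have "chord k (k + 1) p d m T"
      unfolding chord_def using T m(1) Tm fkT tri1 tri2 F1 F2 mT k kN by auto
    then show ?thesis by blast
  next
    case down
    have k0: "k \<noteq> 0"
    proof
      assume "k = 0"
      then have "(ell k - \<alpha>) * b = 0" using a0 by simp
      moreover have "\<gamma> * a \<ge> 0" using bounds ab by simp
      ultimately show False using down by linarith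
    qed
    have b: "b > 0"
    proof (rule ccontr)
      assume "\<not> b > 0"
      then have "(ell k - \<alpha>) * b = 0" using ab by simp
      moreover have "\<gamma> * a \<ge> 0" using bounds ab by simp
      ultimately show False using down by linarith
    qed
    have e1: "ell k > 0" and e2: "ell (k - 1) \<ge> 0" using k k0 by (auto intro: ell_pos ell_nonneg)
    define m where "m = \<gamma> / b"
    have m: "m \<ge> 0" "m * b = \<gamma>" using b bounds by (auto simp: m_def)
    define H where "H = \<alpha> + m * a"
    have "m * a * b < (ell k - \<alpha>) * b" using down m(2) by (metis mult.commute mult.left_commute)
    then have H: "H < ell k" using b by (simp add: H_def)
    define D where "D = ell k * b + ell (k - 1) * a"
    have D: "D > 0" unfolding D_def using e1 e2 b ab by (intro add_pos_nonneg) auto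
    define T where "T = m + ell (k - 1) * (ell k - H) / D"
    have TD: "(T - m) * D = ell (k - 1) * (ell k - H)" using D by (simp add: T_def)
    have Tm: "T \<ge> m" using D H e2 by (simp add: T_def)
    have fu: "f (k - 1) (p + t *\<^sub>R d) = (T - t) * D" for t
    proof -
      have "f (k - 1) (p + t *\<^sub>R d) = ell k * (\<gamma> - t * b) + ell (k - 1) * (ell k - (\<alpha> + t * a))"
        unfolding f_f_down gt ..
      also have "\<dots> = ell (k - 1) * (ell k - H) + ell k * (\<gamma> - m * b) + (m - t) * D"
        by (simp add: H_def D_def algebra_simps)
      also have "\<dots> = (T - t) * D" using TD m(2) by (simp add: algebra_simps)
      finally show ?thesis .
    qed
    have T: "T > 0"
    proof (cases "k = N - 1")
      case True
      then have "ell (k - 1) > 0" using n_ge_3 by (intro ell_pos) auto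
      then have "ell (k - 1) * (ell k - H) / D > 0" using H D by simp
      then show ?thesis using m(1) by (simp add: T_def)
    next
      case False
      then have "m > 0" using strict(2) b by (simp add: m_def)
      then show ?thesis using Tm by simp
    qed
    have gge: "g (k + 1) (p + t *\<^sub>R d) \<ge> 0" if "t \<le> m" for t
      using mult_right_mono[OF that ab(2)] m by (simp add: gt)
    have gle: "g (k + 1) (p + t *\<^sub>R d) \<le> 0" if "m \<le> t" for t
      using mult_right_mono[OF that ab(2)] m by (simp add: gt)
    have glt: "g k (p + t *\<^sub>R d) \<le> ell k" if "t \<le> m" for t
      using mult_right_mono[OF that ab(1)] H by (simp add: gt H_def)
    have fk0: "f k (p + t *\<^sub>R d) \<ge> 0" if "0 \<le> t" for t
      unfolding fk using that ell0 ab by (intro mult_nonneg_nonneg add_nonneg_nonneg) auto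
    have fkT: "f k (p + T *\<^sub>R d) > 0"
      unfolding fk using T ell0 e1 b ab by (intro mult_pos_pos add_nonneg_pos) auto
    have tri1: "p + t *\<^sub>R d \<in> tri k" if "0 \<le> t" "t \<le> m" for t
      using gge[OF that(2)] glt[OF that(2)] fk0[OF that(1)] by (simp add: tri_iff)
    have tri2: "p + t *\<^sub>R d \<in> tri (k - 1)" if "m \<le> t" "t \<le> T" for t
    proof -
      have "0 \<le> t * a" using that m(1) ab by simp
      then have "g k (p + t *\<^sub>R d) \<ge> 0" using bounds by (simp add: gt)
      moreover have "f (k - 1) (p + t *\<^sub>R d) \<ge> 0" unfolding fu using that D by simp
      ultimately show ?thesis using gle[OF that(1)] by (simp add: tri_down_iff)
    qed
    have gm: "g k (p + m *\<^sub>R d) = H" "g (k + 1) (p + m *\<^sub>R d) = 0"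
      using m by (simp_all add: gt H_def)
    have F1: "F k (p + m *\<^sub>R d) < 0" if "k \<noteq> N - 1"
    proof -
      have "F k (p + m *\<^sub>R d) = - (ell (k + 1) * (ell k - H))" unfolding F_def gm by (simp add: algebra_simps)
      moreover have "ell (k + 1) > 0" using strict(2)[OF that] by simp
      ultimately show ?thesis using H by simp
    qed
    have F2: "F (k - 1) (p + m *\<^sub>R d) > 0" if "1 \<le> k - 1"
    proof -
      have "ell (k - 1) > 0" using that k by (intro ell_pos) auto
      moreover have "H > 0" using strict(1)[OF k0] m(1) ab by (simp add: H_def add_pos_nonneg)
      ultimately show ?thesis unfolding F_down gm by simp
    qed
    have mT: "m = T" if "k - 1 < 1"
    proof -
      have "k - 1 = 0" using that k k0 by simp
      then show ?thesis by (simp add: T_def)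
    qed
    have "p + T *\<^sub>R d \<in> P"
    proof (cases "1 \<le> k - 1")
      case True
      then show ?thesis using tri2[OF Tm order.refl] tri_subset_P[of "k - 1"] k by auto
    next
      case False
      then have "1 \<le> k" "k \<le> N - 2" using k k0 n_ge_3 by auto
      then show ?thesis using tri1[of T] mT False T tri_subset_P[of k] by auto
    qed
    moreover have "f (k - 1) (p + T *\<^sub>R d) = 0" by (simp add: fu)
    moreover have "m = 0" if "\<not> (1 \<le> k \<and> k \<le> N - 2)"
    proof -
      have "k = N - 1" using that k k0 by linarith
      then show ?thesis using b0 by (simp add: m_def)
    qed
    ultimately have "chord k (k - 1) p d m T"
      unfolding chord_def using T m(1) Tm fkT tri1 tri2 F1 F2 mT k k0 by auto
    then show ?thesis by blast
  qed
qed

end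

locale veech_automorphism = double_polygon +
  fixes \<phi> :: "point \<Rightarrow> point"
  assumes phi: "affine_automorphism n (flip ** M n) \<phi>"
begin

subsection \<open>The affine automorphism\<close>

lemma phi_bij: "bij_betw \<phi> (surface n) (surface n)"
  and phi_cone: "\<phi> ` cone_points n = cone_points n"
  and phi_chart: "\<forall>p \<in> surface n - cone_points n. \<exists>\<epsilon>>0. \<forall>h. \<forall>q \<in> surface n.
        norm h < \<epsilon> \<and> displaced p h q \<longrightarrow> displaced (\<phi> p) ((flip ** M n) *v h) (\<phi> q)"
  using phi unfolding affine_automorphism_def by simp_all

lemma phi_inj: "q \<in> surface n \<Longrightarrow> q' \<in> surface n \<Longrightarrow> \<phi> q = \<phi> q' \<Longrightarrow> q = q'"
  using phi_bij unfolding bij_betw_def inj_on_def by blast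

lemma phi_regp: assumes "regp q" shows "regp (\<phi> q)"
proof -
  have c: "cone_points n \<subseteq> surface n" by (auto simp: cone_points_def)
  have "\<phi> q \<in> surface n" using regp_surface[OF assms] bij_betwE[OF phi_bij] by blast
  moreover have "\<phi> q \<notin> cone_points n"
  proof
    assume "\<phi> q \<in> cone_points n"
    then obtain q' where q': "q' \<in> cone_points n" "\<phi> q = \<phi> q'"
      using phi_cone by (metis imageE)
    then have "q = q'" using phi_inj c assms unfolding regp_def by blast
    then show False using q' assms by (simp add: regp_def)
  qed
  ultimately show ?thesis by (simp add: regp_def)
qed

lemma phi_regp_surj: assumes "regp q" obtains q0 where "regp q0" "\<phi> q0 = q"
proof -
  have "q \<in> \<phi> ` surface n" using regp_surface[OF assms] bij_betw_imp_surj_on[OF phi_bij] by simp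
  then obtain q0 where q0: "q0 \<in> surface n" "\<phi> q0 = q" by auto
  have "q0 \<notin> cone_points n"
  proof
    assume "q0 \<in> cone_points n"
    then have "q \<in> cone_points n" using imageI[of q0 "cone_points n" \<phi>] phi_cone q0(2) by simp
    then show False using assms by (simp add: regp_def)
  qed
  then show ?thesis using that q0 by (simp add: regp_def)
qed

lemma phi_displaced:
  assumes "regp q"
  shows "\<forall>\<^sub>F u in nhds 0. \<forall>r. r \<in> surface n \<longrightarrow> displaced q (Lam (u *\<^sub>R w)) r \<longrightarrow> displaced (\<phi> q) (Lam (u *\<^sub>R mir w)) (\<phi> r)"
proof -
  obtain e where e: "e > 0" "\<And>h r. r \<in> surface n \<Longrightarrow> norm h < e \<Longrightarrow> displaced q h r \<Longrightarrow>
     displaced (\<phi> q) ((flip ** M n) *v h) (\<phi> r)"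
    using bspec[OF phi_chart, of q] assms unfolding regp_def by metis
  have "((\<lambda>u. norm (u *\<^sub>R Lam w)) \<longlongrightarrow> norm (0 *\<^sub>R Lam w)) (nhds 0)" by (intro tendsto_intros tendsto_id_nhds)
  then have "\<forall>\<^sub>F u in nhds 0. norm (u *\<^sub>R Lam w) < e" using e(1) by (intro order_tendstoD) auto
  then show ?thesis
  proof eventually_elim
    case (elim u)
    then have "norm (Lam (u *\<^sub>R w)) < e" by (simp only: Lam_scale)
    then show ?case using e(2)[of _ "Lam (u *\<^sub>R w)"] unfolding veech_Lam_mir mir_scale by blast
  qed
qed

lemma phi_straight:
  assumes "straight I w \<gamma>" "\<And>t. t \<in> I \<Longrightarrow> regp (\<gamma> t)"
  shows "straight I (mir w) (\<lambda>t. \<phi> (\<gamma> t))"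
  unfolding straight_def
proof (intro ballI conjI)
  fix t assume t: "t \<in> I"
  show "\<phi> (\<gamma> t) \<in> surface n" using assms(2)[OF t] phi_regp regp_surface by blast
  show "\<forall>\<^sub>F u in nhds 0. t + u \<in> I \<longrightarrow> displaced (\<phi> (\<gamma> t)) (Lam (u *\<^sub>R mir w)) (\<phi> (\<gamma> (t + u)))"
    using straightD[OF assms(1) t] phi_displaced[OF assms(2)[OF t], of w]
    by eventually_elim (use straight_surface[OF assms(1)] in blast)
qed

section \<open>The image of the bottom edge\<close>

lemma bottom_point: "0 < x \<Longrightarrow> x < 1 \<Longrightarrow> reg (x, 0)"
proof -
  assume x: "0 < x" "x < 1"
  have "ell 2 > 0" using n_ge_3 by (intro ell_pos) auto
  then have "(x, 0) \<in> tri 1" using x zt_0_1 by (simp add: tri_def f_def g_def pr_def)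
  then show ?thesis using x zt_0_1 n_ge_3 by (intro reg_tri[of _ 1]) auto
qed

text \<open>The image of the open bottom edge cannot be prolonged through its ends: those would have to be
  images of the corners.\<close>

lemma bottom_image_dead_end:
  assumes "e = 0 \<or> e = 1" "\<epsilon> > 0" "straight {e - \<epsilon><..<e + \<epsilon>} (- 1, 0) \<eta>"
    "\<And>t. t \<in> {e - \<epsilon><..<e + \<epsilon>} \<Longrightarrow> regp (\<eta> t)"
    "\<And>t. t \<in> {e - \<epsilon><..<e + \<epsilon>} \<Longrightarrow> 0 < t \<Longrightarrow> t < 1 \<Longrightarrow> \<eta> t = \<phi> (C Upper (t, 0))"
  shows False
proof -
  have e: "e \<in> {e - \<epsilon><..<e + \<epsilon>}" using assms(2) by simp
  obtain q0 where q0: "regp q0" "\<phi> q0 = \<eta> e" using assms(4)[OF e] by (rule phi_regp_surj)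
  have corner: "(e, 0) \<in> P" "\<not> reg (e, 0)"
    using assms(1) zt_P[of 1] zt_P[of 2] not_reg_zt[of 1] not_reg_zt[of 2] zt_0_1 n_ge_3 by auto
  have "q0 \<noteq> C Upper (e, 0)" using q0(1) corner regp_C by blast
  \<comment> \<open>The regular preimage \<open>q0\<close> of the supposed end point differs from
    the corner. Injectivity of \<open>\<phi>\<close> would make equal displacements of both meet on
    the bottom edge, which separation forbids.\<close>
  note sep = separate[OF q0(1) C_surface[OF corner(1)] this, of "(1, 0)"]
  have lim: "((\<lambda>u. e + u) \<longlongrightarrow> e + 0) (nhds 0)" by (intro tendsto_intros tendsto_id_nhds)
  have near: "\<forall>\<^sub>F u in nhds 0. e + u \<in> {e - \<epsilon><..<e + \<epsilon>}"
    using order_tendstoD(1)[OF lim, of "e - \<epsilon>"] order_tendstoD(2)[OF lim, of "e + \<epsilon>"] assms(2)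
    by (simp add: eventually_conj_iff)
  have mir1: "mir (1, 0) = (- 1, 0)" by (simp add: mir_def)
  have "\<forall>\<^sub>F u in nhds 0. \<not> (0 < e + u \<and> e + u < 1)"
    using sep near displaced_ex[OF q0(1), of "(1, 0)"] phi_displaced[OF q0(1), of "(1, 0)", unfolded mir1]
      straightD[OF assms(3) e]
  proof eventually_elim
    case (elim u)
    show ?case
    proof
      assume u: "0 < e + u \<and> e + u < 1"
      obtain r where r: "regp r" "displaced q0 (Lam (u *\<^sub>R (1, 0))) r" using elim(3) by blast
      have "displaced (\<eta> e) (Lam (u *\<^sub>R (- 1, 0))) (\<phi> r)" using elim(4) r regp_surface q0(2) by metis
      moreover have "displaced (\<eta> e) (Lam (u *\<^sub>R (- 1, 0))) (\<eta> (e + u))" using elim(2,5) by blast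
      ultimately have "\<phi> r = \<eta> (e + u)"
        using displaced_unique[OF assms(4)[OF e] regp_surface[OF phi_regp[OF r(1)]]
            straight_surface[OF assms(3) elim(2)]] by blast
      also have "\<dots> = \<phi> (C Upper (e + u, 0))" using assms(5)[OF elim(2)] u by blast
      finally have "r = C Upper (e + u, 0)"
        using r(1) bottom_point u phi_inj regp_surface C_surface reg_P by blast
      moreover have "displaced (C Upper (e, 0)) (Lam (u *\<^sub>R (1, 0))) (C Upper (e + u, 0))"
        using displaced_C[of "(e, 0)" Upper "u *\<^sub>R (1, 0)"]
          corner(1) reg_P[OF bottom_point[of "e + u"]] u by (simp add: sg_def)
      ultimately show False using elim(1) r by blast
    qed
  qed
  then obtain d where d: "d > 0" "\<And>u. dist u 0 < d \<Longrightarrow> \<not> (0 < e + u \<and> e + u < 1)"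
    unfolding eventually_nhds_metric by blast
  define x where "x = min (d / 2) (1 / 2)"
  have x: "0 < x" "x < d" "x < 1" using d(1) by (auto simp: x_def)
  show False using assms(1)
  proof
    assume "e = 0"
    then show False using d(2)[of x] x by simp
  next
    assume "e = 1"
    then show False using d(2)[of "- x"] x by simp
  qed
qed

text \<open>A leaf in an open cylinder could be prolonged past the dead end at time 0. On a chord of
  length \<open>ell k\<close> the available times form an open interval around \<open>1 / 2\<close>
  that contains neither 0 nor 1. Hence \<open>ell k \<le> 1\<close>, which forces
  \<open>k = 1\<close> and places the image in the middle.\<close>

lemma phi_bottom_midpoint: "\<phi> (C Upper (1 / 2, 0)) = C Upper (1 / 2, 0)"
proof (rule ccontr)
  assume neq: "\<phi> (C Upper (1 / 2, 0)) \<noteq> C Upper (1 / 2, 0)"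
  define \<gamma> where "\<gamma> t = C Upper (t, 0)" for t :: real
  define \<delta> where "\<delta> t = \<phi> (\<gamma> t)" for t
  have reg\<gamma>: "regp (\<gamma> t)" if "t \<in> {0<..<1}" for t
    using that bottom_point regp_C reg_P by (auto simp: \<gamma>_def)
  have "straight {0<..<1} (1, 0) (\<lambda>t. C Upper (0 + (t - 0) *\<^sub>R sg Upper *\<^sub>R (1, 0)))"
    by (rule straight_sheet) (use bottom_point reg_P in \<open>auto simp: sg_def zero_prod_def\<close>)
  then have "straight {0<..<1} (1, 0) \<gamma>"
    by (rule straight_cong) (auto simp: sg_def zero_prod_def \<gamma>_def)
  from phi_straight[OF this reg\<gamma>] have st: "straight {0<..<1} (- 1, 0) \<delta>" by (simp add: mir_def \<delta>_def[abs_def])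
  have reg\<delta>: "regp (\<delta> t)" if "t \<in> {0<..<1}" for t using reg\<gamma>[OF that] phi_regp by (simp add: \<delta>_def)
  \<comment> \<open>By unique continuation, a regular path through \<open>\<delta> (1 / 2)\<close>
    with the same velocity agrees with \<open>\<delta>\<close> at common times, so its domain cannot
    contain a dead end.\<close>
  have dead: False if d1: "e = 0 \<or> e = 1" and d2: "open I" and d3: "connected I" and d4: "e \<in> I"
      and d5: "1 / 2 \<in> I" and d6: "straight I (- 1, 0) \<eta>" and d7: "\<And>t. t \<in> I \<Longrightarrow> regp (\<eta> t)"
      and d8: "\<eta> (1 / 2) = \<delta> (1 / 2)" for e I \<eta>
  proof -
    obtain \<epsilon> where \<epsilon>: "\<epsilon> > 0" "ball e \<epsilon> \<subseteq> I" using d2 d4 openE by blast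
    have sub: "{e - \<epsilon><..<e + \<epsilon>} \<subseteq> I" using \<epsilon>(2) by (simp add: ball_eq_greaterThanLessThan)
    show False
    proof (rule bottom_image_dead_end[OF d1 \<epsilon>(1) straight_subset[OF d6 sub]])
      show "regp (\<eta> t)" if "t \<in> {e - \<epsilon><..<e + \<epsilon>}" for t using that sub d7 by blast
      show "\<eta> t = \<phi> (C Upper (t, 0))" if t: "t \<in> {e - \<epsilon><..<e + \<epsilon>}" "0 < t" "t < 1" for t
      proof -
        have "is_interval (I \<inter> {0<..<1})"
          using d3 by (intro is_interval_Int) (auto simp: is_interval_connected_1)
        then have c: "connected (I \<inter> {0<..<1})" by (simp add: is_interval_connected_1)
        have "\<eta> t = \<delta> t"
          by (rule straight_unique[OF c straight_subset[OF d6] _ straight_subset[OF st], of "1 / 2" t])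
             (use sub t d5 d7 d8 in auto)
        then show ?thesis by (simp add: \<delta>_def \<gamma>_def)
      qed
    qed
  qed
  obtain s p where p: "reg p" "\<delta> (1 / 2) = C s p" using reg\<delta>[of "1/2"] by (auto elim: regpE)
  from p(1) show False
  proof (cases rule: P_horizontal_cases)
    case (chord k)
    define I where "I = {t. 0 < g k p - (t - 1 / 2) * sg s \<and> g k p - (t - 1 / 2) * sg s < ell k}"
    define \<eta> where "\<eta> t = C s (p + (t - 1 / 2) *\<^sub>R sg s *\<^sub>R (- 1, 0))" for t
    have prk: "pr k (-1, 0) = -1" "pr (k + 1) (-1, 0) = 0" using chord(1) by (auto simp: pr_def)
    have r: "reg (p + (t - 1 / 2) *\<^sub>R sg s *\<^sub>R (- 1, 0))" if "t \<in> I" for t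
      by (rule reg_chord[OF chord(2,3)]) (use that chord prk in \<open>simp_all only: g_move pr_scale I_def mem_Collect_eq, auto\<close>)
    have "straight I (- 1, 0) \<eta>" unfolding \<eta>_def by (rule straight_sheet) (use r reg_P in auto)
    moreover have "regp (\<eta> t)" if "t \<in> I" for t using r[OF that] regp_C reg_P by (simp add: \<eta>_def)
    moreover have I: "I = (if s = Upper then {g k p + 1/2 - ell k<..<g k p + 1/2} else {1/2 - g k p<..<ell k - g k p + 1/2})"
      by (auto simp: I_def sg_def)
    moreover have "open I" "connected I" unfolding I by auto
    moreover have "1 / 2 \<in> I" using chord by (simp add: I_def)
    moreover have "\<eta> (1 / 2) = \<delta> (1 / 2)" using p by (simp add: \<eta>_def flip: zero_prod_def)
    ultimately have "0 \<notin> I" "1 \<notin> I" using dead[of 0 I \<eta>] dead[of 1 I \<eta>] by auto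
    then have *: "ell k \<le> g k p + 1 / 2" "g k p - 1 / 2 \<le> 0"
      using chord unfolding I by (auto split: if_splits)
    then have "k = 1" using ell_gt_1[of k] chord by force
    then have "fst p = 1 / 2" "snd p = 0" using * chord zt_0_1 by (auto simp: g_def pr_def)
    then have pe: "p = (1 / 2, 0)" by (simp add: prod_eq_iff)
    have "C s p = C Upper (1 / 2, 0)"
    proof (cases s)
      case Lower
      have "f 0 (1 / 2, 0) = 0" "sig 0 (1 / 2, 0) = (1 / 2, 0)" using zt_0_1 by (auto simp: f_def g_def pr_def sig_def)
      then show ?thesis using C_glue[of 0 "(1 / 2, 0)" Upper] bottom_point[of "1/2"] reg_P n_ge_3 Lower pe by (simp add: opp_def)
    qed (simp add: pe)
    then show False using neq p(2) by (simp add: \<delta>_def \<gamma>_def)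
  next
    case (cylinder j)
    obtain D where D: "D > 0" "\<And>m s q. reg q \<Longrightarrow> g j q \<in> {g j p, ell j - g j p} \<Longrightarrow>
      \<exists>\<eta>. straight {0..real m * D} (1, 0) \<eta> \<and> \<eta> 0 = C s q \<and> (\<forall>t\<in>{0..real m * D}. regp (\<eta> t))"
    proof (rule cylinder_leaf[OF cylinder], goal_cases)
      case (1 D)
      show ?case by (rule 1(1)[OF 1(2,3)])
    qed
    obtain m :: nat where m: "1 / 2 < real m * D" using reals_Archimedean3[OF D(1)] by blast
    from D(2)[OF p(1), of m s] obtain \<eta> where \<eta>: "straight {0..real m * D} (1, 0) \<eta>" "\<eta> 0 = \<delta> (1 / 2)"
      "\<And>t. t \<in> {0..real m * D} \<Longrightarrow> regp (\<eta> t)" using p(2) by auto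
    \<comment> \<open>The leaf is traversed backwards from time \<open>1 / 2\<close> until before
      time 0. Appending a piece of \<open>\<delta>\<close>, up to any time below 1, makes
      \<open>1 / 2\<close> an interior time.\<close>
    define \<theta> where "\<theta> t = (if t \<le> 1 / 2 then \<eta> (1 / 2 + (- 1) * t) else \<delta> t)" for t
    define a where "a = 1 / 2 - real m * D"
    have "straight {t. 1 / 2 + (- 1) * t \<in> {0..real m * D}} ((- 1) *\<^sub>R (1, 0)) (\<lambda>t. \<eta> (1 / 2 + (- 1) * t))"
      by (rule straight_affine[OF \<eta>(1)])
    then have "straight {t. 1 / 2 + (- 1) * t \<in> {0..real m * D}} (- 1, 0) (\<lambda>t. \<eta> (1 / 2 + (- 1) * t))" by simp
    then have "straight {a..1/2} (- 1, 0) (\<lambda>t. \<eta> (1 / 2 + (- 1) * t))"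
      by (rule straight_subset) (auto simp: a_def)
    then have 1: "straight {a..1/2} (- 1, 0) \<theta>" by (rule straight_cong) (simp add: \<theta>_def)
    have "straight {1/2..3/4} (- 1, 0) \<delta>" using st by (rule straight_subset) auto
    then have 2: "straight {1/2..3/4} (- 1, 0) \<theta>"
    proof (rule straight_cong)
      show "\<theta> t = \<delta> t" if "t \<in> {1/2..3/4}" for t
      proof (cases "t = 1 / 2")
        case True
        show ?thesis unfolding True \<theta>_def using \<eta>(2) by simp
      qed (use that in \<open>simp add: \<theta>_def\<close>)
    qed
    have "straight {a..3/4} (- 1, 0) \<theta>" by (rule straight_join[OF 1 2]) (use m in \<open>auto simp: a_def\<close>)
    then have 3: "straight {a<..<3/4} (- 1, 0) \<theta>" by (rule straight_subset) auto
    show False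
    proof (rule dead[of 0 "{a<..<3/4}" \<theta>])
      show "regp (\<theta> t)" if "t \<in> {a<..<3/4}" for t
        using that \<eta>(3)[of "1 / 2 + (- 1) * t"] reg\<delta>[of t] by (auto simp: \<theta>_def a_def)
    qed (use 3 m \<eta>(2) in \<open>auto simp: a_def \<theta>_def\<close>)
  qed
qed

section \<open>The automorphism on the boxes\<close>

text \<open>The segment from \<open>a\<close> to \<open>b\<close> stays in the box. Its image and
  its reflection are straight paths of the same velocity with the same start, so they
  coincide.\<close>

lemma phi_Bx_transfer:
  assumes k: "1 \<le> k" "k \<le> N - 2" and a: "inb k a" and b: "inb k b" and eq: "\<phi> (Bx k a) = Bx k (rho k a)"
  shows "\<phi> (Bx k b) = Bx k (rho k b)"
proof -
  have i1: "inb k (a + t *\<^sub>R (b - a))" if "t \<in> {0..1}" for t using inb_convex[OF a b] that by simp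
  have i2: "inb k (rho k a + t *\<^sub>R mir (b - a))" if "t \<in> {0..1}" for t
    using inb_rho[OF i1[OF that]] by (simp add: rho_move)
  have "straight {0..1} (b - a) (\<lambda>t. Bx k (a + t *\<^sub>R (b - a)))" by (rule straight_Bx[OF k i1])
  then have s: "straight {0..1} (mir (b - a)) (\<lambda>t. \<phi> (Bx k (a + t *\<^sub>R (b - a))))"
    by (rule phi_straight) (use regp_Bx[OF k i1] in auto)
  have "(\<lambda>t. \<phi> (Bx k (a + t *\<^sub>R (b - a)))) 1 = (\<lambda>t. Bx k (rho k a + t *\<^sub>R mir (b - a))) 1"
  proof (rule straight_unique[OF _ s _ straight_Bx[OF k i2]])
    show "\<phi> (Bx k (a + 0 *\<^sub>R (b - a))) = Bx k (rho k a + 0 *\<^sub>R mir (b - a))" using eq by simp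
    show "regp (\<phi> (Bx k (a + t *\<^sub>R (b - a))))" if "t \<in> {0..1}" for t
      using regp_Bx[OF k i1[OF that]] phi_regp by blast
  qed auto
  then show ?thesis using rho_move[of k a 1 "b - a"] by simp
qed

lemma phi_Bx:
  assumes "1 \<le> k" "k \<le> N - 2" "inb k p"
  shows "\<phi> (Bx k p) = Bx k (rho k p)"
proof -
  have "k \<le> N - 2 \<longrightarrow> (\<forall>p. inb k p \<longrightarrow> \<phi> (Bx k p) = Bx k (rho k p))"
    using assms(1)
  proof (induction k rule: int_ge_induct)
    case base
    show ?case
    proof (intro impI allI)
      fix p assume k: "1 \<le> N - 2" and p: "inb 1 p"
      have e: "ell 2 > 0" using n_ge_3 by (intro ell_pos) auto
      have g: "g 1 (1 / 2, 0) = 1 / 2" "g 2 (1 / 2, 0) = 0" by (simp_all add: g_def pr_def zt_0_1)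
      have i: "inb 1 (1 / 2, 0)" using e g by (simp add: inb_def)
      have "f 1 (1 / 2, 0) \<ge> 0" using e g by (simp add: f_def)
      then have b: "Bx 1 (1 / 2, 0) = C Upper (1 / 2, 0)" by (simp add: Bx_def)
      have r: "rho 1 (1 / 2, 0) = (1 / 2, 0)" using zt_0_1 by (simp add: rho_def)
      have "\<phi> (Bx 1 (1 / 2, 0)) = Bx 1 (rho 1 (1 / 2, 0))"
        using phi_bottom_midpoint by (simp add: b r)
      then show "\<phi> (Bx 1 p) = Bx 1 (rho 1 p)"
        using phi_Bx_transfer[OF _ k i p] by simp
    qed
  next
    case (step k)
    show ?case
    proof (intro impI allI)
      fix p assume k1: "k + 1 \<le> N - 2" and p: "inb (k + 1) p"
      \<comment> \<open>The midpoint of the zigzag step shared by the boxes of \<open>k\<close> and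
        \<open>k + 1\<close> carries the formula from one to the other.\<close>
      define \<mu> where "\<mu> = (1 / 2) *\<^sub>R zt (k + 1) + (1 / 2) *\<^sub>R zt (k + 2)"
      have e: "ell k > 0" "ell (k + 1) > 0" "ell (k + 2) > 0" using step(1) k1 by (auto intro: ell_pos)
      have g: "g k \<mu> = ell k" "g (k + 1) \<mu> = ell (k + 1) / 2"
        unfolding \<mu>_def by (simp_all add: g_affine g_zt)
      have g2: "g (k + 2) \<mu> = 0" using g_rec[of k \<mu>] g by simp
      have kk: "1 \<le> k" "k \<le> N - 2" "1 \<le> k + 1" using step(1) k1 by auto
      have e12: "k + 1 + 1 = k + 2" by simp
      have i: "inb k \<mu>" "inb (k + 1) \<mu>" using e g g2 by (auto simp: inb_def e12)
      have f: "f k \<mu> \<ge> 0" "f (k + 1) \<mu> \<ge> 0" using e g g2 by (auto simp: f_def e12)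
      \<comment> \<open>For odd \<open>k\<close> the common side is slanted: both reflections move
        \<open>\<mu>\<close> to the opposite side of the respective box, and both results are the
        point \<open>\<mu>\<close> of the lower polygon. For even \<open>k\<close> the side is
        horizontal and both fix its midpoint.\<close>
      have "Bx (k + 1) (rho (k + 1) \<mu>) = Bx k (rho k \<mu>)"
      proof (cases "odd k")
        case True
        have gr: "g k (rho k \<mu>) = 0" "g (k + 1) (rho k \<mu>) = ell (k + 1) / 2" using True g g_rho_odd by auto
        have gr': "g (k + 1) (rho (k + 1) \<mu>) = ell (k + 1) / 2" "g (k + 2) (rho (k + 1) \<mu>) = ell (k + 2)"
          using True g g2 g_rho_even[of "k + 1" \<mu>] by (auto simp: e12)
        have "sig k (rho k \<mu>) = \<mu>" by (rule g_eqI[of k]) (use g gr g_sig[of k] in auto)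
        moreover have "f k (rho k \<mu>) < 0" using gr e by (simp add: f_def)
        moreover have "sig (k + 1) (rho (k + 1) \<mu>) = \<mu>"
          by (rule g_eqI[of "k + 1"]) (use g g2 gr' g_sig[of "k + 1"] in \<open>auto simp: e12\<close>)
        moreover have "f (k + 1) (rho (k + 1) \<mu>) < 0" using gr' e by (simp add: f_def e12)
        ultimately show ?thesis by (simp add: Bx_def)
      next
        case False
        have "rho k \<mu> = \<mu>" by (rule g_eqI[of k]) (use False g g_rho_even[of k \<mu>] in auto)
        moreover have "rho (k + 1) \<mu> = \<mu>"
          by (rule g_eqI[of "k + 1"]) (use False g g_rho_odd[of "k + 1" \<mu>] in auto)
        ultimately show ?thesis using f by (simp add: Bx_def)
      qed
      moreover have "Bx (k + 1) \<mu> = Bx k \<mu>" using f by (simp add: Bx_def)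
      moreover have "\<phi> (Bx k \<mu>) = Bx k (rho k \<mu>)" using step.IH kk i by blast
      ultimately have "\<phi> (Bx (k + 1) \<mu>) = Bx (k + 1) (rho (k + 1) \<mu>)" by simp
      then show "\<phi> (Bx (k + 1) p) = Bx (k + 1) (rho (k + 1) p)"
        using phi_Bx_transfer[OF kk(3) k1 i(2) p] by simp
    qed
  qed
  then show ?thesis using assms by blast
qed

text \<open>On a box \<open>\<phi>\<close> is an involution, since the reflection is. The last
  conclusion locates the image by the reflected point, up to the half-turn that changes the
  sheet.\<close>

lemma phi_tri:
  assumes "1 \<le> k" "k \<le> N - 2" "p \<in> tri k" "reg p"
  obtains s' p' where "\<phi> (C s p) = C s' p'" "p' \<in> tri k" "reg p'" "\<phi> (C s' p') = C s p"
    "p' = rho k (if s = Upper then p else sig k p) \<and> f k p' \<ge> 0 \<or>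
     sig k p' = rho k (if s = Upper then p else sig k p) \<and> f k (sig k p') < 0"
proof -
  define z where "z = (if s = Upper then p else sig k p)"
  have iz: "inb k z" using tri_inb[OF assms] inb_sig by (simp add: z_def)
  have Cz: "C s p = Bx k z" unfolding z_def by (rule C_Bx[OF assms])
  have 1: "\<phi> (C s p) = Bx k (rho k z)" unfolding Cz by (rule phi_Bx[OF assms(1,2) iz])
  have 2: "\<phi> (Bx k (rho k z)) = C s p" using phi_Bx[OF assms(1,2) inb_rho[OF iz]] Cz by simp
  show thesis
  proof (cases "f k (rho k z) \<ge> 0")
    case True
    then show thesis using that[of Upper "rho k z"] 1 2 inb_tri[OF assms(1,2) inb_rho[OF iz] True]
      by (simp add: Bx_def z_def)
  next
    case False
    then have "f k (sig k (rho k z)) \<ge> 0" by (simp add: f_sig)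
    then show thesis using that[of Lower "sig k (rho k z)"] False 1 2
        inb_tri[OF assms(1,2) inb_sig[OF inb_rho[OF iz]]]
      by (simp add: Bx_def z_def)
  qed
qed

text \<open>The two boxes without interior, at the bottom edge and at the edge opposite to it in the zigzag
  order, are the edges themselves.\<close>

lemma phi_degenerate_edge:
  assumes "reg p" "j = 0 \<or> j = N - 1" "f j p = 0"
  shows "\<phi> (C s p) \<in> surface_edge n (lab j)"
proof -
  have U: "\<phi> (C Upper p) \<in> surface_edge n (lab j)" if p: "reg p" "f j p = 0" for p
    using assms(2)
  proof
    assume j: "j = 0"
    note b = bottom_tri[OF p(1) p(2)[unfolded j]]
    have k: "1 \<le> (1::int)" "1 \<le> N - 2" using n_ge_3 by auto
    have e: "ell 2 > 0" using n_ge_3 by (intro ell_pos) auto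
    note i = tri_inb[OF k b(1) p(1)]
    have gr: "g 1 (rho 1 p) = 1 - g 1 p" "g 2 (rho 1 p) = 0" "g 0 (rho 1 p) = 0"
      using g_rho_odd[of 1 p] b g_rec[of 0 "rho 1 p"] by auto
    have "g 1 p \<le> 1" using i by (simp add: inb_def)
    then have f1: "f 1 (rho 1 p) \<ge> 0" using gr e by (simp add: f_def)
    have "\<phi> (C Upper p) = C Upper (rho 1 p)"
      using C_Bx[OF k b(1) p(1), of Upper] phi_Bx[OF k i] f1 by (simp add: Bx_def)
    moreover have "f 0 (rho 1 p) = 0" using gr by (simp add: f_def)
    ultimately show ?thesis
      using surface_edge_iff[OF inb_tri(2)[OF k inb_rho[OF i] f1], of 0 Upper] n_ge_3 j by simp
  next
    assume j: "j = N - 1"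
    note b = apex_tri[OF p(1) p(2)[unfolded j]]
    have k: "1 \<le> N - 2" "N - 2 \<le> N - 2" using n_ge_3 by auto
    have odd: "odd (N - 2)" using odd_n by simp
    have e: "ell (N - 2) > 0" "ell (N - 1) > 0" using n_ge_3 by (auto intro: ell_pos)
    note i = tri_inb[OF k b(1) p(1)]
    have e1: "N - 2 + 1 = N - 1" "N - 2 + 2 = N" by simp_all
    have gr: "g (N - 2) (rho (N - 2) p) = 0" "g (N - 1) (rho (N - 2) p) = g (N - 1) p"
      using g_rho_odd[OF odd, of p] b by (auto simp: e1)
    have "g (N - 1) p > 0" using i b by (auto simp: inb_def e1)
    then have f1: "f (N - 2) (rho (N - 2) p) < 0" using gr e by (simp add: f_def e1)
    let ?r = "sig (N - 2) (rho (N - 2) p)"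
    have "\<phi> (C Upper p) = C Lower ?r"
      using C_Bx[OF k b(1) p(1), of Upper] phi_Bx[OF k i] f1 by (simp add: Bx_def)
    moreover have "g (N - 2) ?r = ell (N - 2)" using gr g_sig(1)[of "N - 2"] by simp
    then have "g N ?r = 0" using g_rec[of "N - 2" ?r] by simp
    then have "f (N - 1) ?r = 0" by (simp add: f_def)
    moreover have "reg ?r" using inb_tri(2)[OF k inb_sig[OF inb_rho[OF i]]] f1 by (simp add: f_sig)
    ultimately show ?thesis using surface_edge_iff[of ?r "N - 1" Lower] n_ge_3 j by simp
  qed
  show ?thesis
  proof (cases s)
    case Lower
    have j: "0 \<le> j" "j < N" using assms(2) n_ge_3 by auto
    have "C s p = C Upper (sig j p)" using C_glue[OF j reg_P[OF assms(1)] assms(3), of Lower] Lower by (simp add: opp_def)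
    then show ?thesis using U[of "sig j p"] reg_sig[OF j assms(1,3)] assms(3) by (simp add: f_sig)
  qed (use U assms in simp)
qed

text \<open>For \<open>j = k\<close> the reflection exchanges the two diagonals. For the degenerate
  edges one implication is \<open>phi_degenerate_edge\<close>; the other applies that lemma to the
  image point and uses that \<open>\<phi>\<close> returns it to the original.\<close>

lemma phi_edge:
  assumes k: "1 \<le> k" "k \<le> N - 2" and p: "p \<in> tri k" "reg p" and j: "0 \<le> j" "j < N"
  shows "\<phi> (C s p) \<in> surface_edge n (lab j) \<longleftrightarrow>
    j = k \<and> F k p = 0 \<or> (j = 0 \<or> j = N - 1) \<and> f j p = 0"
proof -
  obtain s' p' where p': "\<phi> (C s p) = C s' p'" "p' \<in> tri k" "reg p'" "\<phi> (C s' p') = C s p"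
    "p' = rho k (if s = Upper then p else sig k p) \<and> f k p' \<ge> 0 \<or>
     sig k p' = rho k (if s = Upper then p else sig k p) \<and> f k (sig k p') < 0"
    by (rule phi_tri[OF k p, of s])
  have iff: "\<phi> (C s p) \<in> surface_edge n (lab j) \<longleftrightarrow> f j p' = 0"
    unfolding p'(1) by (rule surface_edge_iff[OF p'(3) j])
  show ?thesis
  proof (cases "j = k")
    case True
    have "f k p' = 0 \<longleftrightarrow> f k (rho k (if s = Upper then p else sig k p)) = 0"
      using p'(5) by (metis f_sig neg_equal_0_iff_equal)
    then have "f k p' = 0 \<longleftrightarrow> F k p = 0" by (simp add: f_rho F_sig)
    then show ?thesis using iff True k by auto
  next
    case False
    show ?thesis
    proof
      assume "\<phi> (C s p) \<in> surface_edge n (lab j)"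
      then have f: "f j p' = 0" using iff by simp
      then have d: "j = 0 \<or> j = N - 1" using tri_zero[OF k p'(2,3) j] False by blast
      have "C s p \<in> surface_edge n (lab j)" using phi_degenerate_edge[OF p'(3) d f, of s'] p'(4) by simp
      then show "j = k \<and> F k p = 0 \<or> (j = 0 \<or> j = N - 1) \<and> f j p = 0"
        using surface_edge_iff[OF p(2) j] d by simp
    next
      assume "j = k \<and> F k p = 0 \<or> (j = 0 \<or> j = N - 1) \<and> f j p = 0"
      then show "\<phi> (C s p) \<in> surface_edge n (lab j)" using False phi_degenerate_edge[OF p(2)] by blast
    qed
  qed
qed

end

locale veech_trajectory = veech_automorphism +
  fixes \<tau> :: "real \<Rightarrow> point" and w :: "real \<times> real" and \<sigma> :: real
    and c :: "int \<Rightarrow> real" and \<kappa> :: "int \<Rightarrow> int"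
  assumes straight_tau: "straight UNIV w \<tau>" and regp_tau: "regp (\<tau> t)"
    and w_nonzero: "w \<noteq> 0" and orient: "\<sigma> = 1 \<or> \<sigma> = - 1"
    and sector: "\<sigma> * fst w \<ge> 0" "\<sigma> * snd w \<le> 0"
    and mono_c: "strict_mono c"
    and range_c: "range c = {t. \<exists>k. 0 \<le> k \<and> k < N \<and> \<tau> t \<in> surface_edge n (lab k)}"
    and kappa: "0 \<le> \<kappa> i" "\<kappa> i < N" "\<tau> (c i) \<in> surface_edge n (lab (\<kappa> i))"
begin

subsection \<open>Trajectories\<close>

text \<open>Since the trajectory is regular at all times, a segment inside the polygon is followed
  to its end and cannot contain a corner. The time \<open>u\<close> may be negative.\<close>

lemma follow:
  assumes "\<tau> t0 = C s p" "p \<in> P" "p + u *\<^sub>R sg s *\<^sub>R w \<in> P" "0 \<le> r" "r \<le> 1"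
  shows "\<tau> (t0 + u * r) = C s (p + (u * r) *\<^sub>R sg s *\<^sub>R w)" "reg (p + (u * r) *\<^sub>R sg s *\<^sub>R w)"
proof -
  have inP: "p + (x - 0) *\<^sub>R sg s *\<^sub>R u *\<^sub>R w \<in> P" if "x \<in> {0..1}" for x
  proof -
    have "p + (x - 0) *\<^sub>R sg s *\<^sub>R u *\<^sub>R w = (1 - x) *\<^sub>R p + x *\<^sub>R (p + u *\<^sub>R sg s *\<^sub>R w)"
      by (simp add: algebra_simps)
    also have "\<dots> \<in> P" using convexD_alt[OF convex_P assms(2,3), of x] that by simp
    finally show ?thesis .
  qed
  have s2: "straight {0..1} (u *\<^sub>R w) (\<lambda>x. C s (p + (x - 0) *\<^sub>R sg s *\<^sub>R u *\<^sub>R w))"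
    by (rule straight_sheet[OF inP])
  have "straight {x. t0 + u * x \<in> UNIV} (u *\<^sub>R w) (\<lambda>x. \<tau> (t0 + u * x))"
    by (rule straight_affine[OF straight_tau])
  then have s1: "straight {0..1} (u *\<^sub>R w) (\<lambda>x. \<tau> (t0 + u * x))" by (rule straight_subset) simp
  have e: "p + (r - 0) *\<^sub>R sg s *\<^sub>R u *\<^sub>R w = p + (u * r) *\<^sub>R sg s *\<^sub>R w" by (simp add: mult_ac)
  have "\<tau> (t0 + u * r) = C s (p + (r - 0) *\<^sub>R sg s *\<^sub>R u *\<^sub>R w)"
  proof (rule straight_unique[OF _ s1 _ s2])
    show "\<tau> (t0 + u * 0) = C s (p + (0 - 0) *\<^sub>R sg s *\<^sub>R u *\<^sub>R w)" using assms(1) by simp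
  qed (use regp_tau assms in auto)
  then show 1: "\<tau> (t0 + u * r) = C s (p + (u * r) *\<^sub>R sg s *\<^sub>R w)" unfolding e .
  have "p + (u * r) *\<^sub>R sg s *\<^sub>R w \<in> P" using inP[of r] assms unfolding e by simp
  then show "reg (p + (u * r) *\<^sub>R sg s *\<^sub>R w)" using regp_tau[of "t0 + u * r"] 1 regp_C by simp
qed

text \<open>A trajectory along an edge would run into a corner.\<close>

lemma transversal:
  assumes "\<tau> t0 = C s p" "p \<in> P" "0 \<le> k" "k < N" "f k p = 0"
  shows "df k w \<noteq> 0"
proof
  assume df: "df k w = 0"
  have r: "reg p" using regp_tau[of t0] assms regp_C by simp
  obtain \<theta> where \<theta>: "0 < \<theta>" "\<theta> < 1" "g k p = \<theta> * ell k" "g (k + 1) p = \<theta> * ell (k + 1)"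
    using reg_edge_param[OF assms(3,4) r assms(5)] .
  have ne: "ell k > 0 \<or> ell (k + 1) > 0"
    using assms(3,4) n_ge_3 ell_pos[of k] ell_pos[of "k + 1"] by (cases "k = 0") auto
  obtain l where l: "pr k w = l * ell k" "pr (k + 1) w = l * ell (k + 1)"
  proof (cases "ell k > 0")
    case True
    show thesis by (rule that[of "pr k w / ell k"]) (use True df in \<open>auto simp: df_def field_simps\<close>)
  next
    case False
    then have "ell (k + 1) > 0" using ne by simp
    then show thesis by (intro that[of "pr (k + 1) w / ell (k + 1)"]) (use df in \<open>auto simp: df_def field_simps\<close>)
  qed
  have "l \<noteq> 0"
  proof
    assume "l = 0"
    then have "w = 0" using l pr_eqI[of k w 0] by (simp add: pr_def)
    then show False using w_nonzero by simp
  qed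
  \<comment> \<open>\<open>l\<close> is the velocity measured in edge vectors. From the fraction
    \<open>\<theta>\<close> of the edge, the remaining fraction \<open>1 - \<theta>\<close> leads to
    the corner \<open>zt (k + 2)\<close>; \<open>sg s\<close> accounts for the sheet.\<close>
  define u where "u = (1 - \<theta>) / (sg s * l)"
  have sg0: "sg s \<noteq> 0" by (simp add: sg_def)
  have ul: "u * (sg s * l) = 1 - \<theta>" using \<open>l \<noteq> 0\<close> sg0 by (simp add: u_def)
  have "g k (p + u *\<^sub>R sg s *\<^sub>R w) = \<theta> * ell k + u * (sg s * l) * ell k"
    "g (k + 1) (p + u *\<^sub>R sg s *\<^sub>R w) = \<theta> * ell (k + 1) + u * (sg s * l) * ell (k + 1)"
    unfolding g_move pr_scale l \<theta>(3,4) by (simp_all add: mult_ac)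
  then have "g k (p + u *\<^sub>R sg s *\<^sub>R w) = ell k" "g (k + 1) (p + u *\<^sub>R sg s *\<^sub>R w) = ell (k + 1)"
    unfolding ul by (simp_all add: algebra_simps)
  then have z: "p + u *\<^sub>R sg s *\<^sub>R w = zt (k + 2)" by (intro g_eqI[of k]) (simp_all add: g_zt)
  then have "p + u *\<^sub>R sg s *\<^sub>R w \<in> P" using zt_P assms(3,4) by simp
  from follow(2)[OF assms(1,2) this, of 1] show False using z not_reg_zt[of "k + 2"] assms(3,4) by simp
qed

lemma edge_unique:
  assumes "regp q" "0 \<le> i" "i < N" "0 \<le> j" "j < N" "q \<in> surface_edge n (lab i)" "q \<in> surface_edge n (lab j)"
  shows "i = j"
proof -
  obtain s p where p: "reg p" "q = C s p" using assms(1) by (rule regpE)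
  then have "f i p = 0" "f j p = 0" using surface_edge_iff assms by auto
  then show ?thesis using p(1) assms(2-5) by (auto simp: reg_def)
qed

text \<open>Crossing the \<open>k\<close>-th edge the trajectory enters the sheet \<open>A k\<close>, with velocity \<open>dr k\<close> in its
  coordinates.\<close>

definition A :: "int \<Rightarrow> sheet" where
  "A k = (if (\<sigma> = 1) = odd k then Upper else Lower)"

definition dr :: "int \<Rightarrow> real \<times> real" where "dr k = sg (A k) *\<^sub>R w"

lemma A_step: "A (k + 1) = opp (A k)" "A (k - 1) = opp (A k)"
  by (auto simp: A_def opp_def)

lemma dr_step: "k' = k + 1 \<or> k' = k - 1 \<Longrightarrow> dr k' = - dr k"
  by (auto simp: dr_def A_step sg_opp)

lemma dr_sector: "pr k (dr k) \<ge> 0" "pr (k + 1) (dr k) \<le> 0" "dr k \<noteq> 0"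
  using sector w_nonzero orient by (auto simp: dr_def A_def sg_def pr_def)

definition chord_at :: "int \<Rightarrow> real \<times> real \<Rightarrow> real \<Rightarrow> bool" where
  "chord_at i p m \<longleftrightarrow> reg p \<and> f (\<kappa> i) p = 0 \<and> \<tau> (c i) = C (A (\<kappa> i)) p \<and>
     chord (\<kappa> i) (\<kappa> (i + 1)) p (dr (\<kappa> i)) (m - c i) (c (i + 1) - c i) \<and>
     (\<forall>t. c i \<le> t \<and> t \<le> c (i + 1) \<longrightarrow>
        \<tau> t = C (A (\<kappa> i)) (p + (t - c i) *\<^sub>R dr (\<kappa> i)) \<and> reg (p + (t - c i) *\<^sub>R dr (\<kappa> i)))"

text \<open>The crossing point is represented on the sheet being entered. The corner case of
  \<open>chord_exists\<close> would put the trajectory on a cone point, so the chord ends at a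
  crossing, and it remains to see that none comes earlier.\<close>

lemma chord_at_exists: "\<exists>p m. chord_at i p m"
proof -
  let ?k = "\<kappa> i" and ?s = "A (\<kappa> i)"
  obtain s p0 where p0: "reg p0" "\<tau> (c i) = C s p0" using regp_tau by (rule regpE)
  have f0: "f ?k p0 = 0" using surface_edge_iff[OF p0(1) kappa(1,2)] kappa(3)[of i] p0(2) by simp
  obtain p where p: "reg p" "f ?k p = 0" "\<tau> (c i) = C ?s p"
  proof (cases "s = ?s")
    case True
    then show thesis using that p0 f0 by simp
  next
    case False
    then have "?s = opp s" using sheet_cases[of ?s s] by auto
    then show thesis using that[of "sig ?k p0"] reg_sig[OF kappa(1,2) p0(1) f0] f0
        C_glue[OF kappa(1,2) reg_P[OF p0(1)] f0, of s] p0(2) by (simp add: f_sig)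
  qed
  have tr: "df ?k (dr ?k) \<noteq> 0"
    using transversal[OF p(3) reg_P[OF p(1)] kappa(1,2) p(2)] by (simp add: dr_def df_scale sg_def)
  have pos: "?k = 0 \<longrightarrow> pr ?k (dr ?k) > 0" "?k = N - 1 \<longrightarrow> pr (?k + 1) (dr ?k) < 0"
    using tr dr_sector[of ?k] by (auto simp: df_def)
  have fol: "\<tau> (c i + t) = C ?s (p + t *\<^sub>R dr ?k) \<and> reg (p + t *\<^sub>R dr ?k)"
    if "T > 0" "p + T *\<^sub>R dr ?k \<in> P" "0 \<le> t" "t \<le> T" for t T
  proof -
    have "p + T *\<^sub>R sg ?s *\<^sub>R w \<in> P" using that(2) by (simp only: dr_def)
    from follow[OF p(3) reg_P[OF p(1)] this, of "t / T"] that show ?thesis by (simp add: dr_def)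
  qed
  consider T where "T > 0" "p + T *\<^sub>R dr ?k = zt (?k + 1)" | k' m T where "chord ?k k' p (dr ?k) m T"
    using chord_exists[OF kappa(1,2) p(1,2) dr_sector pos] by blast
  then show ?thesis
  proof cases
    case (1 T)
    have "zt (?k + 1) \<in> P" using zt_P[of "?k + 1"] kappa(1,2)[of i] by simp
    then have "reg (zt (?k + 1))" using fol[of T T] 1 by simp
    then show ?thesis using not_reg_zt[of "?k + 1"] kappa(1,2)[of i] by simp
  next
    case (2 k' m T)
    have T: "T > 0" "p + T *\<^sub>R dr ?k \<in> P" "f k' (p + T *\<^sub>R dr ?k) = 0" "f ?k (p + T *\<^sub>R dr ?k) > 0"
      and k': "0 \<le> k'" "k' < N" using 2 unfolding chord_def by blast+
    have fT: "\<tau> (c i + T) = C ?s (p + T *\<^sub>R dr ?k)" "reg (p + T *\<^sub>R dr ?k)" using fol[OF T(1,2), of T] T(1) by auto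
    have e: "\<tau> (c i + T) \<in> surface_edge n (lab k')" unfolding fT(1) using surface_edge_iff[OF fT(2) k'] T(3) by simp
    then have "c i + T \<in> range c" unfolding range_c using k' by blast
    then obtain j where j: "c j = c i + T" by auto
    then have "i < j" using T(1) strict_mono_less[OF mono_c, of i j] by simp
    then have le: "c (i + 1) \<le> c i + T" using strict_mono_less_eq[OF mono_c, of "i + 1" j] j by simp
    have gt: "c (i + 1) > c i" using strict_mono_less[OF mono_c, of i "i + 1"] by simp
    have ci: "c (i + 1) = c i + T"
    proof (rule ccontr)
      assume "c (i + 1) \<noteq> c i + T"
      define t where "t = c (i + 1) - c i"
      have t: "0 < t" "t < T" using gt le \<open>c (i + 1) \<noteq> c i + T\<close> by (auto simp: t_def)
      have ft: "\<tau> (c i + t) = C ?s (p + t *\<^sub>R dr ?k)" "reg (p + t *\<^sub>R dr ?k)" using fol[OF T(1,2), of t] t by auto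
      let ?l = "\<kappa> (i + 1)"
      have "\<tau> (c i + t) \<in> surface_edge n (lab ?l)" using kappa(3)[of "i + 1"] by (simp add: t_def)
      then have fl: "f ?l (p + t *\<^sub>R dr ?k) = 0" using surface_edge_iff[OF ft(2) kappa(1,2)] ft(1) by simp
      have "f ?l p \<ge> 0" "f ?l (p + T *\<^sub>R dr ?k) \<ge> 0" using reg_P[OF p(1)] T(2) kappa(1,2)[of "i + 1"] by (auto simp: P_def)
      then have nn: "f ?l p \<ge> 0" "f ?l p + T * df ?l (dr ?k) \<ge> 0" "f ?l p + t * df ?l (dr ?k) = 0"
        using fl by (simp_all add: f_move)
      \<comment> \<open>An affine function that is nonnegative at both ends and zero in between
        vanishes at both ends. At the start this forces \<open>?l\<close> to be the edge just
        crossed, and at the end that edge has been left.\<close>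
      have "(T - t) * f ?l p + t * (f ?l p + T * df ?l (dr ?k)) = T * (f ?l p + t * df ?l (dr ?k))"
        by (simp add: algebra_simps)
      then have "(T - t) * f ?l p + t * (f ?l p + T * df ?l (dr ?k)) = 0" using nn(3) by simp
      moreover have "(T - t) * f ?l p \<ge> 0" "t * (f ?l p + T * df ?l (dr ?k)) \<ge> 0" using t nn by auto
      ultimately have "(T - t) * f ?l p = 0" "t * (f ?l p + T * df ?l (dr ?k)) = 0" by linarith+
      then have z: "f ?l p = 0" "f ?l (p + T *\<^sub>R dr ?k) = 0" using t by (auto simp: f_move)
      have "?l = ?k" using p(1,2) z(1) kappa(1,2)[of i] kappa(1,2)[of "i + 1"] by (auto simp: reg_def)
      then show False using z(2) T(4) by simp
    qed
    have kk: "\<kappa> (i + 1) = k'"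
      using edge_unique[OF regp_tau kappa(1,2) k' _ e] kappa(3)[of "i + 1"] by (simp add: ci)
    have "chord_at i p (c i + m)"
      unfolding chord_at_def
    proof (intro conjI allI impI p)
      show "chord ?k (\<kappa> (i + 1)) p (dr ?k) (c i + m - c i) (c (i + 1) - c i)" using 2 by (simp add: kk ci)
      fix t assume t: "c i \<le> t \<and> t \<le> c (i + 1)"
      show "\<tau> t = C ?s (p + (t - c i) *\<^sub>R dr ?k)" "reg (p + (t - c i) *\<^sub>R dr ?k)"
        using fol[OF T(1,2), of "t - c i"] t ci by auto
    qed
    then show ?thesis by blast
  qed
qed

section \<open>Crossing times accumulate nowhere\<close>

lemma crossings_discrete:
  "\<forall>\<^sub>F u in nhds 0. u \<noteq> 0 \<longrightarrow> t0 + u \<notin> range c"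
proof -
  obtain s p where p: "reg p" "\<tau> t0 = C s p" using regp_tau by (rule regpE)
  define H where "H p' w' u \<longleftrightarrow> (\<forall>j\<in>{0..<N}. (f j p' > 0 \<longrightarrow> f j (p' + u *\<^sub>R w') > 0) \<and> (f j p' < 0 \<longrightarrow> f j (p' + u *\<^sub>R w') < 0))" for p' w' u
  have "\<forall>\<^sub>F u in nhds 0. H p (sg s *\<^sub>R w) u" unfolding H_def by (rule eventually_f)
  moreover have "\<forall>\<^sub>F u in nhds 0. \<forall>k\<in>{0..<N}. H (sig k p) (sg (opp s) *\<^sub>R w) u"
    unfolding H_def by (intro eventually_ball_finite ballI eventually_f) simp
  moreover have "\<forall>\<^sub>F u in nhds 0. displaced (\<tau> t0) (Lam (u *\<^sub>R w)) (\<tau> (t0 + u))"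
    using straightD[OF straight_tau, of t0] by simp
  ultimately show ?thesis
  proof eventually_elim
    case (elim u)
    show ?case
    proof (intro impI notI)
      assume u: "u \<noteq> 0" "t0 + u \<in> range c"
      obtain l where l: "0 \<le> l" "l < N" "\<tau> (t0 + u) \<in> surface_edge n (lab l)" using u(2) unfolding range_c by blast
      obtain s1 p1 where p1: "p1 \<in> P" "p1 + sg s1 *\<^sub>R u *\<^sub>R w \<in> P" "\<tau> t0 = C s1 p1" "\<tau> (t0 + u) = C s1 (p1 + sg s1 *\<^sub>R u *\<^sub>R w)"
        using displaced_iff[of "\<tau> t0" "\<tau> (t0 + u)" "u *\<^sub>R w"] elim(3) regp_tau regp_surface by blast
      have G: "H p1 (sg s1 *\<^sub>R w) u"
        using C_reg_eq[OF p(1) p1(1), of s s1] p(2) p1(3) elim(1,2) by auto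
      have "reg (p1 + sg s1 *\<^sub>R u *\<^sub>R w)" using p1(2,4) regp_tau[of "t0 + u"] regp_C by simp
      then have "f l (p1 + sg s1 *\<^sub>R u *\<^sub>R w) = 0" using surface_edge_iff l p1(4) by simp
      then have fl: "f l (p1 + u *\<^sub>R sg s1 *\<^sub>R w) = 0" by (simp add: mult.commute)
      then have f0: "f l p1 = 0" using G l unfolding H_def by (metis atLeastLessThan_iff less_irrefl linorder_neqE_linordered_idom)
      have "df l w = 0" using fl f0 u(1) by (simp add: f_move df_scale sg_def split: if_splits)
      then show False using transversal[OF p1(3,1) l(1,2) f0] by simp
    qed
  qed
qed

lemma crossings_isolated: "\<exists>e>0. \<forall>i. \<bar>c i - t0\<bar> < e \<longrightarrow> c i = t0"
proof -
  obtain e where e: "e > 0" "\<And>u. dist u 0 < e \<Longrightarrow> u \<noteq> 0 \<Longrightarrow> t0 + u \<notin> range c"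
    using crossings_discrete[of t0] unfolding eventually_nhds_metric by blast
  have "c i = t0" if "\<bar>c i - t0\<bar> < e" for i
    using e(2)[of "c i - t0"] that by (auto simp: dist_real_def)
  then show ?thesis using e(1) by blast
qed

text \<open>Bounded crossing times would accumulate at their supremum, against
  \<open>crossings_isolated\<close>. Hence the intervals between crossings exhaust all
  times.\<close>

lemma c_unbounded_above: "\<exists>i. c i > B"
proof (rule ccontr)
  assume "\<not> ?thesis"
  then have B: "c i \<le> B" for i by (simp add: not_less)
  then have bdd: "bdd_above (range c)" unfolding bdd_above_def by blast
  define L where "L = Sup (range c)"
  obtain e where e: "e > 0" "\<And>i. \<bar>c i - L\<bar> < e \<Longrightarrow> c i = L" using crossings_isolated by blast
  have le: "c i \<le> L" for i unfolding L_def using bdd by (intro cSup_upper) auto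
  obtain i where i: "c i > L - e" using less_cSup_iff[OF _ bdd, of "L - e"] e(1) by (auto simp: L_def)
  have "c i < c (i + 1)" using strict_mono_less[OF mono_c, of i "i + 1"] by simp
  then have "\<bar>c i - L\<bar> < e" "\<bar>c (i + 1) - L\<bar> < e" using i le[of i] le[of "i + 1"] by auto
  then show False using e(2)[of i] e(2)[of "i + 1"] \<open>c i < c (i + 1)\<close> by linarith
qed

lemma c_unbounded_below: "\<exists>i. c i \<le> B"
proof (rule ccontr)
  assume "\<not> ?thesis"
  then have B: "B \<le> c i" for i by (simp add: not_le less_imp_le)
  then have bdd: "bdd_below (range c)" unfolding bdd_below_def by blast
  define L where "L = Inf (range c)"
  obtain e where e: "e > 0" "\<And>i. \<bar>c i - L\<bar> < e \<Longrightarrow> c i = L" using crossings_isolated by blast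
  have le: "L \<le> c i" for i unfolding L_def using bdd by (intro cInf_lower) auto
  obtain i where i: "c i < L + e" using cInf_less_iff[OF _ bdd, of "L + e"] e(1) by (auto simp: L_def)
  have "c (i - 1) < c i" using strict_mono_less[OF mono_c, of "i - 1" i] by simp
  then have "\<bar>c i - L\<bar> < e" "\<bar>c (i - 1) - L\<bar> < e" using i le[of i] le[of "i - 1"] by auto
  then show False using e(2)[of i] e(2)[of "i - 1"] \<open>c (i - 1) < c i\<close> by linarith
qed

lemma between_crossings: obtains i where "c i \<le> t" "t < c (i + 1)"
proof -
  obtain i0 where i0: "c i0 \<le> t" using c_unbounded_below by blast
  obtain i1 where i1: "c i1 > t" using c_unbounded_above by blast
  have "\<exists>i. c i \<le> t \<and> t < c (i + 1)"
  proof (rule ccontr)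
    assume "\<not> ?thesis"
    then have step: "c i \<le> t \<Longrightarrow> c (i + 1) \<le> t" for i by (metis not_le)
    have "i0 \<le> i \<Longrightarrow> c i \<le> t" for i
      by (induction i rule: int_ge_induct) (use i0 step in auto)
    moreover have "i0 \<le> i1" using i0 i1 strict_mono_less[OF mono_c, of i0 i1] by simp
    ultimately show False using i1 by force
  qed
  then show thesis using that by blast
qed

section \<open>Visits of the boxes and sandwiched letters\<close>

definition pp :: "int \<Rightarrow> real \<times> real" where "pp i = (SOME p. \<exists>m. chord_at i p m)"
text \<open>The time at which the trajectory passes from the box of its \<open>i\<close>-th crossed
  edge to that of the next one.\<close>

definition mm :: "int \<Rightarrow> real" where "mm i = (SOME m. chord_at i (pp i) m)"

lemma chord_at: "chord_at i (pp i) (mm i)"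
  unfolding mm_def pp_def using chord_at_exists[of i] by (metis (mono_tags, lifting) someI_ex)

definition box_edge :: "int \<Rightarrow> bool" where "box_edge k \<longleftrightarrow> 1 \<le> k \<and> k \<le> N - 2"

abbreviation pt :: "int \<Rightarrow> real \<Rightarrow> real \<times> real" where
  "pt i t \<equiv> pp i + (t - c i) *\<^sub>R dr (\<kappa> i)"

lemma c_less: "c i < c (i + 1)"
  using strict_mono_less[OF mono_c, of i "i + 1"] by simp

lemma pt_tau: "c i \<le> t \<Longrightarrow> t \<le> c (i + 1) \<Longrightarrow> \<tau> t = C (A (\<kappa> i)) (pt i t)"
  and pt_reg: "c i \<le> t \<Longrightarrow> t \<le> c (i + 1) \<Longrightarrow> reg (pt i t)"
  using chord_at[of i] unfolding chord_at_def by blast+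

lemma pp_edge: "f (\<kappa> i) (pp i) = 0"
  using chord_at[of i] unfolding chord_at_def by blast

lemma chord_i: "chord (\<kappa> i) (\<kappa> (i + 1)) (pp i) (dr (\<kappa> i)) (mm i - c i) (c (i + 1) - c i)"
  using chord_at[of i] unfolding chord_at_def by blast

lemma mm_bounds: "c i \<le> mm i" "mm i \<le> c (i + 1)"
  and kappa_step: "\<kappa> (i + 1) = \<kappa> i + 1 \<or> \<kappa> (i + 1) = \<kappa> i - 1"
  and pt_end: "f (\<kappa> (i + 1)) (pt i (c (i + 1))) = 0"
  using chord_i[of i] unfolding chord_def by auto

lemma leave_box:
  assumes "box_edge (\<kappa> i)"
  shows "c i \<le> t \<Longrightarrow> t \<le> mm i \<Longrightarrow> pt i t \<in> tri (\<kappa> i)"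
    "\<kappa> (i + 1) = \<kappa> i + 1 \<Longrightarrow> F (\<kappa> i) (pt i (mm i)) > 0"
    "\<kappa> (i + 1) = \<kappa> i - 1 \<Longrightarrow> F (\<kappa> i) (pt i (mm i)) < 0"
  using chord_i[of i] assms unfolding chord_def box_edge_def by auto

lemma leave_degenerate: "\<not> box_edge (\<kappa> i) \<Longrightarrow> mm i = c i"
  using chord_i[of i] unfolding chord_def box_edge_def by auto

lemma enter_box:
  assumes "box_edge (\<kappa> (i + 1))"
  shows "mm i \<le> t \<Longrightarrow> t \<le> c (i + 1) \<Longrightarrow> pt i t \<in> tri (\<kappa> (i + 1))"
    "\<kappa> (i + 1) = \<kappa> i + 1 \<Longrightarrow> F (\<kappa> (i + 1)) (pt i (mm i)) < 0"
    "\<kappa> (i + 1) = \<kappa> i - 1 \<Longrightarrow> F (\<kappa> (i + 1)) (pt i (mm i)) > 0"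
  using chord_i[of i] assms unfolding chord_def box_edge_def by auto

lemma enter_degenerate: "\<not> box_edge (\<kappa> (i + 1)) \<Longrightarrow> mm i = c (i + 1)"
  using chord_i[of i] unfolding chord_def box_edge_def by auto

text \<open>At the crossing the two points are glued, and the velocities are opposite. Hence
  \<open>sig\<close> relates the two affine parametrisations at all times, also outside the
  chords.\<close>

lemma pt_next: "pt (i + 1) t = sig (\<kappa> (i + 1)) (pt i t)"
proof -
  let ?k' = "\<kappa> (i + 1)" and ?q = "pt i (c (i + 1))"
  have s: "A ?k' = opp (A (\<kappa> i))" "dr ?k' = - dr (\<kappa> i)"
    using kappa_step[of i] A_step dr_step by auto
  have r: "reg ?q" using pt_reg[of i "c (i + 1)"] c_less[of i] by simp
  have "C (A (\<kappa> i)) ?q = C (A ?k') (pp (i + 1))"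
    using pt_tau[of i "c (i + 1)"] pt_tau[of "i + 1" "c (i + 1)"] c_less[of i] c_less[of "i + 1"] by simp
  moreover have "reg (pp (i + 1))" using chord_at[of "i + 1"] unfolding chord_at_def by blast
  ultimately obtain l where l: "0 \<le> l" "l < N" "f l ?q = 0" "pp (i + 1) = sig l ?q"
    using C_reg_eq[OF r reg_P, of "pp (i + 1)" "A (\<kappa> i)" "A ?k'"] s(1) by auto
  have "l = ?k'" using r l(1-3) pt_end[of i] kappa[of "i + 1"] by (auto simp: reg_def)
  then have pe: "pp (i + 1) = sig ?k' ?q" using l(4) by simp
  have "?q + (t - c (i + 1)) *\<^sub>R dr (\<kappa> i) = pt i t" by (simp add: algebra_simps)
  then have "sig ?k' (pt i t) = sig ?k' ?q - (t - c (i + 1)) *\<^sub>R dr (\<kappa> i)" using sig_add by metis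
  then show ?thesis unfolding pe s(2) by simp
qed

text \<open>Along the visit of the box of the \<open>i\<close>-th crossed edge, \<open>G i\<close> measures the position relative to
  the other diagonal of the box; it is an affine function of time.\<close>

definition G :: "int \<Rightarrow> real \<Rightarrow> real" where "G i t = F (\<kappa> i) (pt i t)"

lemma G_prev: "G (i + 1) t = - F (\<kappa> (i + 1)) (pt i t)"
  unfolding G_def pt_next F_sig ..

lemma G_affine: "\<exists>B. \<forall>t. G i t = G i (c i) + (t - c i) * B"
proof -
  let ?k = "\<kappa> i" and ?d = "dr (\<kappa> i)"
  show ?thesis
    by (intro exI[of _ "ell (?k + 1) * pr ?k ?d + ell ?k * pr (?k + 1) ?d"])
       (simp only: G_def F_def g_move, simp add: algebra_simps)
qed

lemma G_leave: "box_edge (\<kappa> i) \<Longrightarrow> \<kappa> (i + 1) = \<kappa> i + 1 \<Longrightarrow> G i (mm i) > 0"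
  "box_edge (\<kappa> i) \<Longrightarrow> \<kappa> (i + 1) = \<kappa> i - 1 \<Longrightarrow> G i (mm i) < 0"
  unfolding G_def by (rule leave_box; assumption)+

text \<open>The entry is seen in the coordinates of the previous sheet. The half-turn to the current
  one negates \<open>F\<close>, which reverses the signs of \<open>enter_box\<close>.\<close>

lemma G_enter: "box_edge (\<kappa> i) \<Longrightarrow> \<kappa> (i - 1) = \<kappa> i + 1 \<Longrightarrow> G i (mm (i - 1)) < 0"
  "box_edge (\<kappa> i) \<Longrightarrow> \<kappa> (i - 1) = \<kappa> i - 1 \<Longrightarrow> G i (mm (i - 1)) > 0"
  using enter_box(2,3)[of "i - 1"] G_prev[of "i - 1" "mm (i - 1)"] by auto

lemma kappa_step_back: "\<kappa> (i - 1) = \<kappa> i + 1 \<or> \<kappa> (i - 1) = \<kappa> i - 1"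
  using kappa_step[of "i - 1"] by auto

definition Sand :: "int set" where "Sand = {i. \<kappa> (i - 1) = \<kappa> (i + 1)}"

text \<open>At either end of the zigzag there is only one neighbouring index, so the previous and
  the next edge agree.\<close>

lemma Sand_degenerate: "\<not> box_edge (\<kappa> i) \<Longrightarrow> i \<in> Sand"
  using kappa_step[of i] kappa_step_back[of i] kappa[of i] kappa[of "i + 1"] kappa[of "i - 1"]
  unfolding Sand_def box_edge_def by auto

lemma affine_zero_unique:
  fixes h :: "real \<Rightarrow> real"
  assumes h: "\<And>t. h t = h0 + (t - a) * b" and "h x \<noteq> 0" "h s = 0" "h t = 0"
  shows "s = t"
proof -
  have "(s - t) * b = 0" using h[of s] h[of t] assms(3,4) by (simp add: algebra_simps)
  moreover have "b \<noteq> 0" using h[of s] h[of x] assms by auto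
  ultimately show ?thesis by simp
qed

lemma Sand_zero:
  assumes "box_edge (\<kappa> i)" "i \<in> Sand"
  shows "\<exists>!t. mm (i - 1) < t \<and> t < mm i \<and> G i t = 0"
proof -
  obtain B where B: "\<And>t. G i t = G i (c i) + (t - c i) * B" using G_affine by blast
  have le: "mm (i - 1) \<le> mm i" using mm_bounds[of i] mm_bounds(2)[of "i - 1"] by simp
  have cont: "continuous_on {mm (i - 1)..mm i} (G i)" by (subst B[abs_def], intro continuous_intros)
  have sgn: "G i (mm (i - 1)) < 0 \<and> G i (mm i) > 0 \<or> G i (mm (i - 1)) > 0 \<and> G i (mm i) < 0"
    using kappa_step_back[of i] assms G_leave[OF assms(1)] G_enter[OF assms(1)] unfolding Sand_def by auto
  then have "\<exists>t\<ge>mm (i - 1). t \<le> mm i \<and> G i t = 0"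
    using IVT'[of "G i" "mm (i - 1)" 0 "mm i"] IVT2'[of "G i" "mm i" 0 "mm (i - 1)"] le cont by auto
  then obtain t where t: "mm (i - 1) \<le> t" "t \<le> mm i" "G i t = 0" by blast
  have "t \<noteq> mm (i - 1)" "t \<noteq> mm i" using sgn t by auto
  then have t': "mm (i - 1) < t \<and> t < mm i \<and> G i t = 0" using t by simp
  then show ?thesis
    using affine_zero_unique[OF B, of "mm i"] sgn by (intro ex1I[of _ t]) auto
qed

text \<open>An affine function that is nonzero at both ends and has a zero in between takes opposite
  signs there; the sign rules for entry and exit then force equal neighbours.\<close>

lemma zero_Sand:
  assumes "box_edge (\<kappa> i)" "mm (i - 1) \<le> t" "t \<le> mm i" "G i t = 0"
  shows "i \<in> Sand" "mm (i - 1) < t" "t < mm i"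
proof -
  obtain B where B: "\<And>t. G i t = G i (c i) + (t - c i) * B" using G_affine by blast
  have ne: "G i (mm (i - 1)) \<noteq> 0" "G i (mm i) \<noteq> 0"
    using kappa_step_back[of i] kappa_step[of i] G_leave[OF assms(1)] G_enter[OF assms(1)] by fastforce+
  then have "t \<noteq> mm (i - 1)" "t \<noteq> mm i" using assms by auto
  then show t: "mm (i - 1) < t" "t < mm i" using assms by auto
  have d: "G i (mm (i - 1)) = (mm (i - 1) - t) * B" "G i (mm i) = (mm i - t) * B"
    using B[of "mm (i - 1)"] B[of "mm i"] B[of t] assms(4) by (simp_all add: algebra_simps)
  have "G i (mm (i - 1)) * G i (mm i) < 0"
  proof -
    have "B \<noteq> 0" using ne(2) d by auto
    then have "B * B > 0" by (metis not_real_square_gt_zero)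
    moreover have "(mm (i - 1) - t) * (mm i - t) < 0" using t by (simp add: mult_neg_pos)
    ultimately have "((mm (i - 1) - t) * (mm i - t)) * (B * B) < 0" by (rule mult_neg_pos[rotated])
    then show ?thesis unfolding d by (simp add: mult_ac)
  qed
  then show "i \<in> Sand"
    using kappa_step_back[of i] kappa_step[of i] G_leave[OF assms(1)] G_enter[OF assms(1)]
    unfolding Sand_def by (auto simp: mult_less_0_iff)
qed

section \<open>Crossing times of the image and the derived sequence\<close>

text \<open>Before \<open>c i\<close> the visit takes place on the previous sheet and after it on
  the next; \<open>G i\<close> is the same affine function on both parts, up to the sign handled by
  \<open>G_prev\<close>.\<close>

lemma phi_visit:
  assumes "box_edge (\<kappa> i)" "mm (i - 1) \<le> t" "t \<le> mm i" "0 \<le> j" "j < N"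
  shows "\<phi> (\<tau> t) \<in> surface_edge n (lab j) \<longleftrightarrow>
    j = \<kappa> i \<and> G i t = 0 \<or> (j = 0 \<or> j = N - 1) \<and> \<tau> t \<in> surface_edge n (lab j)"
proof (cases "c i \<le> t")
  case True
  then have t: "c i \<le> t" "t \<le> c (i + 1)" using assms(3) mm_bounds(2)[of i] by auto
  show ?thesis
    using phi_edge[OF _ _ leave_box(1)[OF assms(1) True assms(3)] pt_reg[OF t] assms(4,5), of "A (\<kappa> i)"]
      assms(1) pt_tau[OF t] surface_edge_iff[OF pt_reg[OF t] assms(4,5), of "A (\<kappa> i)"]
    unfolding box_edge_def G_def by simp
next
  case False
  have e: "i - 1 + 1 = i" by simp
  have t: "c (i - 1) \<le> t" "t \<le> c (i - 1 + 1)" using False assms(2) mm_bounds(1)[of "i - 1"] by auto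
  have b: "box_edge (\<kappa> (i - 1 + 1))" using assms(1) by simp
  have "G i t = - F (\<kappa> i) (pt (i - 1) t)" using G_prev[of "i - 1" t] by simp
  then show ?thesis
    using phi_edge[OF _ _ enter_box(1)[OF b assms(2) t(2)] pt_reg[OF t] assms(4,5), of "A (\<kappa> (i - 1))"]
      assms(1) pt_tau[OF t] surface_edge_iff[OF pt_reg[OF t] assms(4,5), of "A (\<kappa> (i - 1))"]
    unfolding box_edge_def e by simp
qed

text \<open>The time at which the image crosses the edge \<open>\<kappa> i\<close>. For a
  nondegenerate box the value is meaningful only when \<open>i\<close> is in \<open>Sand\<close>; at
  a degenerate edge the visit shrinks to the moment \<open>c i\<close>.\<close>

definition ft :: "int \<Rightarrow> real" where
  "ft i = (if box_edge (\<kappa> i) then THE t. mm (i - 1) < t \<and> t < mm i \<and> G i t = 0 else c i)"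

lemma ft_box: "box_edge (\<kappa> i) \<Longrightarrow> i \<in> Sand \<Longrightarrow> mm (i - 1) < ft i \<and> ft i < mm i \<and> G i (ft i) = 0"
  using theI'[OF Sand_zero] by (simp add: ft_def)

lemma degenerate_times: "\<not> box_edge (\<kappa> i) \<Longrightarrow> ft i = c i \<and> mm i = c i \<and> mm (i - 1) = c i"
  using leave_degenerate[of i] enter_degenerate[of "i - 1"] by (simp add: ft_def)

lemma ft_visit: "i \<in> Sand \<Longrightarrow> mm (i - 1) \<le> ft i \<and> ft i \<le> mm i"
  using ft_box degenerate_times by (cases "box_edge (\<kappa> i)") force+

lemma ft_edge: assumes "i \<in> Sand" shows "\<phi> (\<tau> (ft i)) \<in> surface_edge n (lab (\<kappa> i))"
proof (cases "box_edge (\<kappa> i)")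
  case True
  then show ?thesis using phi_visit[OF True, of "ft i" "\<kappa> i"] ft_box[OF True assms] kappa[of i] by auto
next
  case False
  then have "\<kappa> i = 0 \<or> \<kappa> i = N - 1" using kappa[of i] by (auto simp: box_edge_def)
  moreover have "\<tau> (ft i) = C (A (\<kappa> i)) (pp i)" "reg (pp i)"
    using degenerate_times[OF False] pt_tau[of i "c i"] pt_reg[of i "c i"] c_less[of i] by auto
  ultimately show ?thesis using phi_degenerate_edge pp_edge[of i] by simp
qed

lemma mm_mono: "i \<le> j \<Longrightarrow> mm i \<le> mm j"
proof (induction j rule: int_ge_induct)
  case (step j)
  then show ?case using mm_bounds[of j] mm_bounds(1)[of "j + 1"] by linarith
qed simp

text \<open>Visits follow each other in order but share end points. Strictness comes from the strict
  bounds in a nondegenerate box, and from \<open>c\<close> itself if both edges are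
  degenerate.\<close>

lemma ft_mono: assumes "i \<in> Sand" "j \<in> Sand" "i < j" shows "ft i < ft j"
proof -
  have m: "mm i \<le> mm (j - 1)" using assms by (intro mm_mono) simp
  note v = ft_visit[OF assms(1)] ft_visit[OF assms(2)]
  show ?thesis
  proof (cases "box_edge (\<kappa> i) \<or> box_edge (\<kappa> j)")
    case True
    then show ?thesis using ft_box assms m v by fastforce
  next
    case False
    then show ?thesis using degenerate_times[of i] degenerate_times[of j] strict_mono_less[OF mono_c] assms(3) by auto
  qed
qed

lemma phi_crossing_ft:
  assumes "0 \<le> j" "j < N" "\<phi> (\<tau> t) \<in> surface_edge n (lab j)"
  obtains i where "i \<in> Sand" "t = ft i"
proof -
  obtain i where "c i \<le> t" "t < c (i + 1)" by (rule between_crossings)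
  \<comment> \<open>The visits cover all times: between two crossings, \<open>mm i\<close> separates
    visit \<open>i\<close> from visit \<open>i + 1\<close>.\<close>
  then obtain l where l: "mm (l - 1) \<le> t" "t \<le> mm l"
    using that mm_bounds(2)[of "i - 1"] mm_bounds(1)[of "i + 1"]
    by (cases "t \<le> mm i") (auto dest: meta_spec[of _ i] meta_spec[of _ "i + 1"])
  show thesis
  proof (cases "box_edge (\<kappa> l)")
    case True
    from phi_visit[OF True l assms(1,2)] assms(3)
    consider "G l t = 0" | "j = 0 \<or> j = N - 1" "\<tau> t \<in> surface_edge n (lab j)" by blast
    then show thesis
    proof cases
      case 1
      note z = zero_Sand[OF True l 1]
      have "t = ft l" using Sand_zero[OF True z(1)] ft_box[OF True z(1)] z(2,3) 1 by blast
      then show thesis using that z(1) by blast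
    next
      case 2
      then have "t \<in> range c" unfolding range_c using assms(1,2) by blast
      then obtain i where i: "t = c i" by blast
      have "\<kappa> i = j" using edge_unique[OF regp_tau kappa(1,2) assms(1,2) kappa(3)] 2(2) i by simp
      then have "\<not> box_edge (\<kappa> i)" using 2(1) by (auto simp: box_edge_def)
      then show thesis using that[of i] Sand_degenerate degenerate_times i by simp
    qed
  next
    case False
    then have "t = ft l" using degenerate_times[OF False] l by auto
    then show thesis using that[of l] Sand_degenerate[OF False] by simp
  qed
qed

text \<open>Without sandwiched letters the chain index would be monotone, hence unbounded.\<close>

lemma Sand_above: "\<exists>j>i. j \<in> Sand"
proof (rule ccontr)
  assume "\<not> ?thesis"
  then have ns: "\<kappa> (j - 1) \<noteq> \<kappa> (j + 1)" if "j > i" for j using that by (auto simp: Sand_def)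
  define e where "e = \<kappa> (i + 1) - \<kappa> i"
  have e: "e = 1 \<or> e = - 1" using kappa_step[of i] by (auto simp: e_def)
  have "\<kappa> (i + int m) = \<kappa> i + int m * e \<and> \<kappa> (i + int m + 1) = \<kappa> i + (int m + 1) * e" for m
  proof (induction m)
    case (Suc m)
    then show ?case
      using ns[of "i + int m + 1"] kappa_step[of "i + int m + 1"] e by (auto simp: algebra_simps)
  qed (simp add: e_def)
  then have "\<kappa> (i + N) = \<kappa> i + N * e" by blast
  then show False using e kappa(1,2)[of "i + N"] kappa(1,2)[of i] by auto
qed

lemma Sand_below: "\<exists>j<i. j \<in> Sand"
proof (rule ccontr)
  assume "\<not> ?thesis"
  then have ns: "\<kappa> (j - 1) \<noteq> \<kappa> (j + 1)" if "j < i" for j using that by (auto simp: Sand_def)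
  define e where "e = \<kappa> (i - 1) - \<kappa> i"
  have e: "e = 1 \<or> e = - 1" using kappa_step_back[of i] by (auto simp: e_def)
  have "\<kappa> (i - int m) = \<kappa> i + int m * e \<and> \<kappa> (i - int m - 1) = \<kappa> i + (int m + 1) * e" for m
  proof (induction m)
    case (Suc m)
    then show ?case
      using ns[of "i - int m - 1"] kappa_step_back[of "i - int m - 1"] e by (auto simp: algebra_simps)
  qed (simp add: e_def)
  then have "\<kappa> (i - N) = \<kappa> i + N * e" by blast
  then show False using e kappa(1,2)[of "i - N"] kappa(1,2)[of i] by auto
qed

text \<open>\<open>ft\<close> maps the sandwiched positions in order onto the crossing times of the
  image. So the increasing enumerations of these times are exactly \<open>ft \<circ> j\<close> with
  \<open>j\<close> enumerating \<open>Sand\<close>, which settles both directions for every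
  \<open>d\<close>. Existence is a separate claim, since \<open>ksl\<close> needs sandwiched letters
  unboundedly far in both directions.\<close>

theorem derivation:
  assumes s: "\<And>i. s i = lab (\<kappa> i)"
  shows "(\<exists>d. ksl s d) \<and> (\<forall>d. cutting_sequence n (\<phi> \<circ> \<tau>) d \<longleftrightarrow> ksl s d)"
proof -
  have inj: "lab i = lab j \<longleftrightarrow> i = j" if "0 \<le> i" "i < N" "0 \<le> j" "j < N" for i j
    using bij_lab that by (auto simp: bij_betw_def inj_on_def)
  have S: "{i. sandwiched s i} = Sand"
    using inj[OF kappa(1,2) kappa(1,2)] by (auto simp: sandwiched_def Sand_def s)
  have range_ft: "ft ` Sand = {t. \<exists>k\<in>{1..n}. (\<phi> \<circ> \<tau>) t \<in> surface_edge n k}"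
  proof (intro subset_antisym subsetI)
    fix t assume "t \<in> ft ` Sand"
    then obtain i where "i \<in> Sand" "t = ft i" by blast
    then have "(\<phi> \<circ> \<tau>) t \<in> surface_edge n (lab (\<kappa> i))" using ft_edge by simp
    then show "t \<in> {t. \<exists>k\<in>{1..n}. (\<phi> \<circ> \<tau>) t \<in> surface_edge n k}"
      using lab_range[OF kappa(1,2)] by blast
  next
    fix t assume "t \<in> {t. \<exists>k\<in>{1..n}. (\<phi> \<circ> \<tau>) t \<in> surface_edge n k}"
    then obtain k where "k \<in> {1..n}" "\<phi> (\<tau> t) \<in> surface_edge n k" by auto
    then show "t \<in> ft ` Sand" using lab_cases phi_crossing_ft by (metis imageI)
  qed
  have "\<exists>j :: int \<Rightarrow> int. strict_mono j \<and> range j = Sand"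
    using Sand_above Sand_below by (intro int_set_enumeration) auto
  then have ex: "\<exists>d. ksl s d" unfolding ksl_def S by blast
  have "cutting_sequence n (\<phi> \<circ> \<tau>) d" if dk: "ksl s d" for d
  proof -
    obtain j where j: "strict_mono j" "range j = Sand" "d = s \<circ> j" using dk unfolding ksl_def S by blast
    have jS: "j i \<in> Sand" for i using j(2) by blast
    have "strict_mono (ft \<circ> j)" using ft_mono[OF jS jS] j(1) by (auto simp: strict_mono_def)
    moreover have "range (ft \<circ> j) = ft ` Sand" using j(2) by (metis image_comp)
    moreover have "d i \<in> {1..n} \<and> (\<phi> \<circ> \<tau>) ((ft \<circ> j) i) \<in> surface_edge n (d i)" for i
      using ft_edge[OF jS[of i]] lab_range[OF kappa(1,2)] by (simp add: j(3) s)
    ultimately show ?thesis unfolding cutting_sequence_def range_ft by blast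
  qed
  moreover have "ksl s d" if cut: "cutting_sequence n (\<phi> \<circ> \<tau>) d" for d
  proof -
    obtain c' where c': "strict_mono c'" "range c' = ft ` Sand"
      "\<And>i. d i \<in> {1..n} \<and> (\<phi> \<circ> \<tau>) (c' i) \<in> surface_edge n (d i)"
      using cut unfolding cutting_sequence_def range_ft by blast
    have "\<forall>i. \<exists>x. x \<in> Sand \<and> c' i = ft x" using c'(2) by blast
    then obtain j where j: "\<And>i. j i \<in> Sand" "\<And>i. c' i = ft (j i)" by metis
    have inj_ft: "x = y" if "x \<in> Sand" "y \<in> Sand" "ft x = ft y" for x y
      using ft_mono[OF that(1,2)] ft_mono[OF that(2,1)] that(3) by linarith
    have "strict_mono j"
    proof (rule strict_monoI)
      fix x y :: int assume "x < y"
      then have "ft (j x) < ft (j y)" using c'(1) j(2) by (metis strict_monoD)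
      then show "j x < j y" using ft_mono[OF j(1) j(1), of y x] by (cases "j x" "j y" rule: linorder_cases) auto
    qed
    moreover have "range j = Sand"
    proof (intro subset_antisym subsetI)
      fix x assume x: "x \<in> Sand"
      then obtain i where "ft x = c' i" using c'(2) by (metis imageI imageE)
      then have "x = j i" using inj_ft[OF x j(1)] j(2) by simp
      then show "x \<in> range j" by blast
    qed (use j(1) in blast)
    moreover have "d = s \<circ> j"
    proof
      fix i
      obtain k where k: "0 \<le> k" "k < N" "d i = lab k" using c'(3)[of i] lab_cases by blast
      have "\<phi> (\<tau> (c' i)) \<in> surface_edge n (lab k)" using c'(3)[of i] k(3) by simp
      moreover have "\<phi> (\<tau> (c' i)) \<in> surface_edge n (lab (\<kappa> (j i)))" using ft_edge[OF j(1)[of i]] j(2)[of i] by simp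
      ultimately have "k = \<kappa> (j i)" by (rule edge_unique[OF phi_regp[OF regp_tau] k(1,2) kappa(1,2)])
      then show "d i = (s \<circ> j) i" by (simp add: s k(3))
    qed
    ultimately show ?thesis unfolding ksl_def S by blast
  qed
  ultimately show ?thesis using ex by blast
qed

end

theorem theorem6p4:
  fixes n :: nat
    and \<phi> :: "point \<Rightarrow> point"
    and \<tau> :: "real \<Rightarrow> point"
    and v :: "real^2"
    and s :: "int \<Rightarrow> nat"
  assumes "odd n" and "n \<ge> 3"
    and "affine_automorphism n (flip ** M n) \<phi>"
    and "trajectory n v \<tau>" and "v \<in> standard_sector n"
    and "cutting_sequence n \<tau> s"
  shows "(\<exists>d. ksl s d) \<and> (\<forall>d. cutting_sequence n (\<phi> \<circ> \<tau>) d \<longleftrightarrow> ksl s d)"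
proof -
  interpret veech_automorphism n \<phi> by unfold_locales (fact assms)+
  have v: "v \<noteq> 0" using assms(4) by (simp add: trajectory_def)
  obtain w \<sigma> where w: "v = Lam w" "w \<noteq> 0" "\<sigma> = 1 \<or> \<sigma> = - 1" "\<sigma> * fst w \<ge> 0" "\<sigma> * snd w \<le> 0"
    using sector_Lam[OF assms(5) v] by blast
  have reg: "regp (\<tau> t)" for t using assms(4) by (simp add: trajectory_def regp_def)
  have "straight UNIV w \<tau>" unfolding straight_def
  proof (intro ballI conjI)
    fix t
    show "\<tau> t \<in> surface n" using reg by (rule regp_surface)
    obtain e where e: "e > 0" "\<And>u. \<bar>u\<bar> < e \<Longrightarrow> displaced (\<tau> t) (u *\<^sub>R v) (\<tau> (t + u))"
      using assms(4) unfolding trajectory_def by blast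
    show "\<forall>\<^sub>F u in nhds 0. t + u \<in> UNIV \<longrightarrow> displaced (\<tau> t) (Lam (u *\<^sub>R w)) (\<tau> (t + u))"
      unfolding eventually_nhds_metric using e by (intro exI[of _ e]) (auto simp: w(1) Lam_scale dist_real_def)
  qed
  obtain c where c: "strict_mono c" "range c = {t. \<exists>k\<in>{1..n}. \<tau> t \<in> surface_edge n k}"
    "\<And>i. s i \<in> {1..n} \<and> \<tau> (c i) \<in> surface_edge n (s i)"
    using assms(6) unfolding cutting_sequence_def by blast
  \<comment> \<open>The labels are renumbered in zigzag order, in which successively crossed edges
    are neighbours.\<close>
  have "\<forall>i. \<exists>k. 0 \<le> k \<and> k < int n \<and> s i = lab k" using c(3) lab_cases by metis
  then obtain \<kappa> where \<kappa>: "\<And>i. 0 \<le> \<kappa> i" "\<And>i. \<kappa> i < int n" "\<And>i. s i = lab (\<kappa> i)" by metis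
  have "(\<exists>k\<in>{1..n}. \<tau> t \<in> surface_edge n k) \<longleftrightarrow> (\<exists>k. 0 \<le> k \<and> k < int n \<and> \<tau> t \<in> surface_edge n (lab k))" for t
    using lab_cases lab_range by metis
  then interpret veech_trajectory n \<phi> \<tau> w \<sigma> c \<kappa>
    using c(1,2) c(3)[unfolded \<kappa>(3)] \<kappa>(1,2) w reg \<open>straight UNIV w \<tau>\<close> by unfold_locales auto
  show ?thesis by (rule derivation) (rule \<kappa>(3))
qed

end
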